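(* Let $B$ be a nonconstant inner function and $\Theta$ an inner function, and suppose that $\psi,\phi\in L^2$ satisfy the following conditions: (a) the operators $A^B_{\bar B^j\psi}$ $(j\in\mathbb{Z})$ are bounded, and are nonzero only for a finite number of $j\in\mathbb{Z}$; (b) $A^\Theta_\phi$ is bounded; (c) $\psi\,(\phi\circ B)\in L^2$. Then $A^{\Theta\circ B}_{\psi(\phi\circ B)}$ is bounded, and $$A^{\Theta\circ B}_{\psi(\phi\circ B)}\,\omega_B=\omega_B\Big(\sum_{j}\big(A^B_{\bar B^j\psi}\otimes A^\Theta_{z^j\phi}\big)\Big),$$ where the sum is over the finitely many $j\in\mathbb{Z}$ with $A^B_{\bar B^j\psi}\neq 0$.
   Context: $L^2=L^2(\mathbb{T},dm)$ with $m$ normalized Lebesgue measure on the unit circle $\mathbb{T}$; $H^2\subset L^2$ is the Hardy space (negative Fourier coefficients equal to $0$), $H^\infty=H^2\cap L^\infty$. An inner function is $\Theta\in H^2$ with $|\Theta|=1$ a.e. on $\mathbb{T}$. The model space is $K_\Theta=H^2\ominus\Theta H^2$, and $P_\Theta$ is the orthogonal projection of $L^2$ onto $K_\Theta$. For $\phi\in L^2$ the (possibly unbounded) truncated Toeplitz operator $A^\Theta_\phi$ is $A^\Theta_\phi f=P_\Theta(\phi f)$, defined on the dense subspace $K_\Theta\cap H^\infty$ of $K_\Theta$; it is called bounded if it extends to a bounded operator on $K_\Theta$, and the extension is denoted by the same symbol. If $A^\Theta_\phi$ is bounded, then so is $A^\Theta_{z^j\phi}$ for every $j\in\mathbb{Z}$.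 For an inner function $B$ (nonconstant), $f\circ B$ for $f\in L^2$ means composition with the boundary values of $B$. The formula $h\otimes f\mapsto h\,(f\circ B)$ extends linearly to a unitary operator $\Omega_B:K_B\otimes L^2\to L^2$ (Hilbert space tensor product), and $\Omega_B$ maps $K_B\otimes K_\Theta$ onto $K_{\Theta\circ B}$; $\omega_B:K_B\otimes K_\Theta\to K_{\Theta\circ B}$ denotes the restriction of $\Omega_B$ to $K_B\otimes K_\Theta$. *)

theory Defs
  imports "HOL-Probability.Probability"
begin

text \<open>
  Elements of \<open>L\<^sup>2(M)\<close> are represented by square-integrable functions; identities between
  elements of \<open>L\<^sup>2(M)\<close> are therefore always stated almost everywhere with respect to \<open>M\<close>.
\<close>

definition L2 :: "'a measure \<Rightarrow> ('a \<Rightarrow> complex) set" where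
  "L2 M = {f \<in> borel_measurable M. integrable M (\<lambda>x. (cmod (f x))\<^sup>2)}"

definition L2_inner :: "'a measure \<Rightarrow> ('a \<Rightarrow> complex) \<Rightarrow> ('a \<Rightarrow> complex) \<Rightarrow> complex" where
  "L2_inner M f g = (LINT x|M. f x * cnj (g x))"

definition L2_norm :: "'a measure \<Rightarrow> ('a \<Rightarrow> complex) \<Rightarrow> real" where
  "L2_norm M f = sqrt (LINT x|M. (cmod (f x))\<^sup>2)"

text \<open>
  Bounded complex-linear operators from a subspace \<open>K\<close> of \<open>L\<^sup>2(M)\<close> to a subspace \<open>L\<close> of
  \<open>L\<^sup>2(N)\<close>. Linearity and the norm bound together force \<open>T\<close> to respect a.e. equality, so \<open>T\<close>
  does induce an operator on the spaces of equivalence classes.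
\<close>

definition bounded_operator ::
  "'a measure \<Rightarrow> ('a \<Rightarrow> complex) set \<Rightarrow> 'b measure \<Rightarrow> ('b \<Rightarrow> complex) set
    \<Rightarrow> (('a \<Rightarrow> complex) \<Rightarrow> ('b \<Rightarrow> complex)) \<Rightarrow> bool" where
  "bounded_operator M K N L T \<longleftrightarrow>
     (\<forall>f\<in>K. T f \<in> L) \<and>
     (\<forall>f\<in>K. \<forall>g\<in>K. \<forall>a b. AE x in N. T (\<lambda>y. a * f y + b * g y) x = a * T f x + b * T g x) \<and>
     (\<exists>C. \<forall>f\<in>K. L2_norm N (T f) \<le> C * L2_norm M f)"

text \<open>The orthogonal projection of \<open>L\<^sup>2(M)\<close> onto a closed subspace \<open>K\<close>; unique up to a.e. equality.\<close>

definition L2_proj :: "'a measure \<Rightarrow> ('a \<Rightarrow> complex) set \<Rightarrow> ('a \<Rightarrow> complex) \<Rightarrow> ('a \<Rightarrow> complex)" where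
  "L2_proj M K f = (SOME g. g \<in> K \<and> (\<forall>k\<in>K. L2_inner M (\<lambda>x. f x - g x) k = 0))"

text \<open>
  Normalized Lebesgue measure on the unit circle, as a Borel measure on the complex plane
  concentrated on the circle. Values of functions off the circle are thus irrelevant.
\<close>

definition circle :: "complex measure" where
  "circle = distr (uniform_measure lborel {0..<2 * pi}) borel cis"

definition fourier_coeff :: "(complex \<Rightarrow> complex) \<Rightarrow> int \<Rightarrow> complex" where
  "fourier_coeff f n = (LINT z|circle. f z * z powi (- n))"

definition hardy2 :: "(complex \<Rightarrow> complex) set" where
  "hardy2 = {f \<in> L2 circle. \<forall>n<0. fourier_coeff f n = 0}"

definition hardy_inf :: "(complex \<Rightarrow> complex) set" where
  "hardy_inf = {f \<in> hardy2. \<exists>C. AE z in circle. cmod (f z) \<le> C}"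

definition inner_function :: "(complex \<Rightarrow> complex) \<Rightarrow> bool" where
  "inner_function \<Theta> \<longleftrightarrow> \<Theta> \<in> hardy2 \<and> (AE z in circle. cmod (\<Theta> z) = 1)"

definition nonconstant :: "(complex \<Rightarrow> complex) \<Rightarrow> bool" where
  "nonconstant f \<longleftrightarrow> \<not> (\<exists>c. AE z in circle. f z = c)"

definition model_space :: "(complex \<Rightarrow> complex) \<Rightarrow> (complex \<Rightarrow> complex) set" where
  "model_space \<Theta> = {f \<in> hardy2. \<forall>g\<in>hardy2. L2_inner circle f (\<lambda>z. \<Theta> z * g z) = 0}"

text \<open>
  \<open>tto_extension \<Theta> \<phi> T\<close>: the operator \<open>T\<close> on the model space is a bounded extension of the
  truncated Toeplitz operator \<open>f \<mapsto> P(\<phi> f)\<close>, which is defined for bounded \<open>f\<close> in the model space.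
  As its domain is dense, the extension \<open>tto \<Theta> \<phi>\<close> is unique (up to a.e. equality of its values) if
  it exists.
\<close>

definition tto_extension ::
  "(complex \<Rightarrow> complex) \<Rightarrow> (complex \<Rightarrow> complex) \<Rightarrow> ((complex \<Rightarrow> complex) \<Rightarrow> complex \<Rightarrow> complex) \<Rightarrow> bool"
  where
  "tto_extension \<Theta> \<phi> T \<longleftrightarrow>
     bounded_operator circle (model_space \<Theta>) circle (model_space \<Theta>) T \<and>
     (\<forall>f \<in> model_space \<Theta> \<inter> hardy_inf.
        AE z in circle. T f z = L2_proj circle (model_space \<Theta>) (\<lambda>w. \<phi> w * f w) z)"

definition tto_bounded :: "(complex \<Rightarrow> complex) \<Rightarrow> (complex \<Rightarrow> complex) \<Rightarrow> bool" where
  "tto_bounded \<Theta> \<phi> \<longleftrightarrow> (\<exists>T. tto_extension \<Theta> \<phi> T)"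

definition tto ::
  "(complex \<Rightarrow> complex) \<Rightarrow> (complex \<Rightarrow> complex) \<Rightarrow> (complex \<Rightarrow> complex) \<Rightarrow> (complex \<Rightarrow> complex)" where
  "tto \<Theta> \<phi> = (SOME T. tto_extension \<Theta> \<phi> T)"

definition tto_nonzero :: "(complex \<Rightarrow> complex) \<Rightarrow> (complex \<Rightarrow> complex) \<Rightarrow> bool" where
  "tto_nonzero \<Theta> \<phi> \<longleftrightarrow> \<not> (\<forall>f\<in>model_space \<Theta>. AE z in circle. tto \<Theta> \<phi> f z = 0)"

text \<open>
  The Hilbert space tensor product of two subspaces \<open>K\<close>, \<open>L\<close> of \<open>L\<^sup>2\<close> of the circle, realized
  inside \<open>L\<^sup>2\<close> of the torus: elementary tensors are the functions \<open>(z, w) \<mapsto> h(z) f(w)\<close>, and the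
  tensor product is the closure of the span of the elementary tensors. That this is a tensor
  product of Hilbert spaces is the content of \<open>L2_inner_tensor\<close> below.
\<close>

abbreviation torus :: "(complex \<times> complex) measure" where
  "torus \<equiv> circle \<Otimes>\<^sub>M circle"

definition tensor ::
  "(complex \<Rightarrow> complex) \<Rightarrow> (complex \<Rightarrow> complex) \<Rightarrow> (complex \<times> complex \<Rightarrow> complex)" where
  "tensor h f = (\<lambda>(z, w). h z * f w)"

definition tensor_space ::
  "(complex \<Rightarrow> complex) set \<Rightarrow> (complex \<Rightarrow> complex) set \<Rightarrow> (complex \<times> complex \<Rightarrow> complex) set" where
  "tensor_space K L =
     {F \<in> L2 torus. \<forall>\<epsilon>>0. \<exists>(n::nat) h f. (\<forall>i<n. h i \<in> K \<and> f i \<in> L) \<and>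
        L2_norm torus (\<lambda>p. F p - (\<Sum>i<n. tensor (h i) (f i) p)) < \<epsilon>}"

text \<open>The tensor product of two bounded operators \<open>S\<close> on \<open>K\<close> and \<open>T\<close> on \<open>L\<close>.\<close>

definition tensor_operator ::
  "(complex \<Rightarrow> complex) set \<Rightarrow> (complex \<Rightarrow> complex) set
    \<Rightarrow> ((complex \<Rightarrow> complex) \<Rightarrow> complex \<Rightarrow> complex) \<Rightarrow> ((complex \<Rightarrow> complex) \<Rightarrow> complex \<Rightarrow> complex)
    \<Rightarrow> (complex \<times> complex \<Rightarrow> complex) \<Rightarrow> (complex \<times> complex \<Rightarrow> complex)" where
  "tensor_operator K L S T =
     (SOME R. bounded_operator torus (tensor_space K L) torus (tensor_space K L) R \<and>
        (\<forall>h\<in>K. \<forall>f\<in>L. AE p in torus. R (tensor h f) p = tensor (S h) (T f) p))"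

text \<open>
  The operator determined by \<open>h \<otimes> f \<mapsto> h (f \<circ> B)\<close>. It has to be introduced by its values on
  elementary tensors: \<open>F \<mapsto> (\<lambda>z. F (z, B z))\<close> does not respect a.e. equality on the torus.
\<close>

definition Omega :: "(complex \<Rightarrow> complex) \<Rightarrow> (complex \<times> complex \<Rightarrow> complex) \<Rightarrow> (complex \<Rightarrow> complex)" where
  "Omega B =
     (SOME U. bounded_operator torus (tensor_space (model_space B) (L2 circle)) circle (L2 circle) U \<and>
        (\<forall>h\<in>model_space B. \<forall>f\<in>L2 circle.
           AE z in circle. U (tensor h f) z = h z * (f \<circ> B) z))"

definition omega ::
  "(complex \<Rightarrow> complex) \<Rightarrow> (complex \<Rightarrow> complex)
    \<Rightarrow> (complex \<times> complex \<Rightarrow> complex) \<Rightarrow> (complex \<Rightarrow> complex)" where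
  "omega B \<Theta> = restrict (Omega B) (tensor_space (model_space B) (model_space \<Theta>))"

lemma cis_measurable: "cis \<in> borel_measurable (uniform_measure lborel S)"
  by (subst measurable_cong_sets[of _ borel _ borel])
     (auto intro!: borel_measurable_continuous_onI continuous_intros)

lemma prob_space_circle: "prob_space circle"
  unfolding circle_def
  by (intro prob_space.prob_space_distr prob_space_uniform_measure) (auto intro: cis_measurable)

lemma sets_circle [measurable_cong, simp]: "sets circle = sets borel"
  by (simp add: circle_def)

lemma AE_circle_norm: "AE z in circle. cmod z = 1"
  unfolding circle_def by (subst AE_distr_iff) (auto intro: cis_measurable)

interpretation circle: prob_space circle
  by (rule prob_space_circle)

interpretation torus: pair_sigma_finite circle circle ..

lemma L2_mult_cnj_integrable:
  assumes "f \<in> L2 M" "g \<in> L2 M"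
  shows "integrable M (\<lambda>x. f x * cnj (g x))"
proof (rule Bochner_Integration.integrable_bound)
  show "integrable M (\<lambda>x. (cmod (f x))\<^sup>2 + (cmod (g x))\<^sup>2)"
    using assms by (auto simp: L2_def)
  have [measurable]: "cnj \<in> borel_measurable borel"
    by (intro borel_measurable_continuous_onI continuous_intros)
  have [measurable]: "f \<in> borel_measurable M" "g \<in> borel_measurable M"
    using assms by (auto simp: L2_def)
  show "(\<lambda>x. f x * cnj (g x)) \<in> borel_measurable M"
    by measurable
  have "a * b \<le> a\<^sup>2 + b\<^sup>2" if "0 \<le> a" "0 \<le> b" for a b :: real
    using sum_squares_bound[of a b] mult_nonneg_nonneg[OF that] by linarith
  then show "AE x in M. norm (f x * cnj (g x)) \<le> norm ((cmod (f x))\<^sup>2 + (cmod (g x))\<^sup>2)"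
    by (auto simp: norm_mult)
qed

lemma integrable_torus_times:
  fixes a b :: "complex \<Rightarrow> 'b::{real_normed_field, banach, second_countable_topology}"
  assumes "integrable circle a" "integrable circle b"
  shows "integrable torus (\<lambda>p. a (fst p) * b (snd p))"
proof (rule torus.Fubini_integrable)
  show "(\<lambda>p. a (fst p) * b (snd p)) \<in> borel_measurable torus"
    using assms by (auto intro!: borel_measurable_times)
  have "(\<lambda>x. LINT y|circle. norm (a (fst (x, y)) * b (snd (x, y))))
      = (\<lambda>x. norm (a x) * (LINT y|circle. norm (b y)))"
    by (auto simp: norm_mult)
  then show "integrable circle (\<lambda>x. LINT y|circle. norm (a (fst (x, y)) * b (snd (x, y))))"
    using assms by (auto intro!: integrable_mult_left)
  show "AE x in circle. integrable circle (\<lambda>y. a (fst (x, y)) * b (snd (x, y)))"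
    using assms by auto
qed

lemma tensor_L2:
  assumes "h \<in> L2 circle" "f \<in> L2 circle"
  shows "tensor h f \<in> L2 torus"
proof -
  have "integrable torus (\<lambda>p. (cmod (h (fst p)))\<^sup>2 * (cmod (f (snd p)))\<^sup>2)"
    using assms integrable_torus_times[of "\<lambda>x. (cmod (h x))\<^sup>2" "\<lambda>x. (cmod (f x))\<^sup>2"]
    by (auto simp: L2_def)
  moreover have "(\<lambda>p. h (fst p) * f (snd p)) \<in> borel_measurable torus"
    using assms by (auto simp: L2_def intro!: borel_measurable_times)
  ultimately show ?thesis
    by (auto simp: L2_def tensor_def case_prod_beta' norm_mult power_mult_distrib)
qed

lemma L2_inner_tensor:
  assumes "h \<in> L2 circle" "f \<in> L2 circle" "h' \<in> L2 circle" "f' \<in> L2 circle"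
  shows "L2_inner torus (tensor h f) (tensor h' f') = L2_inner circle h h' * L2_inner circle f f'"
proof -
  let ?a = "\<lambda>x. h x * cnj (h' x)" and ?b = "\<lambda>y. f y * cnj (f' y)"
  have "integrable torus (\<lambda>p. ?a (fst p) * ?b (snd p))"
    using assms by (intro integrable_torus_times L2_mult_cnj_integrable)
  from torus.integral_fst'[OF this]
  have "(LINT p|torus. ?a (fst p) * ?b (snd p)) = (LINT x|circle. LINT y|circle. ?a x * ?b y)"
    by simp
  also have "\<dots> = L2_inner circle h h' * L2_inner circle f f'"
    by (simp add: L2_inner_def)
  finally show ?thesis
    by (simp add: L2_inner_def tensor_def case_prod_beta' mult_ac)
qed

end

theory Submission
  imports Defs
begin

text \<open>
  For \<open>h\<close> in \<open>K\<^sub>B\<close> the moments \<open>\<integral> |h|\<^sup>2 B\<^sup>n dm\<close> vanish for \<open>n \<noteq> 0\<close>, so \<open>B\<close> pushes \<open>|h|\<^sup>2 dm\<close> forward to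
  \<open>\<parallel>h\<parallel>\<^sup>2 dm\<close>. This makes \<open>h \<otimes> f \<mapsto> h (f \<circ> B)\<close> isometric; taking for \<open>h\<close> the projection
  \<open>1 - cnj (B(0)) B\<close> of \<open>1\<close>, which is bounded below, it also makes composition with \<open>B\<close> bounded on
  \<open>L\<^sup>2\<close>. Projections of monomials are bounded functions spanning dense subspaces of the model spaces,
  and on products \<open>h (f \<circ> B)\<close> of these the operator identity reduces to
  \<open>\<integral> u (v \<circ> B) dm = \<Sum>\<^sub>j (\<integral> cnj(B)\<^sup>j u dm) (\<integral> z\<^sup>j v dm)\<close> with \<open>u = \<psi> h cnj(h')\<close> and \<open>v = \<phi> f cnj(f')\<close>, the
  expansion of \<open>v\<close> in its Fourier series. Since \<open>\<psi> (\<phi> \<circ> B)\<close> is only in \<open>L\<^sup>2\<close>, the identity is then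
  extended in two steps, first in the one argument against a fixed bounded function and then, for a
  bounded first argument, in the other.
\<close>

section \<open>Square-integrable functions\<close>

text \<open>Multiplication by \<open>\<psi> (\<phi> \<circ> B)\<close> may be unbounded on
  \<open>L2\<close>, so a norm estimate for the truncated operator cannot simply be read off from
  its symbol. The bound is taken from the other side: the finite sum of tensor operators is bounded,
  \<open>Omega B\<close> is isometric, and the operator \<open>A\<close> carried over to the model
  space of \<open>\<Theta> \<circ> B\<close> is only afterwards recognised, through inner products,
  as the truncated Toeplitz operator. The finiteness in (a) serves twice: it makes the sum a bounded
  operator, and it cuts the Fourier expansion of \<open>v\<close> down to finitely many terms, so
  that no convergence question arises. A second obstacle is that elements are functions while
  equalities hold only almost everywhere. Operators are therefore prescribed by linear relations
  between functions; the norm bound makes such a relation single-valued up to null sets, and its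
  closure is the graph of the operator.\<close>

lemma L2_D:
  assumes "f \<in> L2 M"
  shows "f \<in> borel_measurable M" "integrable M (\<lambda>x. (cmod (f x))\<^sup>2)"
  using assms by (auto simp: L2_def)

lemma L2_bound:
  assumes "f \<in> borel_measurable M" "integrable M g" "AE x in M. (cmod (f x))\<^sup>2 \<le> g x"
  shows "f \<in> L2 M"
  unfolding L2_def
proof (intro CollectI conjI)
  show "integrable M (\<lambda>x. (cmod (f x))\<^sup>2)"
    by (rule Bochner_Integration.integrable_bound[OF assms(2)])
       (use assms in \<open>auto elim!: eventually_mono\<close>)
qed (rule assms)

lemma L2_lincomb:
  assumes "f \<in> L2 M" "g \<in> L2 M"
  shows "(\<lambda>x. a * f x + b * g x) \<in> L2 M"
proof (rule L2_bound)
  show "(\<lambda>x. a * f x + b * g x) \<in> borel_measurable M"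
    using assms[THEN L2_D(1)] by measurable
  show "integrable M (\<lambda>x. 2 * (cmod a)\<^sup>2 * (cmod (f x))\<^sup>2 + 2 * (cmod b)\<^sup>2 * (cmod (g x))\<^sup>2)"
    using assms[THEN L2_D(2)] by auto
  have "(cmod (u + v))\<^sup>2 \<le> 2 * (cmod u)\<^sup>2 + 2 * (cmod v)\<^sup>2" for u v
  proof -
    have "(cmod (u + v))\<^sup>2 \<le> (cmod u + cmod v)\<^sup>2"
      by (intro power_mono norm_triangle_ineq norm_ge_zero)
    also have "\<dots> \<le> 2 * (cmod u)\<^sup>2 + 2 * (cmod v)\<^sup>2"
      using sum_squares_bound[of "cmod u" "cmod v"] by (simp add: power2_sum)
    finally show ?thesis .
  qed
  from this[of "a * f x" "b * g x" for x] show "AE x in M. (cmod (a * f x + b * g x))\<^sup>2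
      \<le> 2 * (cmod a)\<^sup>2 * (cmod (f x))\<^sup>2 + 2 * (cmod b)\<^sup>2 * (cmod (g x))\<^sup>2"
    by (auto simp: norm_mult power_mult_distrib mult_ac)
qed

lemma L2_zero: "(\<lambda>x. 0) \<in> L2 M"
  by (auto simp: L2_def)

lemma L2_diff: "f \<in> L2 M \<Longrightarrow> g \<in> L2 M \<Longrightarrow> (\<lambda>x. f x - g x) \<in> L2 M"
  using L2_lincomb[of f M g 1 "-1"] by simp

lemma L2_scale: "f \<in> L2 M \<Longrightarrow> (\<lambda>x. c * f x) \<in> L2 M"
  using L2_lincomb[of f M f c 0] by simp

lemma L2_cnj: "f \<in> L2 M \<Longrightarrow> (\<lambda>x. cnj (f x)) \<in> L2 M"
  by (rule L2_bound[where g = "\<lambda>x. (cmod (f x))\<^sup>2"])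
     (auto simp: L2_def intro!: borel_measurable_continuous_on[where f = cnj] continuous_intros)

lemma L2_mult_bounded:
  assumes "f \<in> L2 M" "g \<in> borel_measurable M" "AE x in M. cmod (g x) \<le> C"
  shows "(\<lambda>x. f x * g x) \<in> L2 M"
proof (rule L2_bound)
  show "(\<lambda>x. f x * g x) \<in> borel_measurable M"
    using assms by (auto dest: L2_D)
  show "integrable M (\<lambda>x. C\<^sup>2 * (cmod (f x))\<^sup>2)"
    using L2_D(2)[OF assms(1)] by simp
  have "(cmod (f x * g x))\<^sup>2 \<le> C\<^sup>2 * (cmod (f x))\<^sup>2" if "cmod (g x) \<le> C" for x
    using power_mono[OF that norm_ge_zero, of 2]
    by (simp add: norm_mult power_mult_distrib mult.commute[of "(cmod (f x))\<^sup>2"] mult_right_mono)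
  then show "AE x in M. (cmod (f x * g x))\<^sup>2 \<le> C\<^sup>2 * (cmod (f x))\<^sup>2"
    using assms(3) by (auto elim!: eventually_mono)
qed

lemma L2_cong_AE:
  assumes "f \<in> L2 M" "g \<in> borel_measurable M" "AE x in M. f x = g x"
  shows "g \<in> L2 M"
  by (rule L2_bound[OF assms(2) L2_D(2)[OF assms(1)]])
     (use assms(3) in \<open>auto elim!: eventually_mono\<close>)

lemma (in finite_measure) L2_bounded:
  assumes "f \<in> borel_measurable M" "AE x in M. cmod (f x) \<le> C"
  shows "f \<in> L2 M"
proof -
  have "(\<lambda>x. 1 * f x) \<in> L2 M"
    by (rule L2_mult_bounded[OF _ assms]) (auto simp: L2_def)
  then show ?thesis by simp
qed

lemma (in finite_measure) L2_integrable:
  assumes "f \<in> L2 M"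
  shows "integrable M f"
  using L2_mult_cnj_integrable[OF assms, of "\<lambda>_. 1"] by (simp add: L2_def)

section \<open>Norm, inner product and Cauchy-Schwarz\<close>

lemma L2_norm_nonneg [simp]: "0 \<le> L2_norm M f"
  by (simp add: L2_norm_def)

lemma L2_norm_sq: "(L2_norm M f)\<^sup>2 = (LINT x|M. (cmod (f x))\<^sup>2)"
  by (simp add: L2_norm_def)

lemma L2_inner_self: "L2_inner M f f = complex_of_real ((L2_norm M f)\<^sup>2)"
  unfolding L2_inner_def L2_norm_sq
  by (simp add: complex_mult_cnj cmod_power2 flip: integral_complex_of_real)

lemma L2_norm_zero [simp]: "L2_norm M (\<lambda>x. 0) = 0"
  by (simp add: L2_norm_def)

lemma L2_norm_scale: "L2_norm M (\<lambda>x. c * f x) = cmod c * L2_norm M f"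
  by (simp add: L2_norm_def norm_mult power_mult_distrib real_sqrt_mult)

lemma L2_norm_minus: "L2_norm M (\<lambda>x. f x - g x) = L2_norm M (\<lambda>x. g x - f x)"
  by (simp add: L2_norm_def norm_minus_commute)

lemma L2_norm_cong_AE:
  assumes "f \<in> L2 M" "g \<in> L2 M" "AE x in M. f x = g x"
  shows "L2_norm M f = L2_norm M g"
proof -
  have "(LINT x|M. (cmod (f x))\<^sup>2) = (LINT x|M. (cmod (g x))\<^sup>2)"
    by (rule integral_cong_AE) (use assms in \<open>auto simp: L2_def elim!: eventually_mono\<close>)
  then show ?thesis by (simp add: L2_norm_def)
qed

lemma L2_norm_eq_0_iff:
  assumes "f \<in> L2 M"
  shows "L2_norm M f = 0 \<longleftrightarrow> (AE x in M. f x = 0)"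
  using integral_nonneg_eq_0_iff_AE[OF L2_D(2)[OF assms]] by (simp add: L2_norm_def)

lemma L2_inner_cong_AE:
  assumes "f \<in> L2 M" "f' \<in> L2 M" "g \<in> L2 M" "g' \<in> L2 M"
    "AE x in M. f x = f' x" "AE x in M. g x = g' x"
  shows "L2_inner M f g = L2_inner M f' g'"
  unfolding L2_inner_def
  by (rule integral_cong_AE)
     (use assms in \<open>auto intro!: borel_measurable_integrable L2_mult_cnj_integrable\<close>)

lemma L2_inner_commute: "L2_inner M g f = cnj (L2_inner M f g)"
  unfolding L2_inner_def by (subst Bochner_Integration.integral_cnj[symmetric]) (simp add: mult.commute)

lemma L2_inner_lincomb_left:
  assumes "f \<in> L2 M" "g \<in> L2 M" "k \<in> L2 M"
  shows "L2_inner M (\<lambda>x. a * f x + b * g x) k = a * L2_inner M f k + b * L2_inner M g k"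
  using L2_mult_cnj_integrable[of _ M k] assms
  by (simp add: L2_inner_def distrib_right mult.assoc)

lemma L2_inner_lincomb_right:
  assumes "f \<in> L2 M" "g \<in> L2 M" "k \<in> L2 M"
  shows "L2_inner M k (\<lambda>x. a * f x + b * g x) = cnj a * L2_inner M k f + cnj b * L2_inner M k g"
  using L2_inner_lincomb_left[OF assms, of a b]
  by (subst (1 2 3) L2_inner_commute) simp

lemma L2_inner_diff_left:
  assumes "f \<in> L2 M" "g \<in> L2 M" "k \<in> L2 M"
  shows "L2_inner M (\<lambda>x. f x - g x) k = L2_inner M f k - L2_inner M g k"
  using L2_inner_lincomb_left[OF assms, of 1 "-1"] by simp

lemma L2_inner_diff_right:
  assumes "f \<in> L2 M" "g \<in> L2 M" "k \<in> L2 M"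
  shows "L2_inner M k (\<lambda>x. f x - g x) = L2_inner M k f - L2_inner M k g"
  using L2_inner_lincomb_right[OF assms, of 1 "-1"] by simp

lemma L2_inner_zero [simp]: "L2_inner M (\<lambda>x. 0) f = 0" "L2_inner M f (\<lambda>x. 0) = 0"
  by (simp_all add: L2_inner_def)

lemma L2_norm_mult_unimodular:
  assumes "f \<in> L2 M" "g \<in> borel_measurable M" "AE x in M. cmod (g x) = 1"
  shows "L2_norm M (\<lambda>x. f x * g x) = L2_norm M f"
proof -
  have "(LINT x|M. (cmod (f x * g x))\<^sup>2) = (LINT x|M. (cmod (f x))\<^sup>2)"
  proof (rule integral_cong_AE)
    show "AE x in M. (cmod (f x * g x))\<^sup>2 = (cmod (f x))\<^sup>2"
      using assms(3) by eventually_elim (simp add: norm_mult)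
  qed (use assms(2) L2_D(1)[OF assms(1)] in measurable)
  then show ?thesis by (simp add: L2_norm_def)
qed

lemma L2_norm_add_scale_sq:
  assumes "f \<in> L2 M" "g \<in> L2 M"
  shows "(L2_norm M (\<lambda>x. f x + c * g x))\<^sup>2
    = (L2_norm M f)\<^sup>2 + 2 * Re (cnj c * L2_inner M f g) + (cmod c)\<^sup>2 * (L2_norm M g)\<^sup>2"
proof -
  have fg: "(\<lambda>x. f x + c * g x) \<in> L2 M"
    using L2_lincomb[OF assms, of 1 c] by simp
  have "complex_of_real ((L2_norm M (\<lambda>x. f x + c * g x))\<^sup>2)
      = L2_inner M (\<lambda>x. 1 * f x + c * g x) (\<lambda>x. 1 * f x + c * g x)"
    by (simp add: L2_inner_self)
  also have "\<dots> = 1 * (cnj 1 * L2_inner M f f + cnj c * L2_inner M f g)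
      + c * (cnj 1 * L2_inner M g f + cnj c * L2_inner M g g)"
    by (subst L2_inner_lincomb_left[OF assms L2_lincomb[OF assms]])
       (simp only: L2_inner_lincomb_right[OF assms assms(1)] L2_inner_lincomb_right[OF assms assms(2)])
  finally have "complex_of_real ((L2_norm M (\<lambda>x. f x + c * g x))\<^sup>2) = \<dots>" .
  then have "Re (complex_of_real ((L2_norm M (\<lambda>x. f x + c * g x))\<^sup>2)) = Re \<dots>"
    by simp
  also have "\<dots> = (L2_norm M f)\<^sup>2 + 2 * Re (cnj c * L2_inner M f g)
      + ((Re c)\<^sup>2 + (Im c)\<^sup>2) * (L2_norm M g)\<^sup>2"
    by (simp add: L2_inner_self L2_inner_commute[of M g f] power2_eq_square algebra_simps)
  finally show ?thesis
    by (simp add: cmod_power2)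
qed

text \<open>Completing the square: the value is the squared distance from \<open>f\<close> to the
  line through \<open>g\<close>. Its nonnegativity gives the Cauchy-Schwarz inequality, and
  comparing it with a minimal distance gives the orthogonality of the projection.\<close>

lemma L2_norm_add_scale_min:
  assumes "f \<in> L2 M" "g \<in> L2 M" "L2_norm M g \<noteq> 0"
  shows "\<exists>c. (L2_norm M (\<lambda>x. f x + c * g x))\<^sup>2
    = (L2_norm M f)\<^sup>2 - (cmod (L2_inner M f g))\<^sup>2 / (L2_norm M g)\<^sup>2"
proof
  let ?n = "(L2_norm M g)\<^sup>2" and ?i = "L2_inner M f g"
  define c where "c = - ?i / complex_of_real ?n"
  have "cnj c * ?i = - complex_of_real ((cmod ?i)\<^sup>2 / ?n)"
    by (simp add: c_def complex_mult_cnj cmod_power2 mult.commute[of "cnj ?i"])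
  moreover have "cmod c = cmod ?i / ?n"
    by (simp only: c_def norm_divide norm_minus_cancel norm_of_real abs_of_nonneg[OF zero_le_power2])
  ultimately show "(L2_norm M (\<lambda>x. f x + c * g x))\<^sup>2 = (L2_norm M f)\<^sup>2 - (cmod ?i)\<^sup>2 / ?n"
    using L2_norm_add_scale_sq[OF assms(1,2), of c] assms(3) by (simp add: power2_eq_square)
qed

lemma L2_Cauchy_Schwarz:
  assumes "f \<in> L2 M" "g \<in> L2 M"
  shows "cmod (L2_inner M f g) \<le> L2_norm M f * L2_norm M g"
proof (cases "L2_norm M g = 0")
  case True
  then have "AE x in M. g x = 0"
    using assms by (simp add: L2_norm_eq_0_iff)
  then have "L2_inner M f g = L2_inner M f (\<lambda>x. 0)"
    by (intro L2_inner_cong_AE assms L2_zero) auto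
  with True show ?thesis by simp
next
  case False
  obtain c where "(L2_norm M (\<lambda>x. f x + c * g x))\<^sup>2
      = (L2_norm M f)\<^sup>2 - (cmod (L2_inner M f g))\<^sup>2 / (L2_norm M g)\<^sup>2"
    using L2_norm_add_scale_min[OF assms False] by blast
  then have "(cmod (L2_inner M f g))\<^sup>2 / (L2_norm M g)\<^sup>2 \<le> (L2_norm M f)\<^sup>2"
    using zero_le_power2[of "L2_norm M (\<lambda>x. f x + c * g x)"] by linarith
  then have "(cmod (L2_inner M f g))\<^sup>2 \<le> (L2_norm M f * L2_norm M g)\<^sup>2"
    using False by (simp add: divide_le_eq power_mult_distrib)
  then show ?thesis
    by (rule power2_le_imp_le) simp
qed

lemma L2_norm_add_le:
  assumes "f \<in> L2 M" "g \<in> L2 M"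
  shows "L2_norm M (\<lambda>x. f x + g x) \<le> L2_norm M f + L2_norm M g"
proof (rule power2_le_imp_le)
  have "(L2_norm M (\<lambda>x. f x + g x))\<^sup>2 = (L2_norm M f)\<^sup>2 + 2 * Re (L2_inner M f g) + (L2_norm M g)\<^sup>2"
    using L2_norm_add_scale_sq[OF assms, of 1] by simp
  also have "Re (L2_inner M f g) \<le> L2_norm M f * L2_norm M g"
    using L2_Cauchy_Schwarz[OF assms] complex_Re_le_cmod order_trans by blast
  finally show "(L2_norm M (\<lambda>x. f x + g x))\<^sup>2 \<le> (L2_norm M f + L2_norm M g)\<^sup>2"
    by (simp add: power2_sum)
qed simp

lemma L2_norm_triangle:
  assumes "f \<in> L2 M" "g \<in> L2 M" "h \<in> L2 M"
  shows "L2_norm M (\<lambda>x. f x - h x) \<le> L2_norm M (\<lambda>x. f x - g x) + L2_norm M (\<lambda>x. g x - h x)"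
  using L2_norm_add_le[of "\<lambda>x. f x - g x" M "\<lambda>x. g x - h x"] assms by (simp add: L2_diff)

lemma L2_norm_lincomb_le:
  assumes "f \<in> L2 M" "g \<in> L2 M"
  shows "L2_norm M (\<lambda>x. a * f x + b * g x) \<le> cmod a * L2_norm M f + cmod b * L2_norm M g"
  using L2_norm_add_le[OF assms[THEN L2_scale], of a b] by (simp add: L2_norm_scale)

lemma L2_norm_lincomb_diff_less:
  assumes "f \<in> L2 M" "g \<in> L2 M" "f' \<in> L2 M" "g' \<in> L2 M" and e: "e > 0"
    and "L2_norm M (\<lambda>x. f x - f' x) < e / (cmod a + cmod b + 1)"
    and "L2_norm M (\<lambda>x. g x - g' x) < e / (cmod a + cmod b + 1)"
  shows "L2_norm M (\<lambda>x. a * f x + b * g x - (a * f' x + b * g' x)) < e"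
proof -
  have pos: "0 < cmod a + cmod b + 1"
    using norm_ge_zero[of a] norm_ge_zero[of b] by linarith
  \<comment> \<open>The summand 1 covers \<open>a = b = 0\<close> and makes the inequality below
    strict.\<close>
  define d where "d = e / (cmod a + cmod b + 1)"
  have d: "d > 0" using pos e by (simp add: d_def)
  have "L2_norm M (\<lambda>x. a * (f x - f' x) + b * (g x - g' x))
      \<le> cmod a * L2_norm M (\<lambda>x. f x - f' x) + cmod b * L2_norm M (\<lambda>x. g x - g' x)"
    by (intro L2_norm_lincomb_le L2_diff assms)
  also have "\<dots> \<le> cmod a * d + cmod b * d"
    using assms(6,7) by (intro add_mono mult_left_mono) (auto simp: d_def)
  also have "\<dots> < (cmod a + cmod b + 1) * d"
    using d by (simp add: algebra_simps)
  also have "\<dots> = e" using pos by (simp add: d_def)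
  finally show ?thesis by (simp add: algebra_simps)
qed

lemma L2_parallelogram:
  assumes "f \<in> L2 M" "g \<in> L2 M"
  shows "(L2_norm M (\<lambda>x. f x + g x))\<^sup>2 + (L2_norm M (\<lambda>x. f x - g x))\<^sup>2
    = 2 * (L2_norm M f)\<^sup>2 + 2 * (L2_norm M g)\<^sup>2"
  using L2_norm_add_scale_sq[OF assms, of 1] L2_norm_add_scale_sq[OF assms, of "-1"] by simp

text \<open>Riesz-Fischer. On a finite measure space the \<open>L1\<close> norm is at most a
  constant times the \<open>L2\<close> norm, so along a subsequence with geometrically small
  increments the series of increments converges absolutely almost everywhere. Fatou's lemma then
  transfers the norm estimates to the pointwise limit.\<close>

lemma (in finite_measure) L2_complete:
  assumes F: "\<And>n. F n \<in> L2 M"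
    and Cauchy: "\<And>e. 0 < e \<Longrightarrow> \<exists>N::nat. \<forall>m\<ge>N. \<forall>n\<ge>N. L2_norm M (\<lambda>x. F m x - F n x) < e"
  obtains f where "f \<in> L2 M" "(\<lambda>n. L2_norm M (\<lambda>x. F n x - f x)) \<longlonglongrightarrow> 0"
proof -
  obtain N where N: "\<And>k m n. m \<ge> N k \<Longrightarrow> n \<ge> N k \<Longrightarrow> L2_norm M (\<lambda>x. F m x - F n x) < (1/2)^k"
    using Cauchy[of "(1/2)^k" for k] by (metis zero_less_power half_gt_zero_iff zero_less_one)
  \<comment> \<open>The running maximum makes \<open>r\<close> monotone, so that \<open>r k\<close>
    and \<open>r (Suc k)\<close> both lie beyond \<open>N k\<close>.\<close>
  define r where "r k = Max (N ` {..k})" for k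
  have rN: "N k \<le> r k" "r k \<le> r (Suc k)" for k
    unfolding r_def by (auto intro!: Max_mono)
  define G where "G k x = F (r k) x" for k x
  have G: "G k \<in> L2 M" for k
    using F by (simp add: G_def[abs_def])
  have [measurable]: "G k \<in> borel_measurable M" for k
    using G[of k] by (rule L2_D)
  let ?c = "sqrt (measure M (space M))"
  have const: "(\<lambda>x. 1) \<in> L2 M" "L2_norm M (\<lambda>x. 1) = ?c"
    by (auto simp: L2_norm_def L2_def)
  have L1: "(LINT x|M. cmod (G (Suc k) x - G k x)) \<le> ?c * (1/2)^k" for k
  proof -
    have D: "(\<lambda>x. complex_of_real (cmod (G (Suc k) x - G k x))) \<in> L2 M"
      by (rule L2_bound[OF _ L2_D(2)[OF L2_diff[OF G G]]]) auto
    have "complex_of_real (LINT x|M. cmod (G (Suc k) x - G k x))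
      = L2_inner M (\<lambda>x. complex_of_real (cmod (G (Suc k) x - G k x))) (\<lambda>x. 1)"
      unfolding L2_inner_def by (simp flip: integral_complex_of_real)
    then have "(LINT x|M. cmod (G (Suc k) x - G k x)) \<le> cmod (L2_inner M (\<lambda>x. complex_of_real (cmod (G (Suc k) x - G k x))) (\<lambda>x. 1))"
      by (metis abs_ge_self norm_of_real)
    also have "\<dots> \<le> L2_norm M (\<lambda>x. complex_of_real (cmod (G (Suc k) x - G k x))) * ?c"
      using L2_Cauchy_Schwarz[OF D const(1)] const(2) by simp
    also have "L2_norm M (\<lambda>x. complex_of_real (cmod (G (Suc k) x - G k x))) = L2_norm M (\<lambda>x. G (Suc k) x - G k x)"
      by (simp add: L2_norm_def)
    also have "L2_norm M (\<lambda>x. G (Suc k) x - G k x) \<le> (1/2)^k"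
      unfolding G_def using N[of k "r (Suc k)" "r k"] rN[of k] by simp
    finally show ?thesis by (simp add: mult.commute[of ?c] mult_right_mono)
  qed
  have int: "integrable M (\<lambda>x. cmod (G (Suc k) x - G k x))" for k
    using L2_integrable[OF L2_diff[OF G G]] by (rule integrable_norm)
  have "(\<integral>\<^sup>+ x. (\<Sum>k. ennreal (cmod (G (Suc k) x - G k x))) \<partial>M) = (\<Sum>k. \<integral>\<^sup>+ x. ennreal (cmod (G (Suc k) x - G k x)) \<partial>M)"
    by (rule nn_integral_suminf) measurable
  also have "\<dots> \<le> (\<Sum>k. ennreal (?c * (1/2)^k))"
    using L1 int by (intro suminf_le) (auto simp: nn_integral_eq_integral intro!: ennreal_leI)
  also have "\<dots> = ennreal (\<Sum>k. ?c * (1/2)^k)"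
    by (intro suminf_ennreal2 summable_mult summable_geometric) auto
  finally have "(\<integral>\<^sup>+ x. (\<Sum>k. ennreal (cmod (G (Suc k) x - G k x))) \<partial>M) \<noteq> \<infinity>"
    by (auto simp: top_unique)
  then have "AE x in M. (\<Sum>k. ennreal (cmod (G (Suc k) x - G k x))) \<noteq> \<infinity>"
    by (intro nn_integral_PInf_AE) measurable
  then have conv: "AE x in M. convergent (\<lambda>k. G k x)"
  proof (rule eventually_mono)
    fix x assume "(\<Sum>k. ennreal (cmod (G (Suc k) x - G k x))) \<noteq> \<infinity>"
    then have "summable (\<lambda>k. cmod (G (Suc k) x - G k x))"
      by (intro summable_suminf_not_top) (auto simp: infinity_ennreal_def)
    then have "summable (\<lambda>k. G (Suc k) x - G k x)"
      by (rule summable_norm_cancel)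
    then have "convergent (\<lambda>n. \<Sum>k<n. G (Suc k) x - G k x)"
      by (simp only: summable_iff_convergent)
    also have "(\<lambda>n. \<Sum>k<n. G (Suc k) x - G k x) = (\<lambda>n. G n x - G 0 x)"
      by (simp add: sum_lessThan_telescope[of "\<lambda>k. G k x"])
    finally show "convergent (\<lambda>k. G k x)"
      by (rule convergent_diff_const_right_iff[THEN iffD1])
  qed
  define f where "f x = lim (\<lambda>k. G k x)" for x
  have [measurable]: "f \<in> borel_measurable M"
    unfolding f_def[abs_def] by measurable
  have lim: "AE x in M. (\<lambda>k. G k x) \<longlonglongrightarrow> f x"
    using conv by (auto simp: f_def convergent_LIMSEQ_iff)
  have nn: "(\<integral>\<^sup>+ x. ennreal ((cmod (g x))\<^sup>2) \<partial>M) = ennreal ((L2_norm M g)\<^sup>2)" if "g \<in> L2 M" for g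
    using L2_D(2)[OF that] by (simp add: L2_norm_sq nn_integral_eq_integral)
  have bd: "(\<integral>\<^sup>+ x. ennreal ((cmod (F m x - f x))\<^sup>2) \<partial>M) \<le> ennreal (((1/2)^k)\<^sup>2)" if "m \<ge> N k" for m k
  proof -
    have [measurable]: "F m \<in> borel_measurable M" using L2_D(1)[OF F] .
    \<comment> \<open>The integrand is rewritten as a \<open>liminf\<close> along the subsequence so
      that Fatou's lemma applies; the indices \<open>r n\<close> are eventually beyond
      \<open>N k\<close>, which bounds each integral.\<close>
    have "(\<integral>\<^sup>+ x. ennreal ((cmod (F m x - f x))\<^sup>2) \<partial>M) = (\<integral>\<^sup>+ x. liminf (\<lambda>n. ennreal ((cmod (F m x - G n x))\<^sup>2)) \<partial>M)"
    proof (rule nn_integral_cong_AE, use lim in \<open>rule eventually_mono\<close>)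
      fix x assume "(\<lambda>k. G k x) \<longlonglongrightarrow> f x"
      then have "(\<lambda>n. ennreal ((cmod (F m x - G n x))\<^sup>2)) \<longlonglongrightarrow> ennreal ((cmod (F m x - f x))\<^sup>2)"
        by (intro tendsto_intros tendsto_ennrealI)
      then show "ennreal ((cmod (F m x - f x))\<^sup>2) = liminf (\<lambda>n. ennreal ((cmod (F m x - G n x))\<^sup>2))"
        by (rule lim_imp_Liminf[OF sequentially_bot, symmetric])
    qed
    also have "\<dots> \<le> liminf (\<lambda>n. \<integral>\<^sup>+ x. ennreal ((cmod (F m x - G n x))\<^sup>2) \<partial>M)"
      by (rule nn_integral_liminf) measurable
    also have "\<dots> \<le> liminf (\<lambda>n::nat. ennreal (((1/2)^k)\<^sup>2))"
    proof (rule Liminf_mono)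
      have "\<forall>\<^sub>F n in sequentially. r n \<ge> N k"
      proof (rule eventually_sequentiallyI[of k])
        fix n assume "k \<le> n"
        then show "N k \<le> r n" unfolding r_def by (intro Max_ge) auto
      qed
      then show "\<forall>\<^sub>F n in sequentially. (\<integral>\<^sup>+ x. ennreal ((cmod (F m x - G n x))\<^sup>2) \<partial>M) \<le> ennreal (((1/2)^k)\<^sup>2)"
      proof (rule eventually_mono)
        fix n assume "r n \<ge> N k"
        then have "L2_norm M (\<lambda>x. F m x - F (r n) x) < (1/2)^k"
          using N that by blast
        then show "(\<integral>\<^sup>+ x. ennreal ((cmod (F m x - G n x))\<^sup>2) \<partial>M) \<le> ennreal (((1/2)^k)\<^sup>2)"
          unfolding G_def by (subst nn[OF L2_diff[OF F F]]) (intro ennreal_leI power_mono, auto)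
      qed
    qed
    also have "\<dots> = ennreal (((1/2)^k)\<^sup>2)"
      by (simp add: Liminf_const)
    finally show ?thesis .
  qed
  have Fmf: "(\<lambda>x. F m x - f x) \<in> L2 M" if "m \<ge> N k" for m k
  proof -
    have [measurable]: "F m \<in> borel_measurable M" using L2_D(1)[OF F] .
    have "(\<integral>\<^sup>+ x. ennreal ((cmod (F m x - f x))\<^sup>2) \<partial>M) < \<infinity>"
      using bd[OF that] by (simp add: le_less_trans ennreal_less_top)
    then show ?thesis
      by (auto simp: L2_def integrable_iff_bounded)
  qed
  have f: "f \<in> L2 M"
    using L2_diff[OF F Fmf[of 0 "N 0"], of "N 0"] by simp
  have le: "L2_norm M (\<lambda>x. F m x - f x) \<le> (1/2)^k" if "m \<ge> N k" for m k
    using bd[OF that] nn[OF L2_diff[OF F f]]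
    by (simp add: power2_le_iff_abs_le abs_le_square_iff)
  have "(\<lambda>n. L2_norm M (\<lambda>x. F n x - f x)) \<longlonglongrightarrow> 0"
  proof (rule LIMSEQ_I)
    fix e :: real assume "e > 0"
    then obtain k where "(1/2)^k < e"
      using real_arch_pow_inv[of e "1/2"] by auto
    then have "norm (L2_norm M (\<lambda>x. F m x - f x) - 0) < e" if "m \<ge> N k" for m
      using le[OF that] by simp
    then show "\<exists>n0. \<forall>n\<ge>n0. norm (L2_norm M (\<lambda>x. F n x - f x) - 0) < e"
      by blast
  qed
  with f that show ?thesis by blast
qed

section \<open>Closed subspaces and bounded operators\<close>

definition L2_subspace :: "'a measure \<Rightarrow> ('a \<Rightarrow> complex) set \<Rightarrow> bool" where
  "L2_subspace M K \<longleftrightarrow> K \<subseteq> L2 M \<and> (\<lambda>x. 0) \<in> K \<and>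
     (\<forall>f\<in>K. \<forall>g\<in>K. \<forall>a b. (\<lambda>x. a * f x + b * g x) \<in> K)"

definition L2_closure :: "'a measure \<Rightarrow> ('a \<Rightarrow> complex) set \<Rightarrow> ('a \<Rightarrow> complex) set" where
  "L2_closure M V = {f \<in> L2 M. \<forall>e>0. \<exists>v\<in>V. L2_norm M (\<lambda>x. f x - v x) < e}"

definition closed_L2_subspace :: "'a measure \<Rightarrow> ('a \<Rightarrow> complex) set \<Rightarrow> bool" where
  "closed_L2_subspace M K \<longleftrightarrow> L2_subspace M K \<and> L2_closure M K \<subseteq> K"

lemma L2_closureE:
  assumes "f \<in> L2_closure M V" "e > 0"
  obtains v where "v \<in> V" "L2_norm M (\<lambda>x. f x - v x) < e"
  using assms unfolding L2_closure_def by blast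

lemma closed_L2_subspace_closureD:
  assumes "closed_L2_subspace M K" "f \<in> L2_closure M K"
  shows "f \<in> K"
  using assms(2) by (rule subsetD[OF assms(1)[unfolded closed_L2_subspace_def, THEN conjunct2]])

lemma L2_subspace_L2: "L2_subspace M K \<Longrightarrow> f \<in> K \<Longrightarrow> f \<in> L2 M"
  by (auto simp: L2_subspace_def)

lemma L2_subspace_zero: "L2_subspace M K \<Longrightarrow> (\<lambda>x. 0) \<in> K"
  by (auto simp: L2_subspace_def)

lemma L2_subspace_lincomb:
  "L2_subspace M K \<Longrightarrow> f \<in> K \<Longrightarrow> g \<in> K \<Longrightarrow> (\<lambda>x. a * f x + b * g x) \<in> K"
  by (auto simp: L2_subspace_def)

lemma L2_subspace_diff: "L2_subspace M K \<Longrightarrow> f \<in> K \<Longrightarrow> g \<in> K \<Longrightarrow> (\<lambda>x. f x - g x) \<in> K"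
  using L2_subspace_lincomb[of M K f g 1 "-1"] by simp

lemma L2_subspace_add: "L2_subspace M K \<Longrightarrow> f \<in> K \<Longrightarrow> g \<in> K \<Longrightarrow> (\<lambda>x. f x + g x) \<in> K"
  using L2_subspace_lincomb[of M K f g 1 1] by simp

lemma L2_subspace_scale: "L2_subspace M K \<Longrightarrow> f \<in> K \<Longrightarrow> (\<lambda>x. c * f x) \<in> K"
  using L2_subspace_lincomb[of M K f f c 0] by simp

lemma L2_subspace_sum:
  assumes "L2_subspace M K" "\<And>i. i \<in> I \<Longrightarrow> f i \<in> K"
  shows "(\<lambda>x. \<Sum>i\<in>I. f i x) \<in> K"
  using assms(2)
proof (induction I rule: infinite_finite_induct)
  case (insert i I)
  then show ?case
    using L2_subspace_add[OF assms(1), of "f i" "\<lambda>x. \<Sum>i\<in>I. f i x"] by simp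
qed (use assms(1) in \<open>auto simp: L2_subspace_zero\<close>)

lemma L2_subspace_UNIV: "L2_subspace M (L2 M)"
  by (auto simp: L2_subspace_def L2_zero L2_lincomb)

lemma closed_L2_subspaceD: "closed_L2_subspace M K \<Longrightarrow> L2_subspace M K"
  by (simp add: closed_L2_subspace_def)

text \<open>A function equal to \<open>f\<close> almost everywhere is at distance 0 from
  \<open>f\<close> and so belongs to the closure. Closedness thus makes a set of functions saturated
  under a.e. equality.\<close>

lemma closed_L2_subspace_cong_AE:
  assumes "closed_L2_subspace M K" "f \<in> K" "g \<in> borel_measurable M" "AE x in M. f x = g x"
  shows "g \<in> K"
proof -
  have f: "f \<in> L2 M"
    using assms by (meson L2_subspace_L2 closed_L2_subspaceD)
  have g: "g \<in> L2 M"
    by (rule L2_cong_AE[OF f assms(3,4)])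
  have "L2_norm M (\<lambda>x. g x - f x) = 0"
    using assms(4) by (subst L2_norm_eq_0_iff[OF L2_diff[OF g f]]) auto
  then have "g \<in> L2_closure M K"
    using g assms(2) by (auto simp: L2_closure_def intro!: bexI[of _ f])
  then show ?thesis
    using assms(1) by (auto simp: closed_L2_subspace_def)
qed

lemma closed_L2_subspace_UNIV: "closed_L2_subspace M (L2 M)"
  by (auto simp: closed_L2_subspace_def L2_subspace_UNIV L2_closure_def)

lemma L2_closure_superset: "V \<subseteq> L2 M \<Longrightarrow> V \<subseteq> L2_closure M V"
  by (force simp: L2_closure_def)

lemma L2_closure_mono: "V \<subseteq> W \<Longrightarrow> L2_closure M V \<subseteq> L2_closure M W"
  by (fastforce simp: L2_closure_def)

lemma closed_L2_subspace_closure: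
  assumes "L2_subspace M V"
  shows "closed_L2_subspace M (L2_closure M V)"
  unfolding closed_L2_subspace_def L2_subspace_def
proof (intro conjI ballI allI subsetI)
  have VL: "V \<subseteq> L2 M" using assms by (auto simp: L2_subspace_def)
  show "f \<in> L2 M" if "f \<in> L2_closure M V" for f
    using that by (auto simp: L2_closure_def)
  show "(\<lambda>x. 0) \<in> L2_closure M V"
    using L2_closure_superset[OF VL] assms by (auto simp: L2_subspace_def)
  show "(\<lambda>x. a * f x + b * g x) \<in> L2_closure M V"
    if f: "f \<in> L2_closure M V" and g: "g \<in> L2_closure M V" for f g a b
    unfolding L2_closure_def
  proof (intro CollectI conjI allI impI)
    have fL: "f \<in> L2 M" and gL: "g \<in> L2 M"
      using f g by (auto simp: L2_closure_def)
    then show "(\<lambda>x. a * f x + b * g x) \<in> L2 M"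
      by (rule L2_lincomb)
    fix e :: real assume "0 < e"
    have d: "e / (cmod a + cmod b + 1) > 0"
      using \<open>0 < e\<close> norm_ge_zero[of a] norm_ge_zero[of b] by (intro divide_pos_pos) linarith+
    obtain u where u: "u \<in> V" "L2_norm M (\<lambda>x. f x - u x) < e / (cmod a + cmod b + 1)"
      using f d by (rule L2_closureE)
    obtain v where v: "v \<in> V" "L2_norm M (\<lambda>x. g x - v x) < e / (cmod a + cmod b + 1)"
      using g d by (rule L2_closureE)
    have "L2_norm M (\<lambda>x. a * f x + b * g x - (a * u x + b * v x)) < e"
      by (rule L2_norm_lincomb_diff_less[OF fL gL subsetD[OF VL u(1)] subsetD[OF VL v(1)] \<open>0 < e\<close> u(2) v(2)])
    then show "\<exists>w\<in>V. L2_norm M (\<lambda>x. a * f x + b * g x - w x) < e"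
      by (intro bexI[OF _ L2_subspace_lincomb[OF assms u(1) v(1), of a b]])
  qed
  show "f \<in> L2_closure M V" if f: "f \<in> L2_closure M (L2_closure M V)" for f
    unfolding L2_closure_def
  proof (intro CollectI conjI allI impI)
    show fL: "f \<in> L2 M" using f by (auto simp: L2_closure_def)
    fix e :: real assume "0 < e"
    then have e2: "e / 2 > 0" by simp
    obtain g where g: "g \<in> L2_closure M V" "L2_norm M (\<lambda>x. f x - g x) < e / 2"
      using f e2 by (rule L2_closureE)
    obtain v where v: "v \<in> V" "L2_norm M (\<lambda>x. g x - v x) < e / 2"
      using g(1) e2 by (rule L2_closureE)
    have "L2_norm M (\<lambda>x. f x - v x) \<le> L2_norm M (\<lambda>x. f x - g x) + L2_norm M (\<lambda>x. g x - v x)"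
      using g v VL fL by (intro L2_norm_triangle) (auto simp: L2_closure_def)
    with g v have "L2_norm M (\<lambda>x. f x - v x) < e" by simp
    with v show "\<exists>v\<in>V. L2_norm M (\<lambda>x. f x - v x) < e" by blast
  qed
qed

lemma closed_L2_subspace_limit:
  assumes "closed_L2_subspace M K" "\<And>n. F n \<in> K" "f \<in> L2 M"
    "(\<lambda>n. L2_norm M (\<lambda>x. F n x - f x)) \<longlonglongrightarrow> 0"
  shows "f \<in> K"
proof -
  have "\<exists>g\<in>K. L2_norm M (\<lambda>x. f x - g x) < e" if "e > 0" for e
  proof -
    have "\<forall>\<^sub>F n in sequentially. L2_norm M (\<lambda>x. F n x - f x) < e"
      using assms(4) that by (rule order_tendstoD)
    then obtain n where "L2_norm M (\<lambda>x. F n x - f x) < e"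
      by (auto simp: eventually_sequentially)
    then show ?thesis
      using assms(2) by (subst L2_norm_minus) blast
  qed
  then show ?thesis
    using assms by (auto simp: closed_L2_subspace_def L2_closure_def)
qed

text \<open>A minimising sequence is Cauchy by the parallelogram law, so the distance from
  \<open>f\<close> to \<open>K\<close> is attained at some \<open>g\<close>. If \<open>f - g\<close>
  were not orthogonal to \<open>k\<close>, moving from \<open>g\<close> along \<open>k\<close> would
  shorten the distance.\<close>

lemma (in finite_measure) L2_projection_exists:
  assumes K: "closed_L2_subspace M K" and f: "f \<in> L2 M"
  shows "\<exists>g\<in>K. \<forall>k\<in>K. L2_inner M (\<lambda>x. f x - g x) k = 0"
proof -
  note KS = closed_L2_subspaceD[OF K]
  note KL = L2_subspace_L2[OF KS]
  define D where "D = (\<lambda>k. (L2_norm M (\<lambda>x. f x - k x))\<^sup>2) ` K"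
  define d where "d = Inf D"
  have bdd: "bdd_below D" and ne: "D \<noteq> {}"
    using L2_subspace_zero[OF KS] by (auto simp: D_def intro!: bdd_belowI[of _ 0])
  have d_le: "d \<le> (L2_norm M (\<lambda>x. f x - k x))\<^sup>2" if "k \<in> K" for k
    unfolding d_def using that by (intro cInf_lower bdd) (auto simp: D_def)
  have "\<exists>k\<in>K. (L2_norm M (\<lambda>x. f x - k x))\<^sup>2 < d + 1 / Suc n" for n
  proof -
    have "\<exists>y\<in>D. y < d + 1 / Suc n"
      using cInf_less_iff[OF ne bdd, of "d + 1 / Suc n"] by (simp add: d_def)
    then show ?thesis by (auto simp: D_def)
  qed
  then obtain F where F: "\<And>n. F n \<in> K" "\<And>n. (L2_norm M (\<lambda>x. f x - F n x))\<^sup>2 < d + 1 / Suc n"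
    by metis
  have par: "(L2_norm M (\<lambda>x. F m x - F n x))\<^sup>2 \<le> 2 / Suc m + 2 / Suc n" for m n
  proof -
    \<comment> \<open>The midpoint lies in \<open>K\<close>, so its squared distance to
      \<open>f\<close> is at least \<open>d\<close>; in the parallelogram law this forces the two
      terms of the sequence to be close.\<close>
    have mid: "(\<lambda>x. (1/2) * F m x + (1/2) * F n x) \<in> K"
      by (intro L2_subspace_lincomb[OF KS] F)
    have "(L2_norm M (\<lambda>x. (f x - F n x) + (f x - F m x)))\<^sup>2 + (L2_norm M (\<lambda>x. (f x - F n x) - (f x - F m x)))\<^sup>2
        = 2 * (L2_norm M (\<lambda>x. f x - F n x))\<^sup>2 + 2 * (L2_norm M (\<lambda>x. f x - F m x))\<^sup>2"
      by (intro L2_parallelogram L2_diff f KL F)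
    moreover have "(\<lambda>x. (f x - F n x) + (f x - F m x)) = (\<lambda>x. 2 * (f x - ((1/2) * F m x + (1/2) * F n x)))"
      by (auto simp: algebra_simps)
    then have "L2_norm M (\<lambda>x. (f x - F n x) + (f x - F m x)) = 2 * L2_norm M (\<lambda>x. f x - ((1/2) * F m x + (1/2) * F n x))"
      by (simp only: L2_norm_scale) simp
    moreover have "(\<lambda>x. (f x - F n x) - (f x - F m x)) = (\<lambda>x. F m x - F n x)"
      by auto
    moreover note d_le[OF mid] F(2)[of m] F(2)[of n]
    ultimately show ?thesis
      by (simp add: power_mult_distrib add_divide_distrib)
  qed
  have "\<exists>N. \<forall>m\<ge>N. \<forall>n\<ge>N. L2_norm M (\<lambda>x. F m x - F n x) < e" if "e > 0" for e
  proof -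
    obtain N where N: "4 / e\<^sup>2 < real N"
      using reals_Archimedean2 by blast
    have pos: "0 < real N" using that N by (meson divide_pos_pos less_trans zero_less_numeral zero_less_power)
    have "L2_norm M (\<lambda>x. F m x - F n x) < e" if "m \<ge> N" "n \<ge> N" for m n
    proof (rule power_less_imp_less_base[of _ 2])
      have "2 / Suc k \<le> 2 / real N" if "k \<ge> N" for k
        using that pos by (intro divide_left_mono) auto
      from this[OF that(1)] this[OF that(2)] par[of m n]
      have "(L2_norm M (\<lambda>x. F m x - F n x))\<^sup>2 \<le> 4 / real N"
        by simp
      also have "\<dots> < e\<^sup>2"
        using N pos \<open>e > 0\<close> by (simp add: field_simps)
      finally show "(L2_norm M (\<lambda>x. F m x - F n x))\<^sup>2 < e\<^sup>2" .
    qed (use \<open>e > 0\<close> in simp)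
    then show ?thesis by blast
  qed
  then obtain g where g: "g \<in> L2 M" "(\<lambda>n. L2_norm M (\<lambda>x. F n x - g x)) \<longlonglongrightarrow> 0"
    using L2_complete[of F] KL[OF F(1)] by blast
  have gK: "g \<in> K"
    by (rule closed_L2_subspace_limit[OF K F(1) g])
  \<comment> \<open>By the triangle inequality through \<open>F n\<close> the squared distance is
    below a sequence that tends to \<open>d\<close>.\<close>
  have gd: "(L2_norm M (\<lambda>x. f x - g x))\<^sup>2 \<le> d"
  proof (rule LIMSEQ_le_const[where X = "\<lambda>n. (sqrt (d + 1 / Suc n) + L2_norm M (\<lambda>x. F n x - g x))\<^sup>2"])
    have "(\<lambda>n. (sqrt (d + 1 / Suc n) + L2_norm M (\<lambda>x. F n x - g x))\<^sup>2) \<longlonglongrightarrow> (sqrt (d + 0) + 0)\<^sup>2"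
      by (intro tendsto_intros g LIMSEQ_Suc[OF lim_1_over_n])
    moreover have "d \<ge> 0"
      unfolding d_def using ne by (intro cInf_greatest) (auto simp: D_def)
    ultimately show "(\<lambda>n. (sqrt (d + 1 / Suc n) + L2_norm M (\<lambda>x. F n x - g x))\<^sup>2) \<longlonglongrightarrow> d"
      by simp
    have "(L2_norm M (\<lambda>x. f x - g x))\<^sup>2 \<le> (sqrt (d + 1 / Suc n) + L2_norm M (\<lambda>x. F n x - g x))\<^sup>2" for n
    proof (rule power_mono)
      have "L2_norm M (\<lambda>x. f x - F n x) \<le> sqrt (d + 1 / Suc n)"
        using F(2)[of n] by (intro real_le_rsqrt) simp
      with L2_norm_triangle[OF f KL[OF F(1)] g(1), of n]
      show "L2_norm M (\<lambda>x. f x - g x) \<le> sqrt (d + 1 / Suc n) + L2_norm M (\<lambda>x. F n x - g x)"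
        by simp
    qed simp
    then show "\<exists>N. \<forall>n\<ge>N. (L2_norm M (\<lambda>x. f x - g x))\<^sup>2 \<le> (sqrt (d + 1 / Suc n) + L2_norm M (\<lambda>x. F n x - g x))\<^sup>2"
      by blast
  qed
  have "L2_inner M (\<lambda>x. f x - g x) k = 0" if k: "k \<in> K" for k
  proof (cases "L2_norm M k = 0")
    case True
    then show ?thesis
      using L2_Cauchy_Schwarz[OF L2_diff[OF f g(1)] KL[OF k]] by simp
  next
    case False
    let ?i = "L2_inner M (\<lambda>x. f x - g x) k" and ?n = "(L2_norm M k)\<^sup>2"
    obtain c where c: "(L2_norm M (\<lambda>x. (f x - g x) + c * k x))\<^sup>2
        = (L2_norm M (\<lambda>x. f x - g x))\<^sup>2 - (cmod ?i)\<^sup>2 / ?n"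
      using L2_norm_add_scale_min[OF L2_diff[OF f g(1)] KL[OF k] False] by blast
    have "(\<lambda>x. 1 * g x + (- c) * k x) \<in> K"
      by (intro L2_subspace_lincomb[OF KS] gK k)
    from d_le[OF this] gd
    have "(L2_norm M (\<lambda>x. f x - g x))\<^sup>2 \<le> (L2_norm M (\<lambda>x. f x - (1 * g x + (- c) * k x)))\<^sup>2"
      by (rule order_trans[rotated])
    also have "(\<lambda>x. f x - (1 * g x + (- c) * k x)) = (\<lambda>x. (f x - g x) + c * k x)"
      by auto
    finally have "(cmod ?i)\<^sup>2 / ?n \<le> 0" using c by simp
    then show ?thesis
      using False by (simp add: divide_le_0_iff)
  qed
  with gK show ?thesis by blast
qed

lemma (in finite_measure)
  assumes "closed_L2_subspace M K" and "f \<in> L2 M"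
  shows L2_proj_in: "L2_proj M K f \<in> K"
    and L2_proj_orthogonal: "k \<in> K \<Longrightarrow> L2_inner M (\<lambda>x. f x - L2_proj M K f x) k = 0"
  using someI_ex[of "\<lambda>g. g \<in> K \<and> (\<forall>k\<in>K. L2_inner M (\<lambda>x. f x - g x) k = 0)"]
    L2_projection_exists[OF assms] by (auto simp: L2_proj_def)

lemma (in finite_measure) L2_inner_proj:
  assumes "closed_L2_subspace M K" "f \<in> L2 M" "k \<in> K"
  shows "L2_inner M (L2_proj M K f) k = L2_inner M f k"
  using L2_proj_orthogonal[OF assms] L2_inner_diff_left[of f M "L2_proj M K f" k]
    L2_proj_in[OF assms(1,2)] L2_subspace_L2[OF closed_L2_subspaceD[OF assms(1)]] assms
  by simp

text \<open>Testing with \<open>k = f - g\<close> shows that the difference has norm 0.\<close>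

lemma L2_subspace_eq_AE:
  assumes K: "L2_subspace M K" and "f \<in> K" "g \<in> K" "\<And>k. k \<in> K \<Longrightarrow> L2_inner M f k = L2_inner M g k"
  shows "AE x in M. f x = g x"
proof -
  note KL = L2_subspace_L2[OF K]
  have fg: "(\<lambda>x. f x - g x) \<in> K"
    by (rule L2_subspace_diff[OF assms(1-3)])
  have "L2_inner M (\<lambda>x. f x - g x) (\<lambda>x. f x - g x) = 0"
    using assms(4)[OF fg] by (subst L2_inner_diff_left) (auto intro!: KL assms fg)
  then have "L2_norm M (\<lambda>x. f x - g x) = 0"
    by (simp add: L2_inner_self)
  then show ?thesis
    using L2_norm_eq_0_iff[OF KL[OF fg]] by auto
qed

lemma (in finite_measure) L2_proj_unique:
  assumes K: "closed_L2_subspace M K" and "f \<in> L2 M" "g \<in> K"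
    and "\<And>k. k \<in> K \<Longrightarrow> L2_inner M g k = L2_inner M f k"
  shows "AE x in M. g x = L2_proj M K f x"
  by (rule L2_subspace_eq_AE[OF closed_L2_subspaceD[OF K]])
     (use assms in \<open>auto simp: L2_inner_proj L2_proj_in\<close>)

text \<open>The linear span, built one scaled generator at a time: linear facts follow by induction,
  without index sets or families of coefficients.\<close>

inductive_set lspan :: "('a \<Rightarrow> complex) set \<Rightarrow> ('a \<Rightarrow> complex) set" for G where
  lspan_zero: "(\<lambda>x. 0) \<in> lspan G"
| lspan_step: "f \<in> lspan G \<Longrightarrow> g \<in> G \<Longrightarrow> (\<lambda>x. f x + c * g x) \<in> lspan G"

lemma lspan_base: "g \<in> G \<Longrightarrow> g \<in> lspan G"
  using lspan_step[OF lspan_zero, of g G 1] by simp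

lemma lspan_add: "g \<in> lspan G \<Longrightarrow> f \<in> lspan G \<Longrightarrow> (\<lambda>x. f x + g x) \<in> lspan G"
proof (induction rule: lspan.induct)
  case (lspan_step f' g' c)
  then show ?case
    using lspan.lspan_step[of "\<lambda>x. f x + f' x" G g' c] by (simp add: add.assoc)
qed simp

lemma lspan_scale: "g \<in> lspan G \<Longrightarrow> (\<lambda>x. a * g x) \<in> lspan G"
proof (induction rule: lspan.induct)
  case (lspan_step f' g' c)
  then show ?case
    using lspan.lspan_step[of "\<lambda>x. a * f' x" G g' "a * c"] by (simp add: algebra_simps)
qed (simp add: lspan.lspan_zero)

lemma lspan_mono:
  assumes "G \<subseteq> H"
  shows "lspan G \<subseteq> lspan H"
proof
  fix f assume "f \<in> lspan G"
  then show "f \<in> lspan H"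
    by induction (use assms in \<open>auto intro: lspan.intros\<close>)
qed

lemma lspan_subset:
  assumes "L2_subspace M K" "G \<subseteq> K"
  shows "lspan G \<subseteq> K"
proof
  fix f assume "f \<in> lspan G"
  then show "f \<in> K"
  proof induction
    case (lspan_step f g c)
    then show ?case
      using L2_subspace_lincomb[OF assms(1), of f g 1 c] assms(2) by auto
  qed (use assms in \<open>auto simp: L2_subspace_zero\<close>)
qed

lemma L2_subspace_lspan:
  assumes "G \<subseteq> L2 M"
  shows "L2_subspace M (lspan G)"
  unfolding L2_subspace_def
  using lspan_subset[OF L2_subspace_UNIV assms]
  by (auto intro!: lspan_zero lspan_add lspan_scale)

text \<open>The difference of \<open>f\<close> and its projection onto the closed span is orthogonal
  to \<open>G\<close>, hence zero by \<open>orth\<close>. All density statements for trigonometric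
  polynomials, powers and model spaces are instances.\<close>

lemma (in finite_measure) lspan_dense:
  assumes K: "closed_L2_subspace M K" and G: "G \<subseteq> K"
    and orth: "\<And>f. f \<in> K \<Longrightarrow> (\<And>g. g \<in> G \<Longrightarrow> L2_inner M f g = 0) \<Longrightarrow> AE x in M. f x = 0"
  shows "L2_closure M (lspan G) = K"
proof
  note KS = closed_L2_subspaceD[OF K]
  have GL: "G \<subseteq> L2 M" using G L2_subspace_L2[OF KS] by blast
  note cl = closed_L2_subspace_closure[OF L2_subspace_lspan[OF GL]]
  show sub: "L2_closure M (lspan G) \<subseteq> K"
    using L2_closure_mono[OF lspan_subset[OF KS G], of M] K by (auto simp: closed_L2_subspace_def)
  show "K \<subseteq> L2_closure M (lspan G)"
  proof
    fix f assume f: "f \<in> K"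
    then have fL: "f \<in> L2 M" by (rule L2_subspace_L2[OF KS])
    let ?g = "L2_proj M (L2_closure M (lspan G)) f"
    have g: "?g \<in> L2_closure M (lspan G)"
      by (rule L2_proj_in[OF cl fL])
    have "AE x in M. f x - ?g x = 0"
    proof (rule orth)
      show "(\<lambda>x. f x - ?g x) \<in> K"
        using L2_subspace_diff[OF KS f] g sub by blast
      show "L2_inner M (\<lambda>x. f x - ?g x) h = 0" if "h \<in> G" for h
        by (rule L2_proj_orthogonal[OF cl fL])
           (use that L2_closure_superset[of "lspan G" M] lspan_base[of h G]
              lspan_subset[OF L2_subspace_UNIV GL] in auto)
    qed
    then show "f \<in> L2_closure M (lspan G)"
      by (intro closed_L2_subspace_cong_AE[OF cl g]) (use L2_D(1)[OF fL] in auto)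
  qed
qed

text \<open>A bounded linear functional is determined by its values on a set with dense span. Every
  extension from generators by continuity goes through this form, usually with the difference of two
  inner products as \<open>\<Lambda>\<close>.\<close>

lemma functional_eq_0:
  assumes K: "L2_subspace M K" and G: "G \<subseteq> K" and dense: "K \<subseteq> L2_closure M (lspan G)"
    and lin: "\<And>f g c. f \<in> K \<Longrightarrow> g \<in> K \<Longrightarrow> \<Lambda> (\<lambda>x. f x + c * g x) = \<Lambda> f + c * \<Lambda> g"
    and bd: "\<And>f. f \<in> K \<Longrightarrow> cmod (\<Lambda> f) \<le> C * L2_norm M f"
    and zero: "\<And>g. g \<in> G \<Longrightarrow> \<Lambda> g = 0" and f: "f \<in> K"
  shows "\<Lambda> f = 0"
proof -
  have sp: "\<Lambda> v = 0" if "v \<in> lspan G" for v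
    using that
  proof induction
    case lspan_zero
    show ?case using bd[OF L2_subspace_zero[OF K]] by simp
  next
    case (lspan_step f g c)
    then show ?case using lin[of f g c] zero[of g] G lspan_subset[OF K G] by auto
  qed
  have "cmod (\<Lambda> f) \<le> \<bar>C\<bar> * e" if "e > 0" for e
  proof -
    have "f \<in> L2_closure M (lspan G)"
      using dense f by blast
    then obtain v where v: "v \<in> lspan G" "L2_norm M (\<lambda>x. f x - v x) < e"
      using \<open>e > 0\<close> unfolding L2_closure_def by blast
    then have vK: "v \<in> K" using lspan_subset[OF K G] by auto
    have "\<Lambda> (\<lambda>x. f x + (-1) * v x) = \<Lambda> f"
      by (subst lin[OF f vK]) (simp add: sp v)
    moreover have "(\<lambda>x. f x - v x) \<in> K" by (rule L2_subspace_diff[OF K f vK])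
    ultimately have "cmod (\<Lambda> f) \<le> C * L2_norm M (\<lambda>x. f x - v x)"
      using bd[of "\<lambda>x. f x - v x"] by simp
    also have "\<dots> \<le> \<bar>C\<bar> * e"
      using v by (intro mult_mono) auto
    finally show ?thesis .
  qed
  from this[of "e / (\<bar>C\<bar> + 1)" for e] have "cmod (\<Lambda> f) \<le> e" if "e > 0" for e
  proof -
    have "cmod (\<Lambda> f) \<le> \<bar>C\<bar> * (e / (\<bar>C\<bar> + 1))"
      by (rule \<open>\<And>e. 0 < e / (\<bar>C\<bar> + 1) \<Longrightarrow> _\<close>) (use that in auto)
    also have "\<dots> \<le> e"
      using that by (simp add: field_simps add_pos_nonneg)
    finally show ?thesis .
  qed
  then have "cmod (\<Lambda> f) \<le> 0"
    by (rule field_le_epsilon[of _ 0, simplified])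
  then show ?thesis by simp
qed

section \<open>Bounded operators: sums, density arguments and extension\<close>

lemma bounded_operatorD:
  assumes "bounded_operator M K N L T"
  shows "f \<in> K \<Longrightarrow> T f \<in> L"
    and "f \<in> K \<Longrightarrow> g \<in> K \<Longrightarrow> AE x in N. T (\<lambda>y. a * f y + b * g y) x = a * T f x + b * T g x"
  using assms by (auto simp: bounded_operator_def)

lemma bounded_operator_bound:
  assumes "bounded_operator M K N L T"
  obtains C where "C \<ge> 0" "\<And>f. f \<in> K \<Longrightarrow> L2_norm N (T f) \<le> C * L2_norm M f"
proof -
  obtain C where "\<forall>f\<in>K. L2_norm N (T f) \<le> C * L2_norm M f"
    using assms unfolding bounded_operator_def by blast
  then have C: "L2_norm N (T f) \<le> C * L2_norm M f" if "f \<in> K" for f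
    using that by blast
  have "L2_norm N (T f) \<le> \<bar>C\<bar> * L2_norm M f" if "f \<in> K" for f
    by (rule order_trans[OF C[OF that] mult_right_mono]) auto
  then show ?thesis using that[of "\<bar>C\<bar>"] by simp
qed

text \<open>The bound gives \<open>T (f - g)\<close> norm 0, and linearity relates it to
  \<open>T f - T g\<close>.\<close>

lemma bounded_operator_cong_AE:
  assumes T: "bounded_operator M K N L T" and K: "L2_subspace M K" and L: "L2_subspace N L"
    and fg: "f \<in> K" "g \<in> K" "AE x in M. f x = g x"
  shows "AE x in N. T f x = T g x"
proof -
  obtain C where C: "C \<ge> 0" "\<And>f. f \<in> K \<Longrightarrow> L2_norm N (T f) \<le> C * L2_norm M f"
    using bounded_operator_bound[OF T] by blast
  have d: "(\<lambda>x. f x - g x) \<in> K" by (rule L2_subspace_diff[OF K fg(1,2)])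
  have "L2_norm M (\<lambda>x. f x - g x) = 0"
    using fg(3) by (subst L2_norm_eq_0_iff[OF L2_subspace_L2[OF K d]]) auto
  then have "L2_norm N (T (\<lambda>x. f x - g x)) = 0"
    using C(2)[OF d] by (simp add: order_antisym)
  then have "AE x in N. T (\<lambda>x. f x - g x) x = 0"
    using L2_norm_eq_0_iff L2_subspace_L2[OF L bounded_operatorD(1)[OF T d]] by blast
  moreover have "AE x in N. T (\<lambda>x. 1 * f x + (-1) * g x) x = 1 * T f x + (-1) * T g x"
    by (rule bounded_operatorD(2)[OF T fg(1,2)])
  ultimately show ?thesis by (auto elim!: eventually_elim2)
qed

lemma bounded_operator_inner:
  assumes S: "bounded_operator M K N L S" and K: "L2_subspace M K" and L: "L2_subspace N L"
    and fg: "f \<in> K" "g \<in> K" and k: "k \<in> L2 N"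
  shows "L2_inner N (S (\<lambda>x. f x + c * g x)) k = L2_inner N (S f) k + c * L2_inner N (S g) k"
proof -
  note LL = L2_subspace_L2[OF L bounded_operatorD(1)[OF S]]
  have fgK: "(\<lambda>x. 1 * f x + c * g x) \<in> K" by (rule L2_subspace_lincomb[OF K fg])
  have "L2_inner N (S (\<lambda>x. 1 * f x + c * g x)) k = L2_inner N (\<lambda>x. 1 * S f x + c * S g x) k"
    by (rule L2_inner_cong_AE[OF LL[OF fgK] L2_lincomb[OF LL[OF fg(1)] LL[OF fg(2)]] k k
          bounded_operatorD(2)[OF S fg]]) simp
  then show ?thesis
    using L2_inner_lincomb_left[OF LL[OF fg(1)] LL[OF fg(2)] k, of 1 c] by simp
qed

lemma bounded_operator_zero:
  assumes T: "bounded_operator M K N L T" and K: "L2_subspace M K"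
  shows "AE x in N. T (\<lambda>x. 0) x = 0"
  using bounded_operatorD(2)[OF T L2_subspace_zero[OF K] L2_subspace_zero[OF K], of 0 0] by simp

lemma bounded_operator_sum_arg:
  assumes T: "bounded_operator M K N L T" and K: "L2_subspace M K"
    and "finite I" "\<And>i. i \<in> I \<Longrightarrow> g i \<in> K"
  shows "AE x in N. T (\<lambda>y. \<Sum>i\<in>I. g i y) x = (\<Sum>i\<in>I. T (g i) x)"
  using assms(3,4)
proof (induction I)
  case empty
  then show ?case using bounded_operator_zero[OF T K] by simp
next
  case (insert i I)
  then have g: "g i \<in> K" "(\<lambda>y. \<Sum>i\<in>I. g i y) \<in> K"
    using L2_subspace_sum[OF K, of I g] by auto
  have "AE x in N. T (\<lambda>y. 1 * g i y + 1 * (\<Sum>i\<in>I. g i y)) x = 1 * T (g i) x + 1 * T (\<lambda>y. \<Sum>i\<in>I. g i y) x"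
    by (rule bounded_operatorD(2)[OF T g])
  moreover have "AE x in N. T (\<lambda>y. \<Sum>i\<in>I. g i y) x = (\<Sum>i\<in>I. T (g i) x)"
    using insert by simp
  ultimately show ?case
    by eventually_elim (use insert in simp)
qed

lemma bounded_operator_sum:
  assumes K: "L2_subspace M K" and L: "L2_subspace N L"
    and "finite I" "\<And>i. i \<in> I \<Longrightarrow> bounded_operator M K N L (T i)"
  shows "bounded_operator M K N L (\<lambda>f x. \<Sum>i\<in>I. T i f x)"
  using assms(3,4)
proof (induction I)
  case empty
  then show ?case
    using L2_subspace_zero[OF L] by (auto simp: bounded_operator_def intro!: exI[of _ 0])
next
  case (insert i I)
  let ?R = "\<lambda>f x. \<Sum>i\<in>I. T i f x"
  have T: "bounded_operator M K N L (T i)" and R: "bounded_operator M K N L ?R"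
    using insert by auto
  have eq: "(\<lambda>f x. \<Sum>i\<in>insert i I. T i f x) = (\<lambda>f x. T i f x + ?R f x)"
    using insert(1,2) by simp
  obtain C where C: "\<And>f. f \<in> K \<Longrightarrow> L2_norm N (T i f) \<le> C * L2_norm M f"
    using bounded_operator_bound[OF T] by blast
  obtain D where D: "\<And>f. f \<in> K \<Longrightarrow> L2_norm N (?R f) \<le> D * L2_norm M f"
    using bounded_operator_bound[OF R] by blast
  show ?case
    unfolding eq bounded_operator_def
  proof (intro conjI ballI allI exI)
    show "(\<lambda>x. T i f x + ?R f x) \<in> L" if "f \<in> K" for f
      by (rule L2_subspace_add[OF L bounded_operatorD(1)[OF T that] bounded_operatorD(1)[OF R that]])
    show "AE x in N. T i (\<lambda>y. a * f y + b * g y) x + ?R (\<lambda>y. a * f y + b * g y) x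
        = a * (T i f x + ?R f x) + b * (T i g x + ?R g x)" if fg: "f \<in> K" "g \<in> K" for f g a b
      using bounded_operatorD(2)[OF T fg, of a b] bounded_operatorD(2)[OF R fg, of a b]
      by eventually_elim (simp add: algebra_simps)
    show "L2_norm N (\<lambda>x. T i f x + ?R f x) \<le> (C + D) * L2_norm M f" if f: "f \<in> K" for f
      using L2_norm_add_le[OF L2_subspace_L2[OF L bounded_operatorD(1)[OF T f]]
          L2_subspace_L2[OF L bounded_operatorD(1)[OF R f]]] C[OF f] D[OF f]
      by (simp add: distrib_right)
  qed
qed

lemma L2_inner_sum_left:
  assumes "finite I" "\<And>i. i \<in> I \<Longrightarrow> f i \<in> L2 M" "k \<in> L2 M"
  shows "L2_inner M (\<lambda>x. \<Sum>i\<in>I. f i x) k = (\<Sum>i\<in>I. L2_inner M (f i) k)"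
  unfolding L2_inner_def sum_distrib_right
  by (rule Bochner_Integration.integral_sum) (rule L2_mult_cnj_integrable[OF assms(2,3)])

text \<open>Approximants from the span have images in \<open>L0\<close>, and these converge to
  \<open>T f\<close> by boundedness. It shows below that \<open>Omega B\<close> maps the tensor
  product of two model spaces into a model space.\<close>

lemma bounded_operator_closure_range:
  assumes T: "bounded_operator M K N L T" and K: "L2_subspace M K" and L: "L2_subspace N L"
    and L0: "closed_L2_subspace N L0" and G: "\<And>g. g \<in> G \<Longrightarrow> g \<in> K \<and> T g \<in> L0"
    and f: "f \<in> K" "f \<in> L2_closure M (lspan G)"
  shows "T f \<in> L0"
proof (rule closed_L2_subspace_closureD[OF L0])
  note LL = L2_subspace_L2[OF L bounded_operatorD(1)[OF T]]
  note L0S = closed_L2_subspaceD[OF L0]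
  have span: "v \<in> K \<and> T v \<in> L0" if "v \<in> lspan G" for v
    using that
  proof induction
    case lspan_zero
    have z: "(\<lambda>x. 0) \<in> K" by (rule L2_subspace_zero[OF K])
    have "AE x in N. 0 = T (\<lambda>x. 0) x"
      using bounded_operator_zero[OF T K] by eventually_elim simp
    with z show ?case
      using closed_L2_subspace_cong_AE[OF L0 L2_subspace_zero[OF L0S] L2_D(1)[OF LL[OF z]]] by blast
  next
    case (lspan_step v g c)
    then have v: "v \<in> K" "T v \<in> L0" and g: "g \<in> K" "T g \<in> L0" using G by auto
    have w: "(\<lambda>x. 1 * v x + c * g x) \<in> K" by (rule L2_subspace_lincomb[OF K v(1) g(1)])
    have "AE x in N. 1 * T v x + c * T g x = T (\<lambda>x. 1 * v x + c * g x) x"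
      using bounded_operatorD(2)[OF T v(1) g(1), of 1 c] by eventually_elim simp
    from closed_L2_subspace_cong_AE[OF L0 L2_subspace_lincomb[OF L0S v(2) g(2)] L2_D(1)[OF LL[OF w]] this]
    show ?case using w by simp
  qed
  obtain C where C: "C \<ge> 0" "\<And>f. f \<in> K \<Longrightarrow> L2_norm N (T f) \<le> C * L2_norm M f"
    using bounded_operator_bound[OF T] by blast
  show "T f \<in> L2_closure N L0"
    unfolding L2_closure_def
  proof (intro CollectI conjI allI impI)
    show "T f \<in> L2 N" by (rule LL[OF f(1)])
    fix e :: real assume "e > 0"
    then have "e / (C + 1) > 0" using C by simp
    with f(2) obtain v where v: "v \<in> lspan G" "L2_norm M (\<lambda>x. f x - v x) < e / (C + 1)"
      by (rule L2_closureE)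
    have vK: "v \<in> K" and Tv: "T v \<in> L0" using span[OF v(1)] by auto
    have d: "(\<lambda>x. f x - v x) \<in> K" by (rule L2_subspace_diff[OF K f(1) vK])
    have "AE x in N. T f x - T v x = T (\<lambda>x. f x - v x) x"
      using bounded_operatorD(2)[OF T f(1) vK, of 1 "-1"] by (simp add: eq_commute)
    then have "L2_norm N (\<lambda>x. T f x - T v x) = L2_norm N (T (\<lambda>x. f x - v x))"
      by (rule L2_norm_cong_AE[OF L2_diff[OF LL[OF f(1)] LL[OF vK]] LL[OF d]])
    also have "\<dots> \<le> C * L2_norm M (\<lambda>x. f x - v x)" by (rule C(2)[OF d])
    also have "\<dots> \<le> (C + 1) * L2_norm M (\<lambda>x. f x - v x)" by (intro mult_right_mono) auto
    also have "\<dots> < (C + 1) * (e / (C + 1))" using v(2) C(1) by (intro mult_strict_left_mono) auto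
    also have "\<dots> = e" using C(1) by simp
    finally have "L2_norm N (\<lambda>x. T f x - T v x) < e" .
    from this Tv show "\<exists>v\<in>L0. L2_norm N (\<lambda>x. T f x - v x) < e" by (rule bexI)
  qed
qed

text \<open>The operators are compared weakly: for each fixed \<open>k\<close> in \<open>L\<close>
  the difference of inner products with \<open>k\<close> is a bounded functional that vanishes on
  \<open>G\<close>.\<close>

lemma bounded_operator_agree:
  assumes T: "bounded_operator M K N L T" and T': "bounded_operator M K N L T'"
    and K: "L2_subspace M K" and L: "L2_subspace N L"
    and G: "G \<subseteq> K" and dense: "K \<subseteq> L2_closure M (lspan G)"
    and eq: "\<And>g. g \<in> G \<Longrightarrow> AE x in N. T g x = T' g x" and f: "f \<in> K"
  shows "AE x in N. T f x = T' f x"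
proof (rule L2_subspace_eq_AE[OF L])
  show TT: "T f \<in> L" "T' f \<in> L"
    using bounded_operatorD(1)[OF T f] bounded_operatorD(1)[OF T' f] by auto
  fix k assume k: "k \<in> L"
  note LL = L2_subspace_L2[OF L]
  obtain C C' where C: "C \<ge> 0" "\<And>f. f \<in> K \<Longrightarrow> L2_norm N (T f) \<le> C * L2_norm M f"
    and C': "C' \<ge> 0" "\<And>f. f \<in> K \<Longrightarrow> L2_norm N (T' f) \<le> C' * L2_norm M f"
    using bounded_operator_bound[OF T] bounded_operator_bound[OF T'] by metis
  have "L2_inner N (T f) k - L2_inner N (T' f) k = 0"
  proof (rule functional_eq_0[OF K G dense, where \<Lambda> = "\<lambda>f. L2_inner N (T f) k - L2_inner N (T' f) k"
        and C = "(C + C') * L2_norm N k"])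
    show "L2_inner N (T (\<lambda>x. f x + c * g x)) k - L2_inner N (T' (\<lambda>x. f x + c * g x)) k
      = (L2_inner N (T f) k - L2_inner N (T' f) k) + c * (L2_inner N (T g) k - L2_inner N (T' g) k)"
      if "f \<in> K" "g \<in> K" for f g c
      using bounded_operator_inner[OF T K L that LL[OF k]] bounded_operator_inner[OF T' K L that LL[OF k]]
      by (simp add: algebra_simps)
    show "cmod (L2_inner N (T f) k - L2_inner N (T' f) k) \<le> (C + C') * L2_norm N k * L2_norm M f"
      if f: "f \<in> K" for f
    proof -
      have "cmod (L2_inner N (T f) k - L2_inner N (T' f) k)
          \<le> L2_norm N (T f) * L2_norm N k + L2_norm N (T' f) * L2_norm N k"
        by (intro norm_triangle_le_diff add_mono L2_Cauchy_Schwarz LL k bounded_operatorD(1)[OF T f]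
            bounded_operatorD(1)[OF T' f])
      also have "\<dots> \<le> (C * L2_norm M f) * L2_norm N k + (C' * L2_norm M f) * L2_norm N k"
        using C C' f by (intro add_mono mult_right_mono) auto
      finally show ?thesis by (simp add: algebra_simps)
    qed
    show "L2_inner N (T g) k - L2_inner N (T' g) k = 0" if "g \<in> G" for g
    proof -
      have "L2_inner N (T g) k = L2_inner N (T' g) k"
        by (rule L2_inner_cong_AE)
          (use eq[OF that] that G in \<open>auto intro!: LL k bounded_operatorD(1)[OF T] bounded_operatorD(1)[OF T']\<close>)
      then show ?thesis by simp
    qed
  qed (rule f)
  then show "L2_inner N (T f) k = L2_inner N (T' f) k" by simp
qed

text \<open>The operator is prescribed by a relation \<open>P\<close> because one function, or two
  a.e. equal ones, may arise as different combinations with different representatives of the image.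
  Linearity and the bound force two such images to agree almost everywhere; completeness of
  \<open>L2\<close> then extends the relation to all of \<open>K\<close>.\<close>

lemma bounded_operator_extension:
  fixes P :: "(('a \<Rightarrow> complex) \<times> ('b \<Rightarrow> complex)) set"
  assumes N: "finite_measure N"
    and K: "L2_subspace M K" and L: "closed_L2_subspace N L"
    and PKL: "P \<subseteq> K \<times> L" and ne: "P \<noteq> {}"
    and lin: "\<And>x y x' y' a b. (x, y) \<in> P \<Longrightarrow> (x', y') \<in> P \<Longrightarrow>
        (\<lambda>t. a * x t + b * x' t, \<lambda>t. a * y t + b * y' t) \<in> P"
    and bd: "\<And>x y. (x, y) \<in> P \<Longrightarrow> L2_norm N y \<le> C * L2_norm M x"
    and dense: "K \<subseteq> L2_closure M (fst ` P)"
  obtains T where "bounded_operator M K N L T" "\<And>x y. (x, y) \<in> P \<Longrightarrow> AE t in N. T x t = y t"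
proof -
  interpret N: finite_measure N by (rule N)
  note LS = closed_L2_subspaceD[OF L]
  note LL = L2_subspace_L2[OF LS] and KL = L2_subspace_L2[OF K]
  \<comment> \<open>A strictly positive constant, since it is divided by below.\<close>
  define C' where "C' = \<bar>C\<bar> + 1"
  have C': "C' > 0" by (simp add: C'_def)
  have bd': "L2_norm N y \<le> C' * L2_norm M x" if "(x, y) \<in> P" for x y
    by (rule order_trans[OF bd[OF that] mult_right_mono]) (auto simp: C'_def)
  have P: "x \<in> K" "y \<in> L" "x \<in> L2 M" "y \<in> L2 N" if "(x, y) \<in> P" for x y
    using that PKL KL LL by auto
  have P_bd: "L2_norm N (\<lambda>t. y t - y' t) \<le> C' * L2_norm M (\<lambda>t. x t - x' t)"
    if "(x, y) \<in> P" "(x', y') \<in> P" for x y x' y'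
    using bd'[OF lin[OF that, of 1 "-1"]] by simp
  \<comment> \<open>\<open>Q\<close> is the closure of \<open>P\<close> in the product of
    \<open>K\<close> and \<open>L\<close>, taken with both norms at once; it inherits linearity and
    the bound.\<close>
  define Q where "Q = {(x, y). x \<in> K \<and> y \<in> L \<and> (\<forall>e>0. \<exists>(x', y')\<in>P.
      L2_norm M (\<lambda>t. x t - x' t) < e \<and> L2_norm N (\<lambda>t. y t - y' t) < e)}"
  have PQ: "P \<subseteq> Q"
  proof
    fix p assume p: "p \<in> P"
    obtain x y where "p = (x, y)" by (cases p)
    with p P[of x y] show "p \<in> Q"
      by (auto simp: Q_def intro!: bexI[of _ "(x, y)"])
  qed
  have Q_bd: "L2_norm N y \<le> C' * L2_norm M x" if Q: "(x, y) \<in> Q" for x y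
  proof (rule field_le_epsilon)
    fix e :: real assume "e > 0"
    define d where "d = e / (C' + 1)"
    have d: "d > 0" using \<open>e > 0\<close> C' by (simp add: d_def)
    obtain x' y' where P': "(x', y') \<in> P" "L2_norm M (\<lambda>t. x t - x' t) < d" "L2_norm N (\<lambda>t. y t - y' t) < d"
      using Q d by (auto simp: Q_def)
    have xy: "x \<in> L2 M" "y \<in> L2 N" using Q KL LL by (auto simp: Q_def)
    have "L2_norm N y \<le> L2_norm N (\<lambda>t. y t - y' t) + L2_norm N y'"
      using L2_norm_add_le[OF L2_diff[OF xy(2) P(4)[OF P'(1)]] P(4)[OF P'(1)]] by simp
    also have "L2_norm N y' \<le> C' * L2_norm M x'" by (rule bd'[OF P'(1)])
    also have "L2_norm M x' \<le> L2_norm M (\<lambda>t. x' t - x t) + L2_norm M x"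
      using L2_norm_add_le[OF L2_diff[OF P(3)[OF P'(1)] xy(1)] xy(1)] by simp
    also have "L2_norm M (\<lambda>t. x' t - x t) \<le> d"
      using P'(2) by (subst L2_norm_minus) simp
    finally have "L2_norm N y \<le> d + C' * (d + L2_norm M x)"
      using P'(3) C' by simp
    also have "\<dots> = C' * L2_norm M x + (C' + 1) * d" by (simp add: algebra_simps)
    also have "(C' + 1) * d = e" using C' by (simp add: d_def)
    finally show "L2_norm N y \<le> C' * L2_norm M x + e" .
  qed
  have Q_lin: "(\<lambda>t. a * x t + b * x' t, \<lambda>t. a * y t + b * y' t) \<in> Q"
    if Q: "(x, y) \<in> Q" "(x', y') \<in> Q" for x y x' y' a b
    unfolding Q_def
  proof (intro CollectI case_prodI conjI allI impI)
    have in_KL: "x \<in> K" "x' \<in> K" "y \<in> L" "y' \<in> L" using Q by (auto simp: Q_def)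
    show "(\<lambda>t. a * x t + b * x' t) \<in> K" "(\<lambda>t. a * y t + b * y' t) \<in> L"
      by (intro L2_subspace_lincomb[OF K] L2_subspace_lincomb[OF LS] in_KL)+
    fix e :: real assume "e > 0"
    define d where "d = e / (cmod a + cmod b + 1)"
    have d: "d > 0"
      using \<open>e > 0\<close> norm_ge_zero[of a] norm_ge_zero[of b] unfolding d_def by (intro divide_pos_pos) linarith+
    obtain u v where u: "(u, v) \<in> P" "L2_norm M (\<lambda>t. x t - u t) < d" "L2_norm N (\<lambda>t. y t - v t) < d"
      using Q(1) d by (auto simp: Q_def)
    obtain u' v' where u': "(u', v') \<in> P" "L2_norm M (\<lambda>t. x' t - u' t) < d" "L2_norm N (\<lambda>t. y' t - v' t) < d"
      using Q(2) d by (auto simp: Q_def)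
    show "\<exists>(x'', y'')\<in>P. L2_norm M (\<lambda>t. a * x t + b * x' t - x'' t) < e \<and>
        L2_norm N (\<lambda>t. a * y t + b * y' t - y'' t) < e"
      by (rule bexI[OF _ lin[OF u(1) u'(1), of a b]])
         (use L2_norm_lincomb_diff_less[OF KL[OF in_KL(1)] KL[OF in_KL(2)] P(3)[OF u(1)] P(3)[OF u'(1)] \<open>e > 0\<close>]
            L2_norm_lincomb_diff_less[OF LL[OF in_KL(3)] LL[OF in_KL(4)] P(4)[OF u(1)] P(4)[OF u'(1)] \<open>e > 0\<close>]
            u u' in \<open>simp add: d_def\<close>)
  qed
  have ex: "\<exists>y. (x, y) \<in> Q" if x: "x \<in> K" for x
  proof -
    have "\<exists>p\<in>P. L2_norm M (\<lambda>t. x t - fst p t) < (1/2)^n" for n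
      using dense x zero_less_power[of "1/2 :: real" n] by (fastforce simp: L2_closure_def)
    then obtain p where p: "\<And>n. p n \<in> P" "\<And>n. L2_norm M (\<lambda>t. x t - fst (p n) t) < (1/2)^n"
      by metis
    define X where "X n = fst (p n)" for n
    define Y where "Y n = snd (p n)" for n
    have XY: "(X n, Y n) \<in> P" "L2_norm M (\<lambda>t. x t - X n t) < (1/2)^n" for n
      using p by (auto simp: X_def Y_def)
    have dist: "L2_norm N (\<lambda>t. Y m t - Y n t) \<le> C' * ((1/2)^m + (1/2)^n)" for m n
    proof -
      have "L2_norm N (\<lambda>t. Y m t - Y n t) \<le> C' * L2_norm M (\<lambda>t. X m t - X n t)"
        by (rule P_bd[OF XY(1) XY(1)])
      also have "L2_norm M (\<lambda>t. X m t - X n t) \<le> L2_norm M (\<lambda>t. X m t - x t) + L2_norm M (\<lambda>t. x t - X n t)"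
        by (intro L2_norm_triangle KL x P(3)[OF XY(1)])
      also have "L2_norm M (\<lambda>t. X m t - x t) = L2_norm M (\<lambda>t. x t - X m t)"
        by (rule L2_norm_minus)
      finally show ?thesis
        using XY(2)[of m] XY(2)[of n] C' by (smt (verit) mult_left_mono)
    qed
    have "\<exists>N0. \<forall>m\<ge>N0. \<forall>n\<ge>N0. L2_norm N (\<lambda>t. Y m t - Y n t) < e" if "e > 0" for e
    proof -
      obtain k where k: "(1/2)^k < e / (2 * C')"
        using real_arch_pow_inv[of "e / (2 * C')" "1/2"] \<open>e > 0\<close> C' by auto
      have "L2_norm N (\<lambda>t. Y m t - Y n t) < e" if "m \<ge> k" "n \<ge> k" for m n
      proof -
        have half: "(1/2::real)^m \<le> (1/2)^k" "(1/2::real)^n \<le> (1/2)^k"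
          by (rule power_decreasing; use that in simp)+
        have "C' * ((1/2)^m + (1/2)^n) \<le> C' * (2 * (1/2)^k)"
          by (rule mult_left_mono, use half in linarith, use C' in simp)
        also have "\<dots> < e" using k C' by (simp add: field_simps)
        finally show ?thesis using dist[of m n] by simp
      qed
      then show ?thesis by blast
    qed
    then obtain y where y: "y \<in> L2 N" "(\<lambda>n. L2_norm N (\<lambda>t. Y n t - y t)) \<longlonglongrightarrow> 0"
      using N.L2_complete[of Y] P(4)[OF XY(1)] by blast
    have "y \<in> L"
      by (rule closed_L2_subspace_limit[OF L _ y]) (rule P(2)[OF XY(1)])
    moreover have "\<exists>(x', y')\<in>P. L2_norm M (\<lambda>t. x t - x' t) < e \<and> L2_norm N (\<lambda>t. y t - y' t) < e"
      if "e > 0" for e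
    proof -
      have "\<forall>\<^sub>F n in sequentially. L2_norm N (\<lambda>t. Y n t - y t) < e"
        using y(2) that by (rule order_tendstoD)
      moreover have "\<forall>\<^sub>F n in sequentially. (1/2::real)^n < e"
        using that LIMSEQ_power_zero[of "1/2::real"] by (intro order_tendstoD) auto
      ultimately have "\<forall>\<^sub>F n in sequentially. L2_norm N (\<lambda>t. Y n t - y t) < e \<and> (1/2::real)^n < e"
        by (rule eventually_conj)
      then obtain n where n: "L2_norm N (\<lambda>t. Y n t - y t) < e" "(1/2::real)^n < e"
        by (auto simp: eventually_sequentially)
      have "L2_norm N (\<lambda>t. y t - Y n t) < e"
        using n(1) by (subst L2_norm_minus)
      then show ?thesis
        using XY[of n] n(2) by (intro bexI[OF _ XY(1)[of n]]) auto
    qed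
    ultimately have "(x, y) \<in> Q" using x by (simp add: Q_def)
    then show ?thesis by (intro exI)
  qed
  \<comment> \<open>The choice among the representatives of the image is immaterial up to null sets
    by \<open>uniq\<close>.\<close>
  define T where "T x = (SOME y. (x, y) \<in> Q)" for x
  have T: "(x, T x) \<in> Q" if "x \<in> K" for x
    unfolding T_def using ex[OF that] by (rule someI_ex)
  have uniq: "AE t in N. y t = y' t" if Q: "(x, y) \<in> Q" "(x, y') \<in> Q" for x y y'
  proof -
    have "L2_norm N (\<lambda>t. 1 * y t + (-1) * y' t) \<le> C' * L2_norm M (\<lambda>t. 1 * x t + (-1) * x t)"
      by (rule Q_bd[OF Q_lin[OF Q]])
    then have "L2_norm N (\<lambda>t. y t - y' t) = 0" by (simp add: order_antisym)
    moreover have "(\<lambda>t. y t - y' t) \<in> L2 N"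
      using Q by (intro L2_diff LL) (auto simp: Q_def)
    ultimately show ?thesis
      using L2_norm_eq_0_iff[of "\<lambda>t. y t - y' t" N] by auto
  qed
  show ?thesis
  proof
    show "bounded_operator M K N L T"
      unfolding bounded_operator_def
    proof (intro conjI ballI allI exI)
      show "T f \<in> L" if "f \<in> K" for f
        using T[OF that] by (simp add: Q_def)
      show "AE x in N. T (\<lambda>y. a * f y + b * g y) x = a * T f x + b * T g x"
        if "f \<in> K" "g \<in> K" for f g a b
        by (rule uniq[OF T[OF L2_subspace_lincomb[OF K that]] Q_lin[OF T[OF that(1)] T[OF that(2)]]])
      show "L2_norm N (T f) \<le> C' * L2_norm M f" if "f \<in> K" for f
        by (rule Q_bd[OF T[OF that]])
    qed
    show "AE t in N. T x t = y t" if "(x, y) \<in> P" for x y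
      by (rule uniq[OF T[OF P(1)[OF that]]]) (use that PQ in auto)
  qed
qed

section \<open>Moments of functions on the circle\<close>

lemma borel_measurable_powi [measurable (raw)]:
  fixes f :: "'a \<Rightarrow> complex"
  assumes "f \<in> borel_measurable M"
  shows "(\<lambda>x. f x powi n) \<in> borel_measurable M"
  using assms by (simp add: power_int_def)

lemma borel_measurable_cnj [measurable (raw)]:
  assumes "f \<in> borel_measurable M"
  shows "(\<lambda>x. cnj (f x)) \<in> borel_measurable M"
  by (rule borel_measurable_continuous_on[OF _ assms]) (intro continuous_intros)

lemma circle_integral_powi: "(LINT z|circle. z powi n) = of_bool (n = 0)"
proof (cases "n = 0")
  case True
  then show ?thesis by (simp add: circle.prob_space)
next
  case False
  have pos: "ennreal (2 * pi) > 0" by simp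
  have meas: "(\<lambda>t. cis t powi n) \<in> borel_measurable lborel"
    by (intro borel_measurable_powi) (simp add: borel_measurable_continuous_onI continuous_on_cis)
  have "(LINT z|circle. z powi n) = (LINT t|uniform_measure lborel {0..<2 * pi}. cis t powi n)"
    unfolding circle_def by (rule integral_distr) (auto intro: cis_measurable)
  also have "uniform_measure lborel {0..<2 * pi} = density lborel (\<lambda>t. ennreal (indicator {0..<2 * pi} t / (2 * pi)))"
    unfolding uniform_measure_def
    by (rule density_cong) (auto simp: indicator_def divide_ennreal[of 1 "2 * pi", simplified])
  also have "(LINT t|density lborel (\<lambda>t. ennreal (indicator {0..<2 * pi} t / (2 * pi))). cis t powi n)
      = (LINT t|lborel. (indicator {0..<2 * pi} t / (2 * pi)) *\<^sub>R cis t powi n)"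
    using meas by (intro integral_density) auto
  \<comment> \<open>The null point \<open>2 * pi\<close> is added to the interval, since the
    fundamental theorem of calculus is applied on a closed one.\<close>
  also have "\<dots> = (LINT t|lborel. indicator {0..2 * pi} t *\<^sub>R ((1 / (2 * pi)) *\<^sub>R cis (of_int n * t)))"
  proof (rule integral_cong_AE)
    show "(\<lambda>t. indicator {0..2 * pi} t *\<^sub>R ((1 / (2 * pi)) *\<^sub>R cis (of_int n * t))) \<in> borel_measurable lborel"
      by (intro borel_measurable_scaleR borel_measurable_const borel_measurable_indicator)
         (auto intro!: borel_measurable_continuous_onI continuous_intros)
    show "AE t in lborel. (indicator {0..<2 * pi} t / (2 * pi)) *\<^sub>R cis t powi n
        = indicator {0..2 * pi} t *\<^sub>R ((1 / (2 * pi)) *\<^sub>R cis (of_int n * t))"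
      using AE_lborel_singleton[of "2 * pi"]
      by eventually_elim (auto simp: indicator_def cis_power_int)
  qed (use meas in simp)
  also have "\<dots> = cis (of_int n * (2 * pi)) / (2 * pi * \<i> * of_int n) - cis (of_int n * 0) / (2 * pi * \<i> * of_int n)"
  proof (rule integral_FTC_atLeastAtMost)
    fix t :: real
    have "((\<lambda>t. cis (of_int n * t)) has_vector_derivative of_int n *\<^sub>R (\<i> * cis (of_int n * t))) (at t within {0..2 * pi})"
      unfolding has_vector_derivative_def by (auto intro!: derivative_eq_intros)
    from bounded_linear.has_vector_derivative[OF bounded_linear_divide this, of "2 * pi * \<i> * of_int n"]
    show "((\<lambda>t. cis (of_int n * t) / (2 * pi * \<i> * of_int n)) has_vector_derivative
        (1 / (2 * pi)) *\<^sub>R cis (of_int n * t)) (at t within {0..2 * pi})"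
      using False by (simp add: scaleR_conv_of_real)
  qed (auto intro!: continuous_intros)
  also have "cis (of_int n * (2 * pi)) = 1"
    using cis_power_int[of "2 * pi" n] by (simp add: cis_2pi)
  finally show ?thesis using False by simp
qed

lemma powi_unimodular:
  assumes "cmod z = 1"
  shows "cmod (z powi n) = 1" "cnj z = inverse z" "z \<noteq> 0" "cnj (z powi n) = z powi (- n)"
proof -
  show z: "z \<noteq> 0" using assms by auto
  have "z * cnj z = 1"
    using complex_norm_square[of z] assms by simp
  then show c: "cnj z = inverse z"
    by (metis inverse_unique)
  show "cmod (z powi n) = 1"
    using assms by (simp add: norm_power_int)
  show "cnj (z powi n) = z powi (- n)"
    by (simp add: c power_int_minus power_int_inverse)
qed

section \<open>Trigonometric polynomials and uniqueness of moments\<close>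

abbreviation trig_polynomials :: "(complex \<Rightarrow> complex) set" where
  "trig_polynomials \<equiv> lspan (range (\<lambda>(n::int) z. z powi n))"

lemma powi_in_trig: "(\<lambda>z. z powi n) \<in> trig_polynomials"
  by (rule lspan_base) (rule rangeI)

lemma unimodular_mult_cnj: "cmod w = 1 \<Longrightarrow> w * cnj w = 1"
  using complex_norm_square[of w] by simp

text \<open>The product agrees with a member of the span only on the circle: at 0 the law of
  exponents for \<open>powi\<close> fails, for instance for the exponents 1 and -1.\<close>

lemma trig_polynomial_mult:
  assumes "f \<in> trig_polynomials" "g \<in> trig_polynomials"
  shows "\<exists>h \<in> trig_polynomials. \<forall>z. cmod z = 1 \<longrightarrow> h z = f z * g z"
  using assms(2)
proof induction
  case lspan_zero
  show ?case by (auto intro!: bexI[of _ "\<lambda>z. 0"] lspan.lspan_zero)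
next
  case (lspan_step g e c)
  then obtain n where e: "e = (\<lambda>z. z powi n)" by auto
  obtain h where h: "h \<in> trig_polynomials" "\<And>z. cmod z = 1 \<Longrightarrow> h z = f z * g z"
    using lspan_step by blast
  have "\<exists>h' \<in> trig_polynomials. \<forall>z. cmod z = 1 \<longrightarrow> h' z = f z * z powi n"
    using assms(1)
  proof induction
    case lspan_zero
    show ?case by (auto intro!: bexI[of _ "\<lambda>z. 0"] lspan.lspan_zero)
  next
    case (lspan_step f e' c)
    then obtain m where e': "e' = (\<lambda>z. z powi m)" by auto
    obtain h' where h': "h' \<in> trig_polynomials" "\<And>z. cmod z = 1 \<Longrightarrow> h' z = f z * z powi n"
      using lspan_step by blast
    have "(\<lambda>z. h' z + c * z powi (m + n)) \<in> trig_polynomials"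
      by (rule lspan.lspan_step[OF h'(1)]) auto
    then show ?case
      by (rule bexI[rotated]) (auto simp: h'(2) e' power_int_add powi_unimodular(3) algebra_simps)
  qed
  then obtain h' where h': "h' \<in> trig_polynomials" "\<And>z. cmod z = 1 \<Longrightarrow> h' z = f z * z powi n"
    by blast
  show ?case
    by (rule bexI[OF _ lspan_add[OF lspan_scale[OF h'(1), of c] h(1)]]) (auto simp: h h' e algebra_simps)
qed

text \<open>This connects the Stone-Weierstrass theorem, which supplies real polynomials in the
  coordinates, with the integer powers of \<open>z\<close> whose integrals are known.\<close>

lemma real_polynomial_function_trig:
  fixes p :: "complex \<Rightarrow> real"
  assumes "real_polynomial_function p"
  shows "\<exists>h \<in> trig_polynomials. \<forall>z. cmod z = 1 \<longrightarrow> h z = complex_of_real (p z)"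
  using assms
proof induction
  case (linear f)
  interpret f: bounded_linear f by (rule linear)
  \<comment> \<open>On the circle \<open>Re z = (z + inverse z) / 2\<close> and
    \<open>Im z = (z - inverse z) / (2 * \<i>)\<close>; the coefficients come from substituting
    these in \<open>Re z * f 1 + Im z * f \<i>\<close>.\<close>
  let ?h = "\<lambda>z::complex. ((f 1 - f \<i> * \<i>) / 2) * z powi 1 + ((f 1 + f \<i> * \<i>) / 2) * z powi (-1)"
  have eq: "?h z = complex_of_real (f z)" if "cmod z = 1" for z
  proof -
    have "z = Re z *\<^sub>R 1 + Im z *\<^sub>R \<i>"
      by (simp add: complex_eq_iff)
    then have "f z = f (Re z *\<^sub>R 1 + Im z *\<^sub>R \<i>)"
      by (rule arg_cong)
    also have "\<dots> = Re z * f 1 + Im z * f \<i>"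
      by (simp add: f.add f.scaleR)
    finally have fz: "f z = Re z * f 1 + Im z * f \<i>" .
    have inv: "z powi (-1) = cnj z"
      using powi_unimodular[OF that] by (simp add: power_int_minus)
    show ?thesis
      unfolding inv fz power_int_1_right
      by (simp add: complex_eq_iff algebra_simps add_divide_distrib diff_divide_distrib)
  qed
  have mem: "?h \<in> trig_polynomials"
    using lspan_add[OF lspan_scale[OF powi_in_trig, of "(f 1 + f \<i> * \<i>) / 2" "-1"]
        lspan_scale[OF powi_in_trig, of "(f 1 - f \<i> * \<i>) / 2" 1]] .
  show ?case
    by (rule bexI[OF _ mem]) (use eq in blast)
next
  case (const c)
  show ?case
    by (rule bexI[OF _ lspan_scale[OF powi_in_trig, of "complex_of_real c" 0]]) simp
next
  case (add f g)
  then obtain h h' where "h \<in> trig_polynomials" "h' \<in> trig_polynomials"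
    "\<And>z. cmod z = 1 \<Longrightarrow> h z = complex_of_real (f z)" "\<And>z. cmod z = 1 \<Longrightarrow> h' z = complex_of_real (g z)"
    by blast
  then show ?case
    by (intro bexI[of _ "\<lambda>z. h z + h' z"] lspan_add) auto
next
  case (mult f g)
  then obtain h h' where h: "h \<in> trig_polynomials" "h' \<in> trig_polynomials"
    "\<And>z. cmod z = 1 \<Longrightarrow> h z = complex_of_real (f z)" "\<And>z. cmod z = 1 \<Longrightarrow> h' z = complex_of_real (g z)"
    by blast
  with trig_polynomial_mult[OF h(1,2)] show ?case by auto
qed

text \<open>The weighted images of \<open>u\<close> under \<open>b\<close> and of \<open>v\<close>
  under \<open>c\<close> are complex measures on the circle with equal Fourier coefficients. Uniform
  approximation on the circle by trigonometric polynomials makes them agree on continuous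
  functions.\<close>

lemma circle_moments_eq_continuous:
  fixes u b :: "'a \<Rightarrow> complex" and v c :: "'b \<Rightarrow> complex" and g :: "complex \<Rightarrow> real"
  assumes u: "integrable M u" and b [measurable]: "b \<in> borel_measurable M" and b1: "AE x in M. cmod (b x) = 1"
    and v: "integrable N v" and c [measurable]: "c \<in> borel_measurable N" and c1: "AE x in N. cmod (c x) = 1"
    and mom: "\<And>n::int. (LINT x|M. u x * b x powi n) = (LINT x|N. v x * c x powi n)"
    and g: "continuous_on UNIV g" and gb: "\<And>z. \<bar>g z\<bar> \<le> D"
  shows "(LINT x|M. u x * complex_of_real (g (b x))) = (LINT x|N. v x * complex_of_real (g (c x)))"
proof -
  have [measurable]: "g \<in> borel_measurable borel"
    using g by (rule borel_measurable_continuous_onI)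
  have int_powi: "integrable R (\<lambda>x. w x * d x powi n)"
    if "integrable R w" "d \<in> borel_measurable R" "AE x in R. cmod (d x) = 1" for R :: "'c measure" and w d :: "'c \<Rightarrow> complex" and n
    by (rule Bochner_Integration.integrable_bound[OF that(1)])
       (use that in \<open>auto simp: norm_mult powi_unimodular elim!: eventually_mono\<close>)
  have trig: "integrable M (\<lambda>x. u x * h (b x)) \<and> integrable N (\<lambda>x. v x * h (c x)) \<and>
      (LINT x|M. u x * h (b x)) = (LINT x|N. v x * h (c x))"
    if "h \<in> trig_polynomials" for h
    using that
  proof induction
    case (lspan_step f e k)
    then obtain n where e: "e = (\<lambda>z. z powi n)" by auto
    have "u x * (f (b x) + k * e (b x)) = u x * f (b x) + k * (u x * b x powi n)"
      "v y * (f (c y) + k * e (c y)) = v y * f (c y) + k * (v y * c y powi n)" for x y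
      by (auto simp: e algebra_simps)
    then show ?case
      using lspan_step int_powi[OF u b b1, of n] int_powi[OF v c c1, of n] by (simp add: mom)
  qed simp
  have int_g: "integrable R (\<lambda>x. w x * complex_of_real (g (d x)))"
    if "integrable R w" "d \<in> borel_measurable R" for R :: "'c measure" and w d :: "'c \<Rightarrow> complex"
  proof (rule Bochner_Integration.integrable_bound[OF integrable_mult_right[OF that(1), of "complex_of_real D"]])
    show "AE x in R. norm (w x * complex_of_real (g (d x))) \<le> norm (complex_of_real D * w x)"
      using gb order_trans[OF gb abs_ge_self[of D]] by (auto simp: norm_mult mult.commute[of _ "cmod _"] intro!: mult_left_mono)
  qed (use that in measurable)
  let ?d = "(LINT x|M. u x * complex_of_real (g (b x))) - (LINT x|N. v x * complex_of_real (g (c x)))"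
  \<comment> \<open>The total mass of both weights: replacing \<open>g\<close> by an approximant
    within \<open>r\<close> on the circle changes the two integrals together by at most
    \<open>r * C\<close>.\<close>
  define C where "C = (LINT x|M. cmod (u x)) + (LINT x|N. cmod (v x))"
  have C: "C \<ge> 0" by (simp add: C_def)
  have "cmod ?d \<le> 0 + e" if "e > 0" for e
  proof -
    define r where "r = e / (C + 1)"
    have r: "r > 0" using that C by (simp add: r_def add_nonneg_pos)
    obtain p where p: "real_polynomial_function p" "\<And>z. z \<in> sphere 0 1 \<Longrightarrow> \<bar>g z - p z\<bar> < r"
      using Stone_Weierstrass_real_polynomial_function[of "sphere (0::complex) 1" g r] r
        continuous_on_subset[OF g] by auto
    obtain h where h: "h \<in> trig_polynomials"
      "\<And>z. cmod z = 1 \<Longrightarrow> h z = complex_of_real (p z)"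
      using real_polynomial_function_trig[OF p(1)] by blast
    have gh: "cmod (complex_of_real (g z) - h z) \<le> r" if "cmod z = 1" for z
      using p(2)[of z] that by (simp add: h(2) less_imp_le flip: of_real_diff)
    have est: "cmod ((LINT x|R. w x * complex_of_real (g (d x))) - (LINT x|R. w x * h (d x))) \<le> r * (LINT x|R. cmod (w x))"
      if w: "integrable R w" "d \<in> borel_measurable R" "AE x in R. cmod (d x) = 1" "integrable R (\<lambda>x. w x * h (d x))"
      for R :: "'c measure" and w d :: "'c \<Rightarrow> complex"
    proof -
      note int = Bochner_Integration.integrable_diff[OF int_g[OF w(1,2)] w(4)]
      have "(LINT x|R. w x * complex_of_real (g (d x))) - (LINT x|R. w x * h (d x))
          = (LINT x|R. w x * complex_of_real (g (d x)) - w x * h (d x))"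
        by (rule Bochner_Integration.integral_diff[symmetric]) (use int_g w in auto)
      also have "cmod \<dots> \<le> (LINT x|R. cmod (w x * complex_of_real (g (d x)) - w x * h (d x)))"
        by (rule integral_norm_bound)
      also have "\<dots> \<le> (LINT x|R. r * cmod (w x))"
      proof (rule integral_mono_AE)
        show "AE x in R. cmod (w x * complex_of_real (g (d x)) - w x * h (d x)) \<le> r * cmod (w x)"
          using w(3)
        proof eventually_elim
          case (elim x)
          have "cmod (w x * complex_of_real (g (d x)) - w x * h (d x)) = cmod (w x) * cmod (complex_of_real (g (d x)) - h (d x))"
            by (simp add: norm_mult[symmetric] algebra_simps)
          also have "\<dots> \<le> cmod (w x) * r"
            by (intro mult_left_mono gh elim) simp
          finally show ?case by (simp add: mult.commute)
        qed
      qed (use integrable_norm[OF int] w in auto)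
      finally show ?thesis by simp
    qed
    have "cmod ?d = cmod (((LINT x|M. u x * complex_of_real (g (b x))) - (LINT x|M. u x * h (b x)))
        - ((LINT x|N. v x * complex_of_real (g (c x))) - (LINT x|N. v x * h (c x))))"
      using trig[OF h(1)] by simp
    also have "\<dots> \<le> r * (LINT x|M. cmod (u x)) + r * (LINT x|N. cmod (v x))"
      using trig[OF h(1)] by (intro norm_triangle_le_diff add_mono est u v b c b1 c1) auto
    also have "\<dots> = r * C" by (simp add: C_def algebra_simps)
    also have "\<dots> \<le> r * (C + 1)" using r by (simp add: mult_left_mono)
    also have "\<dots> = e" using C by (simp add: r_def)
    finally show ?thesis by simp
  qed
  then have "cmod ?d \<le> 0" by (rule field_le_epsilon)
  then show ?thesis by simp
qed

text \<open>Agreement passes from continuous functions to closed sets by monotone approximation of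
  the indicator and from closed sets to Borel sets by the Dynkin argument. As the weights are
  complex, the argument runs on integrals and dominated convergence rather than on nonnegative
  measures.\<close>

lemma circle_moments_eq:
  fixes u b :: "'a \<Rightarrow> complex" and v c :: "'b \<Rightarrow> complex"
  assumes u: "integrable M u" and b [measurable]: "b \<in> borel_measurable M" and b1: "AE x in M. cmod (b x) = 1"
    and v: "integrable N v" and c [measurable]: "c \<in> borel_measurable N" and c1: "AE x in N. cmod (c x) = 1"
    and mom: "\<And>n::int. (LINT x|M. u x * b x powi n) = (LINT x|N. v x * c x powi n)"
    and A: "A \<in> sets borel"
  shows "(LINT x|M. u x * indicator A (b x)) = (LINT x|N. v x * indicator A (c x))"
proof -
  have [measurable]: "u \<in> borel_measurable M" "v \<in> borel_measurable N"
    using u v by auto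
  have int_ind: "integrable R (\<lambda>x. w x * indicator S (d x))"
    if "integrable R w" "d \<in> borel_measurable R" "S \<in> sets borel" for R :: "'c measure" and w d :: "'c \<Rightarrow> complex" and S :: "complex set"
    by (rule Bochner_Integration.integrable_bound[OF that(1)])
       (use that in \<open>auto simp: norm_mult indicator_def\<close>)
  have "Int_stable (Collect closed :: complex set set)"
    by (auto simp: Int_stable_def)
  moreover have "Collect closed \<subseteq> Pow (UNIV :: complex set)"
    by auto
  moreover have "A \<in> sigma_sets UNIV (Collect closed)"
    using A by (simp add: borel_eq_closed)
  ultimately show ?thesis
  proof (induction A rule: sigma_sets_induct_disjoint)
    case (basic F)
    then have F: "closed F" by simp
    show ?case
    \<comment> \<open>\<open>infdist\<close> to the empty set is 0, so the functions
      \<open>g k\<close> below would be constantly 1; the empty set is therefore treated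
      separately.\<close>
    proof (cases "F = {}")
      case False
      \<comment> \<open>Equal to 1 on \<open>F\<close> and eventually 0 at each point outside,
        because points outside a closed set have positive distance from it.\<close>
      define g where "g k z = max 0 (1 - real k * infdist z F)" for k z
      have g_cont: "continuous_on UNIV (g k)" for k
        unfolding g_def by (intro continuous_intros)
      have [measurable]: "g k \<in> borel_measurable borel" for k
        using g_cont by (rule borel_measurable_continuous_onI)
      have g_bd: "\<bar>g k z\<bar> \<le> 1" for k z
        by (auto simp: g_def infdist_nonneg)
      have g_lim: "(\<lambda>k. g k z) \<longlonglongrightarrow> indicator F z" for z
      proof (cases "z \<in> F")
        case True
        then show ?thesis by (simp add: g_def)
      next
        case z: False
        then have pos: "infdist z F > 0"
          using infdist_pos_not_in_closed[OF F False] by auto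
        obtain K where K: "1 < real K * infdist z F"
          using reals_Archimedean3[OF pos] by blast
        have "g k z = 0" if "k \<ge> K" for k
        proof -
          have "real K * infdist z F \<le> real k * infdist z F"
            by (rule mult_right_mono) (use that pos in auto)
          with K show ?thesis by (simp add: g_def)
        qed
        then have "\<forall>\<^sub>F k in sequentially. g k z = 0"
          by (auto simp: eventually_sequentially)
        then show ?thesis using z by (simp add: tendsto_eventually)
      qed
      have lim: "(\<lambda>k. LINT x|R. w x * complex_of_real (g k (d x))) \<longlonglongrightarrow> (LINT x|R. w x * indicator F (d x))"
        if [measurable]: "integrable R w" "d \<in> borel_measurable R" for R :: "'c measure" and w d :: "'c \<Rightarrow> complex"
      proof (rule integral_dominated_convergence[where w = "\<lambda>x. cmod (w x)"])
        have [measurable]: "w \<in> borel_measurable R" "F \<in> sets borel" using that F by auto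
        show "(\<lambda>x. w x * indicator F (d x)) \<in> borel_measurable R"
          by measurable
        show "(\<lambda>x. w x * complex_of_real (g k (d x))) \<in> borel_measurable R" for k
          by measurable
        show "AE x in R. (\<lambda>k. w x * complex_of_real (g k (d x))) \<longlonglongrightarrow> w x * indicator F (d x)"
        proof (intro always_eventually allI tendsto_intros)
          fix x
          have "(\<lambda>k. complex_of_real (g k (d x))) \<longlonglongrightarrow> complex_of_real (indicator F (d x))"
            by (intro tendsto_of_real g_lim)
          then show "(\<lambda>k. complex_of_real (g k (d x))) \<longlonglongrightarrow> indicator F (d x)"
            by (cases "d x \<in> F") auto
        qed
        show "AE x in R. norm (w x * complex_of_real (g k (d x))) \<le> cmod (w x)" for k
        proof (intro always_eventually allI)
          fix x
          have "cmod (w x) * \<bar>g k (d x)\<bar> \<le> cmod (w x) * 1"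
            by (intro mult_left_mono g_bd norm_ge_zero)
          then show "norm (w x * complex_of_real (g k (d x))) \<le> cmod (w x)"
            by (simp add: norm_mult)
        qed
      qed (rule integrable_norm[OF that(1)])
      have "(LINT x|M. u x * complex_of_real (g k (b x))) = (LINT x|N. v x * complex_of_real (g k (c x)))" for k
        by (rule circle_moments_eq_continuous[OF u b b1 v c c1 mom g_cont g_bd])
      with lim[OF v c] have "(\<lambda>k. LINT x|M. u x * complex_of_real (g k (b x))) \<longlonglongrightarrow> (LINT x|N. v x * indicator F (c x))"
        by simp
      with lim[OF u b] show ?thesis by (rule LIMSEQ_unique)
    qed simp
  next
    case empty
    show ?case by simp
  next
    case (compl S)
    have S: "S \<in> sets borel" using compl by (simp add: borel_eq_closed)
    have eq: "indicator (UNIV - S) z = (1 - indicator S z :: complex)" for z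
      by (simp add: indicator_def)
    \<comment> \<open>Complements need equal total masses, which is the moment of order 0.\<close>
    have "(LINT x|M. u x) = (LINT x|N. v x)"
      using mom[of 0] by simp
    then show ?case
      using compl int_ind[OF u b S] int_ind[OF v c S] u v
      by (simp add: eq right_diff_distrib)
  next
    case (union S)
    have S [measurable]: "S i \<in> sets borel" for i
      using union by (auto simp: borel_eq_closed)
    have lim: "(\<lambda>k. \<Sum>i<k. LINT x|R. w x * indicator (S i) (d x)) \<longlonglongrightarrow> (LINT x|R. w x * indicator (\<Union>i. S i) (d x))"
      if [measurable]: "integrable R w" "d \<in> borel_measurable R" for R :: "'c measure" and w d :: "'c \<Rightarrow> complex"
    proof -
      have [measurable]: "w \<in> borel_measurable R" "(\<Union>i. S i) \<in> sets borel" "(\<Union>i<k. S i) \<in> sets borel" for k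
        using that S by auto
      have ind: "indicator (\<Union>i<k. S i) z = (\<Sum>i<k. indicator (S i) z :: complex)" for k z
        using union(1) by (intro indicator_UN_disjoint) (auto simp: disjoint_family_on_def)
      have "(\<lambda>k. LINT x|R. w x * indicator (\<Union>i<k. S i) (d x)) \<longlonglongrightarrow> (LINT x|R. w x * indicator (\<Union>i. S i) (d x))"
      proof (rule integral_dominated_convergence[where w = "\<lambda>x. cmod (w x)"])
        show "AE x in R. (\<lambda>k. w x * indicator (\<Union>i<k. S i) (d x)) \<longlonglongrightarrow> w x * indicator (\<Union>i. S i) (d x)"
          by (intro always_eventually allI tendsto_intros LIMSEQ_indicator_UN)
        show "AE x in R. norm (w x * indicator (\<Union>i<k. S i) (d x)) \<le> cmod (w x)" for k
          by (intro always_eventually allI) (simp add: norm_mult indicator_def)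
        show "(\<lambda>x. w x * indicator (\<Union>i. S i) (d x)) \<in> borel_measurable R"
          by measurable
        show "(\<lambda>x. w x * indicator (\<Union>i<k. S i) (d x)) \<in> borel_measurable R" for k
          by measurable
      qed (rule integrable_norm[OF that(1)])
      moreover have "(LINT x|R. w x * indicator (\<Union>i<k. S i) (d x)) = (\<Sum>i<k. LINT x|R. w x * indicator (S i) (d x))" for k
        unfolding ind sum_distrib_left
        by (rule Bochner_Integration.integral_sum) (rule int_ind[OF that S])
      ultimately show ?thesis by simp
    qed
    show ?case
      using lim[OF u b] lim[OF v c] unfolding union(3) by (rule LIMSEQ_unique)
  qed
qed

text \<open>For \<open>h\<close> in the set, the inner product of \<open>f\<close> with
  \<open>g\<close> equals that of \<open>f - h\<close> with \<open>g\<close>, which Cauchy-Schwarz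
  makes small. The Hardy space and the model spaces are both of this form, so one argument makes
  them closed.\<close>

lemma closed_L2_subspace_orthogonal:
  assumes K: "closed_L2_subspace M K" and G: "G \<subseteq> L2 M"
  shows "closed_L2_subspace M {f \<in> K. \<forall>g\<in>G. L2_inner M f g = 0}" (is "closed_L2_subspace M ?O")
proof -
  note KS = closed_L2_subspaceD[OF K]
  note KL = L2_subspace_L2[OF KS]
  have GL: "g \<in> L2 M" if "g \<in> G" for g using that G by auto
  have sub: "L2_subspace M ?O"
    unfolding L2_subspace_def
    by (auto simp: KL L2_subspace_zero[OF KS] L2_subspace_lincomb[OF KS] L2_inner_lincomb_left GL)
  have "f \<in> ?O" if f: "f \<in> L2_closure M ?O" for f
  proof -
    have fL: "f \<in> L2 M" using f by (auto simp: L2_closure_def)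
    have "f \<in> K"
      using f L2_closure_mono[of ?O K M] K by (auto simp: closed_L2_subspace_def)
    moreover have "L2_inner M f g = 0" if g: "g \<in> G" for g
    proof -
      have "cmod (L2_inner M f g) \<le> 0 + e" if "e > 0" for e
      proof -
        have "e / (L2_norm M g + 1) > 0"
          using that by (simp add: add_nonneg_pos)
        then obtain h where h: "h \<in> ?O" "L2_norm M (\<lambda>x. f x - h x) < e / (L2_norm M g + 1)"
          using f unfolding L2_closure_def by blast
        have hL: "h \<in> L2 M" using h KL by auto
        have "cmod (L2_inner M f g) = cmod (L2_inner M (\<lambda>x. f x - h x) g)"
          using h g by (simp add: L2_inner_diff_left fL hL GL)
        also have "\<dots> \<le> L2_norm M (\<lambda>x. f x - h x) * L2_norm M g"
          by (intro L2_Cauchy_Schwarz L2_diff fL hL GL g)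
        also have "\<dots> \<le> e / (L2_norm M g + 1) * (L2_norm M g + 1)"
          using h that by (intro mult_mono) auto
        also have "\<dots> = e"
        proof -
          have "L2_norm M g + 1 \<noteq> 0"
            using L2_norm_nonneg[of M g] by linarith
          then show ?thesis by simp
        qed
        finally show ?thesis by simp
      qed
      then have "cmod (L2_inner M f g) \<le> 0" by (rule field_le_epsilon)
      then show ?thesis by simp
    qed
    ultimately show ?thesis by blast
  qed
  then have "L2_closure M ?O \<subseteq> ?O" by (rule subsetI)
  with sub show ?thesis
    unfolding closed_L2_subspace_def by (rule conjI)
qed

section \<open>Hardy spaces and model spaces\<close>

lemma powi_L2: "(\<lambda>z. z powi n) \<in> L2 circle"
  by (rule circle.L2_bounded[where C = 1])
     (use AE_circle_norm in \<open>auto simp: powi_unimodular(1) elim!: eventually_mono\<close>)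

lemma AE_circle_nonzero: "AE z in circle. z \<noteq> 0"
  using AE_circle_norm by eventually_elim auto

lemma fourier_coeff_inner:
  assumes "f \<in> L2 circle"
  shows "fourier_coeff f n = L2_inner circle f (\<lambda>z. z powi n)"
  unfolding fourier_coeff_def L2_inner_def
proof (rule integral_cong_AE)
  show "AE z in circle. f z * z powi (- n) = f z * cnj (z powi n)"
    using AE_circle_norm by eventually_elim (simp only: powi_unimodular(4))
qed (use L2_D(1)[OF assms] in measurable)

lemma L2_inner_powi: "L2_inner circle (\<lambda>z. z powi m) (\<lambda>z. z powi n) = of_bool (m = n)"
proof -
  have "L2_inner circle (\<lambda>z. z powi m) (\<lambda>z. z powi n) = (LINT z|circle. z powi (m - n))"
    unfolding L2_inner_def
  proof (rule integral_cong_AE)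
    show "AE z in circle. z powi m * cnj (z powi n) = z powi (m - n)"
      using AE_circle_norm
    proof eventually_elim
      case (elim z)
      then show ?case
        using powi_unimodular[OF elim] power_int_add[of z m "- n"] by simp
    qed
  qed measurable
  then show ?thesis by (simp add: circle_integral_powi)
qed

text \<open>Uniqueness of Fourier coefficients for integrable functions, by comparison with the zero
  function: the integral of \<open>f\<close> over every Borel set vanishes.\<close>

lemma circle_moments_zero_imp_AE_zero:
  assumes "integrable circle f" "\<And>n. (LINT z|circle. f z * z powi n) = 0"
  shows "AE z in circle. f z = 0"
proof (rule circle.density_zero[OF assms(1)])
  fix A assume "A \<in> sets circle"
  then have "(LINT z|circle. f z * indicator A z) = (LINT z|circle. (\<lambda>_. 0) z * indicator A z)"
    using assms AE_circle_norm
    by (intro circle_moments_eq[where b = "\<lambda>z. z" and c = "\<lambda>z. z"]) auto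
  moreover have "set_lebesgue_integral circle A f = (LINT z|circle. f z * indicator A z)"
    unfolding set_lebesgue_integral_def
    by (rule Bochner_Integration.integral_cong) (simp_all add: indicator_def)
  ultimately show "set_lebesgue_integral circle A f = 0"
    by (simp only: mult_zero_left integral_zero)
qed

lemma orthogonal_powi_imp_AE_zero:
  assumes "f \<in> L2 circle" "\<And>n. L2_inner circle f (\<lambda>z. z powi n) = 0"
  shows "AE z in circle. f z = 0"
proof (rule circle_moments_zero_imp_AE_zero)
  show "(LINT z|circle. f z * z powi n) = 0" for n
    using assms(2)[of "- n"] fourier_coeff_inner[OF assms(1), of "- n"] by (simp add: fourier_coeff_def)
qed (rule circle.L2_integrable[OF assms(1)])

lemma L2_closure_trig: "L2_closure circle trig_polynomials = L2 circle"
  by (rule circle.lspan_dense[OF closed_L2_subspace_UNIV])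
     (auto simp: powi_L2 intro: orthogonal_powi_imp_AE_zero)

lemma hardy2_eq:
  "hardy2 = {f \<in> L2 circle. \<forall>g\<in>{\<lambda>z. z powi n |n. n < 0}. L2_inner circle f g = 0}"
  by (auto simp: hardy2_def fourier_coeff_inner)

lemma closed_L2_subspace_hardy2: "closed_L2_subspace circle hardy2"
  unfolding hardy2_eq
  by (rule closed_L2_subspace_orthogonal[OF closed_L2_subspace_UNIV]) (auto simp: powi_L2)

lemmas hardy2_subspace = closed_L2_subspaceD[OF closed_L2_subspace_hardy2]

lemma hardy2_L2: "f \<in> hardy2 \<Longrightarrow> f \<in> L2 circle"
  by (simp add: hardy2_def)

lemma power_hardy2: "(\<lambda>z. z ^ n) \<in> hardy2"
  using powi_L2[of "int n"] L2_inner_powi[of "int n"] by (auto simp: hardy2_eq)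

lemma hardy2_AE_zero:
  assumes f: "f \<in> hardy2" and orth: "\<And>n::nat. L2_inner circle f (\<lambda>z. z ^ n) = 0"
  shows "AE z in circle. f z = 0"
proof (rule orthogonal_powi_imp_AE_zero[OF hardy2_L2[OF f]])
  fix n :: int
  show "L2_inner circle f (\<lambda>z. z powi n) = 0"
  proof (cases "n < 0")
    case True
    then show ?thesis using f by (auto simp: hardy2_eq)
  next
    case False
    then show ?thesis using orth[of "nat n"] by (simp add: power_int_def)
  qed
qed

lemma L2_closure_power: "L2_closure circle (lspan (range (\<lambda>n::nat. \<lambda>z. z ^ n))) = hardy2"
  by (rule circle.lspan_dense[OF closed_L2_subspace_hardy2])
     (auto simp: power_hardy2 intro: hardy2_AE_zero)

text \<open>The powers of \<open>z\<close> span a dense subspace of the Hardy space. The function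
  \<open>k\<close> may be any element of \<open>L2\<close>, which later allows factors such as
  conjugated inner functions to be moved into it.\<close>

lemma hardy2_inner_eq_0:
  assumes f: "f \<in> hardy2" and k: "k \<in> L2 circle"
    and orth: "\<And>n::nat. L2_inner circle (\<lambda>z. z ^ n) k = 0"
  shows "L2_inner circle f k = 0"
proof (rule functional_eq_0[OF hardy2_subspace, where G = "range (\<lambda>n::nat. \<lambda>z. z ^ n)"
      and \<Lambda> = "\<lambda>f. L2_inner circle f k" and C = "L2_norm circle k"])
  show "L2_inner circle (\<lambda>x. f x + c * g x) k = L2_inner circle f k + c * L2_inner circle g k"
    if "f \<in> hardy2" "g \<in> hardy2" for f g c
    using L2_inner_lincomb_left[of f circle g k 1 c] that k by (simp add: hardy2_L2)
  show "cmod (L2_inner circle f k) \<le> L2_norm circle k * L2_norm circle f" if "f \<in> hardy2" for f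
    using L2_Cauchy_Schwarz[of f circle k] that k by (simp add: hardy2_L2 mult.commute)
qed (use orth L2_closure_power in \<open>auto simp: power_hardy2 f\<close>)

lemma fourier_coeff_0_power: "fourier_coeff (\<lambda>z. z ^ n) 0 = of_bool (n = 0)"
  using fourier_coeff_inner[OF powi_L2[of "int n"], of 0] L2_inner_powi[of "int n" 0] by simp

text \<open>Integration against normalized measure is evaluation at 0, hence multiplicative on
  analytic functions. For \<open>f = z\<^sup>n\<close> the integral is a Fourier coefficient of
  \<open>g\<close> at \<open>- n\<close>, which vanishes unless \<open>n = 0\<close>; density of the
  powers gives the rest.\<close>

lemma integral_hardy2_mult:
  assumes f: "f \<in> hardy2" and g: "g \<in> hardy2"
  shows "(LINT z|circle. f z * g z) = fourier_coeff f 0 * fourier_coeff g 0"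
proof -
  have one: "(\<lambda>z. 1) \<in> L2 circle" using powi_L2[of 0] by simp
  have cg: "(\<lambda>z. cnj (g z)) \<in> L2 circle"
    by (rule L2_cnj[OF hardy2_L2[OF g]])
  \<comment> \<open>This test function is the conjugate of \<open>g\<close> minus its mean; its
    inner product with \<open>f\<close> is exactly the difference of the two sides.\<close>
  have k: "(\<lambda>z. 1 * cnj (g z) + (- cnj (fourier_coeff g 0)) * 1) \<in> L2 circle"
    by (rule L2_lincomb[OF cg one])
  have inner_k: "L2_inner circle h (\<lambda>z. 1 * cnj (g z) + (- cnj (fourier_coeff g 0)) * 1)
    = (LINT z|circle. h z * g z) - fourier_coeff g 0 * fourier_coeff h 0" if "h \<in> hardy2" for h
    using L2_inner_lincomb_right[OF cg one hardy2_L2[OF that], of 1 "- cnj (fourier_coeff g 0)"]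
    by (simp add: L2_inner_def fourier_coeff_def)
  have "L2_inner circle f (\<lambda>z. 1 * cnj (g z) + (- cnj (fourier_coeff g 0)) * 1) = 0"
  proof (rule hardy2_inner_eq_0[OF f k])
    fix n :: nat
    have eq: "(LINT z|circle. z ^ n * g z) = fourier_coeff g (- int n)"
      by (simp add: fourier_coeff_def mult.commute)
    have "fourier_coeff g (- int n) = fourier_coeff g 0 * of_bool (n = 0)"
      using g by (cases "n = 0") (simp_all add: hardy2_def)
    then show "L2_inner circle (\<lambda>z. z ^ n) (\<lambda>z. 1 * cnj (g z) + (- cnj (fourier_coeff g 0)) * 1) = 0"
      unfolding inner_k[OF power_hardy2] eq fourier_coeff_0_power by simp
  qed
  then show ?thesis
    unfolding inner_k[OF f] by (simp add: mult.commute)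
qed

lemma fourier_coeff_mult_powi:
  assumes [measurable]: "f \<in> borel_measurable borel"
  shows "fourier_coeff (\<lambda>z. f z * z powi k) n = fourier_coeff f (n - k)"
  unfolding fourier_coeff_def
proof (rule integral_cong_AE)
  show "AE z in circle. f z * z powi k * z powi (- n) = f z * z powi (- (n - k))"
    using AE_circle_nonzero
  proof eventually_elim
    case (elim z)
    then show ?case using power_int_add[of z k "- n"] by (simp add: mult.assoc)
  qed
qed measurable

lemma L2_mult_powi:
  assumes "f \<in> L2 circle"
  shows "(\<lambda>z. f z * z powi k) \<in> L2 circle"
  by (rule L2_mult_bounded[OF assms, where C = 1])
     (use AE_circle_norm in \<open>auto simp: powi_unimodular(1) elim!: eventually_mono\<close>)

lemma hardy2_mult_power:
  assumes "f \<in> hardy2"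
  shows "(\<lambda>z. f z * z ^ k) \<in> hardy2"
  using L2_mult_powi[OF hardy2_L2[OF assms], of "int k"] fourier_coeff_mult_powi[of f "int k"]
    L2_D(1)[OF hardy2_L2[OF assms]] assms
  by (simp add: hardy2_def)

lemma hardy_inf_hardy2: "f \<in> hardy_inf \<Longrightarrow> f \<in> hardy2"
  by (simp add: hardy_inf_def)

lemma hardy_infE:
  assumes "f \<in> hardy_inf"
  obtains C where "AE z in circle. cmod (f z) \<le> C"
  using assms by (auto simp: hardy_inf_def)

lemma L2_mult_hardy_inf:
  assumes "f \<in> L2 circle" "g \<in> hardy_inf"
  shows "(\<lambda>z. f z * g z) \<in> L2 circle"
proof -
  obtain C where "AE z in circle. cmod (g z) \<le> C" using assms(2) by (rule hardy_infE)
  then show ?thesis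
    using L2_mult_bounded[OF assms(1) L2_D(1)[OF hardy2_L2[OF hardy_inf_hardy2[OF assms(2)]]]] by blast
qed

text \<open>A negative coefficient of the product is the mean of \<open>f\<close> times
  \<open>g z\<^sup>k\<close> with \<open>k > 0\<close>. This is a product of means, and the second
  mean is a negative coefficient of \<open>g\<close>. Boundedness of \<open>g\<close> only serves to
  keep the product in \<open>L2\<close>.\<close>

lemma hardy2_mult:
  assumes f: "f \<in> hardy2" and g: "g \<in> hardy_inf"
  shows "(\<lambda>z. f z * g z) \<in> hardy2"
proof -
  have g2: "g \<in> hardy2" using g by (rule hardy_inf_hardy2)
  have gm: "g \<in> borel_measurable borel"
    using L2_D(1)[OF hardy2_L2[OF g2]] by simp
  have "fourier_coeff (\<lambda>z. f z * g z) n = 0" if "n < 0" for n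
  proof -
    define k where "k = nat (- n)"
    have k: "- n = int k" "k > 0" using that by (auto simp: k_def)
    have "fourier_coeff (\<lambda>z. f z * g z) n = (LINT z|circle. f z * (g z * z ^ k))"
      by (simp add: fourier_coeff_def k mult.assoc)
    also have "\<dots> = fourier_coeff f 0 * fourier_coeff (\<lambda>z. g z * z ^ k) 0"
      by (rule integral_hardy2_mult[OF f hardy2_mult_power[OF g2]])
    also have "fourier_coeff (\<lambda>z. g z * z ^ k) 0 = 0"
      using fourier_coeff_mult_powi[OF gm, of "int k" 0] g2 k by (simp add: hardy2_def)
    finally show ?thesis by simp
  qed
  with L2_mult_hardy_inf[OF hardy2_L2[OF f] g] show ?thesis
    by (simp add: hardy2_def)
qed

lemma hardy_inf_mult:
  assumes f: "f \<in> hardy_inf" and g: "g \<in> hardy_inf"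
  shows "(\<lambda>z. f z * g z) \<in> hardy_inf"
proof -
  obtain C D where C: "AE z in circle. cmod (f z) \<le> C" and D: "AE z in circle. cmod (g z) \<le> D"
    using f g by (metis hardy_infE)
  have "AE z in circle. cmod (f z * g z) \<le> C * D"
    using C D
  proof eventually_elim
    case (elim z)
    have "cmod (f z) * cmod (g z) \<le> C * D"
      by (intro mult_mono elim norm_ge_zero order_trans[OF norm_ge_zero elim(1)])
    then show ?case by (simp add: norm_mult)
  qed
  then show ?thesis
    using hardy2_mult[OF hardy_inf_hardy2[OF f] g] by (auto simp: hardy_inf_def)
qed

lemma hardy_inf_lincomb:
  assumes f: "f \<in> hardy_inf" and g: "g \<in> hardy_inf"
  shows "(\<lambda>z. a * f z + b * g z) \<in> hardy_inf"
proof -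
  obtain C D where C: "AE z in circle. cmod (f z) \<le> C" and D: "AE z in circle. cmod (g z) \<le> D"
    using f g by (metis hardy_infE)
  have "AE z in circle. cmod (a * f z + b * g z) \<le> cmod a * C + cmod b * D"
    using C D
  proof eventually_elim
    case (elim z)
    have "cmod a * cmod (f z) + cmod b * cmod (g z) \<le> cmod a * C + cmod b * D"
      by (intro add_mono mult_left_mono elim norm_ge_zero)
    then show ?case using norm_triangle_ineq[of "a * f z" "b * g z"] by (simp add: norm_mult)
  qed
  then show ?thesis
    using L2_subspace_lincomb[OF hardy2_subspace hardy_inf_hardy2[OF f] hardy_inf_hardy2[OF g], of a b]
    by (auto simp: hardy_inf_def)
qed

lemma power_hardy_inf: "(\<lambda>z. z ^ n) \<in> hardy_inf"
proof -
  have "AE z in circle. cmod (z ^ n) \<le> 1"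
    using AE_circle_norm by eventually_elim (simp add: norm_power)
  then show ?thesis using power_hardy2 by (auto simp: hardy_inf_def)
qed

lemma const_hardy_inf: "(\<lambda>z. c) \<in> hardy_inf"
  using hardy_inf_lincomb[OF power_hardy_inf[of 0] power_hardy_inf[of 0], of c 0] by simp

lemma hardy_inf_power:
  assumes "f \<in> hardy_inf"
  shows "(\<lambda>z. f z ^ n) \<in> hardy_inf"
proof (induction n)
  case 0
  show ?case using const_hardy_inf[of 1] by simp
next
  case (Suc n)
  show ?case using hardy_inf_mult[OF assms Suc] by simp
qed

lemma hardy_inf_sum:
  assumes "\<And>i. i \<in> I \<Longrightarrow> f i \<in> hardy_inf"
  shows "(\<lambda>z. \<Sum>i\<in>I. f i z) \<in> hardy_inf"
  using assms
proof (induction I rule: infinite_finite_induct)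
  case (insert i I)
  then show ?case
    using hardy_inf_lincomb[of "f i" "\<lambda>z. \<Sum>i\<in>I. f i z" 1 1] by simp
qed (use const_hardy_inf[of 0] in simp_all)

section \<open>Inner functions and their model spaces\<close>

lemma inner_functionD:
  assumes "inner_function \<Theta>"
  shows "\<Theta> \<in> hardy_inf" "\<Theta> \<in> hardy2" "\<Theta> \<in> L2 circle" "\<Theta> \<in> borel_measurable borel"
    "AE z in circle. cmod (\<Theta> z) = 1"
proof -
  show 1: "AE z in circle. cmod (\<Theta> z) = 1" "\<Theta> \<in> hardy2"
    using assms by (auto simp: inner_function_def)
  then show "\<Theta> \<in> hardy_inf"
    by (auto simp: hardy_inf_def elim!: eventually_mono intro!: exI[of _ 1])
  show "\<Theta> \<in> L2 circle" using 1 by (simp add: hardy2_L2)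
  then show "\<Theta> \<in> borel_measurable borel"
    using L2_D(1) by fastforce
qed

lemma closed_L2_subspace_model_space:
  assumes "inner_function \<Theta>"
  shows "closed_L2_subspace circle (model_space \<Theta>)"
proof -
  have eq: "model_space \<Theta> = {f \<in> hardy2. \<forall>g\<in>(\<lambda>g z. \<Theta> z * g z) ` hardy2. L2_inner circle f g = 0}"
    by (auto simp: model_space_def)
  have "(\<lambda>g z. \<Theta> z * g z) ` hardy2 \<subseteq> L2 circle"
    using L2_mult_hardy_inf[OF hardy2_L2 inner_functionD(1)[OF assms]] by (auto simp: mult.commute)
  then show ?thesis
    unfolding eq by (rule closed_L2_subspace_orthogonal[OF closed_L2_subspace_hardy2])
qed

lemma model_space_hardy2: "f \<in> model_space \<Theta> \<Longrightarrow> f \<in> hardy2"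
  by (simp add: model_space_def)

lemma model_space_L2: "f \<in> model_space \<Theta> \<Longrightarrow> f \<in> L2 circle"
  by (simp add: model_space_def hardy2_L2)

lemma space_circle: "space circle = UNIV"
  by (simp add: circle_def)

text \<open>Orthogonality to \<open>\<Theta> g\<close> is orthogonality of \<open>g\<close> to the
  fixed \<open>L2\<close> function \<open>f\<close> times the conjugate of \<open>\<Theta>\<close>,
  so it can be tested on powers of \<open>z\<close>.\<close>

lemma model_spaceI:
  assumes \<Theta>: "inner_function \<Theta>" and f: "f \<in> hardy2"
    and orth: "\<And>n::nat. L2_inner circle f (\<lambda>z. \<Theta> z * z ^ n) = 0"
  shows "f \<in> model_space \<Theta>"
  unfolding model_space_def
proof (intro CollectI conjI ballI f)
  fix g assume g: "g \<in> hardy2"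
  note \<Theta>D = inner_functionD[OF \<Theta>]
  have eq: "L2_inner circle h (\<lambda>z. f z * cnj (\<Theta> z)) = cnj (L2_inner circle f (\<lambda>z. \<Theta> z * h z))" for h
    unfolding L2_inner_commute[of circle "\<lambda>z. \<Theta> z * h z" f, symmetric]
    by (simp add: L2_inner_def mult_ac)
  have u: "(\<lambda>z. f z * cnj (\<Theta> z)) \<in> L2 circle"
  proof (rule L2_mult_bounded[OF hardy2_L2[OF f]])
    show "(\<lambda>z. cnj (\<Theta> z)) \<in> borel_measurable circle"
      using \<Theta>D(4) by (simp add: borel_measurable_cnj)
    show "AE z in circle. cmod (cnj (\<Theta> z)) \<le> 1"
      using \<Theta>D(5) by eventually_elim simp
  qed
  have "L2_inner circle g (\<lambda>z. f z * cnj (\<Theta> z)) = 0"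
    by (rule hardy2_inner_eq_0[OF g u]) (simp add: eq orth)
  then show "L2_inner circle f (\<lambda>z. \<Theta> z * g z) = 0"
    unfolding eq by simp
qed

lemma L2_norm_inner_function:
  assumes "inner_function \<Theta>"
  shows "L2_norm circle \<Theta> = 1"
  using L2_norm_mult_unimodular[of "\<lambda>z. 1" circle \<Theta>] inner_functionD[OF assms] powi_L2[of 0]
  by (simp add: L2_norm_def circle.prob_space)

text \<open>\<open>inner_power_quot \<Theta> n\<close> is the projection of \<open>cnj \<Theta> z\<^sup>n\<close> onto the Hardy space, a polynomial of degree
  at most \<open>n\<close>, so that \<open>model_power \<Theta> n\<close> is the projection of \<open>z\<^sup>n\<close> onto the model space.\<close>

definition inner_power_quot :: "(complex \<Rightarrow> complex) \<Rightarrow> nat \<Rightarrow> complex \<Rightarrow> complex" where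
  "inner_power_quot \<Theta> n z = (\<Sum>k\<le>n. cnj (fourier_coeff \<Theta> (int n - int k)) * z ^ k)"

definition model_power :: "(complex \<Rightarrow> complex) \<Rightarrow> nat \<Rightarrow> complex \<Rightarrow> complex" where
  "model_power \<Theta> n z = z ^ n - \<Theta> z * inner_power_quot \<Theta> n z"

lemma inner_power_quot_hardy_inf: "inner_power_quot \<Theta> n \<in> hardy_inf"
  unfolding inner_power_quot_def[abs_def]
  by (intro hardy_inf_sum hardy_inf_mult const_hardy_inf power_hardy_inf)

lemma model_power_hardy_inf:
  assumes "inner_function \<Theta>"
  shows "model_power \<Theta> n \<in> hardy_inf"
  using hardy_inf_lincomb[OF power_hardy_inf hardy_inf_mult[OF inner_functionD(1)[OF assms]
        inner_power_quot_hardy_inf], of 1 n "-1" \<Theta> n]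
  by (simp add: model_power_def[abs_def])

lemma L2_inner_inner_function_mult:
  assumes \<Theta>: "inner_function \<Theta>" and f: "f \<in> L2 circle" and g: "g \<in> L2 circle"
  shows "L2_inner circle (\<lambda>z. \<Theta> z * f z) (\<lambda>z. \<Theta> z * g z) = L2_inner circle f g"
  unfolding L2_inner_def
proof (rule integral_cong_AE)
  show "AE z in circle. \<Theta> z * f z * cnj (\<Theta> z * g z) = f z * cnj (g z)"
    using inner_functionD(5)[OF \<Theta>]
  proof eventually_elim
    case (elim z)
    have "\<Theta> z * f z * cnj (\<Theta> z * g z) = (\<Theta> z * cnj (\<Theta> z)) * (f z * cnj (g z))"
      by (simp add: mult_ac)
    then show ?case by (simp only: unimodular_mult_cnj[OF elim] mult_1)
  qed
qed (use inner_functionD(4)[OF \<Theta>] L2_D(1)[OF f] L2_D(1)[OF g] in measurable)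

lemma model_power_in_model_space:
  assumes \<Theta>: "inner_function \<Theta>"
  shows "model_power \<Theta> n \<in> model_space \<Theta>"
proof (rule model_spaceI[OF \<Theta> hardy_inf_hardy2[OF model_power_hardy_inf[OF \<Theta>]]])
  fix m :: nat
  let ?q = "inner_power_quot \<Theta> n"
  note \<Theta>D = inner_functionD[OF \<Theta>]
  have pL: "(\<lambda>z. z ^ i) \<in> L2 circle" for i
    by (rule hardy2_L2[OF power_hardy2])
  have q: "?q \<in> L2 circle"
    by (rule hardy2_L2[OF hardy_inf_hardy2[OF inner_power_quot_hardy_inf]])
  have \<Theta>q: "(\<lambda>z. \<Theta> z * ?q z) \<in> L2 circle"
    by (rule L2_mult_hardy_inf[OF \<Theta>D(3) inner_power_quot_hardy_inf])
  have \<Theta>m: "(\<lambda>z. \<Theta> z * z ^ m) \<in> L2 circle"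
    by (rule L2_mult_hardy_inf[OF \<Theta>D(3) power_hardy_inf])
  have "L2_inner circle (\<lambda>z. z ^ n) (\<lambda>z. \<Theta> z * z ^ m) = cnj (L2_inner circle (\<lambda>z. \<Theta> z * z ^ m) (\<lambda>z. z ^ n))"
    by (rule L2_inner_commute)
  also have "L2_inner circle (\<lambda>z. \<Theta> z * z ^ m) (\<lambda>z. z ^ n) = fourier_coeff \<Theta> (int n - int m)"
    using fourier_coeff_inner[OF \<Theta>m, of "int n"] fourier_coeff_mult_powi[OF \<Theta>D(4), of "int m" "int n"] by simp
  finally have 1: "L2_inner circle (\<lambda>z. z ^ n) (\<lambda>z. \<Theta> z * z ^ m) = cnj (fourier_coeff \<Theta> (int n - int m))" .
  have "L2_inner circle ?q (\<lambda>z. z ^ m)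
      = (\<Sum>i\<le>n. L2_inner circle (\<lambda>z. cnj (fourier_coeff \<Theta> (int n - int i)) * z ^ i) (\<lambda>z. z ^ m))"
    unfolding inner_power_quot_def[abs_def]
    by (rule L2_inner_sum_left[OF _ L2_scale[OF pL] pL]) simp
  also have "\<dots> = (\<Sum>i\<le>n. if i = m then cnj (fourier_coeff \<Theta> (int n - int m)) else 0)"
    using L2_inner_powi[of "int i" "int m" for i]
    by (intro sum.cong) (auto simp: L2_inner_def mult.assoc)
  \<comment> \<open>For \<open>m > n\<close> the index \<open>m\<close> does not occur in the sum,
    and the coefficient on the right has negative index, so both sides are 0.\<close>
  also have "\<dots> = cnj (fourier_coeff \<Theta> (int n - int m))"
    using \<Theta>D(2) by (auto simp: hardy2_def)
  finally show "L2_inner circle (model_power \<Theta> n) (\<lambda>z. \<Theta> z * z ^ m) = 0"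
    unfolding model_power_def[abs_def]
    by (simp add: L2_inner_diff_left[OF pL \<Theta>q \<Theta>m] 1 L2_inner_inner_function_mult[OF \<Theta> q pL])
qed

lemma model_space_inner_mult_zero:
  assumes "f \<in> model_space \<Theta>" "g \<in> hardy2"
  shows "L2_inner circle f (\<lambda>z. \<Theta> z * g z) = 0" "L2_inner circle (\<lambda>z. \<Theta> z * g z) f = 0"
  using assms L2_inner_commute[of circle "\<lambda>z. \<Theta> z * g z" f] by (auto simp: model_space_def)

lemma model_space_inner_model_power:
  assumes \<Theta>: "inner_function \<Theta>" and f: "f \<in> model_space \<Theta>"
  shows "L2_inner circle f (model_power \<Theta> n) = L2_inner circle f (\<lambda>z. z ^ n)"
proof -
  let ?q = "inner_power_quot \<Theta> n"
  have q: "?q \<in> hardy2"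
    by (rule hardy_inf_hardy2[OF inner_power_quot_hardy_inf])
  have \<Theta>q: "(\<lambda>z. \<Theta> z * ?q z) \<in> L2 circle"
    by (rule hardy2_L2[OF hardy2_mult[OF inner_functionD(2)[OF \<Theta>] inner_power_quot_hardy_inf]])
  show ?thesis
    unfolding model_power_def[abs_def]
    using L2_inner_diff_right[OF hardy2_L2[OF power_hardy2] \<Theta>q model_space_L2[OF f]]
    by (simp add: model_space_inner_mult_zero(1)[OF f q])
qed

text \<open>On the model space, inner products with \<open>model_power \<Theta> n\<close> and with
  \<open>z\<^sup>n\<close> coincide, since the difference lies in the orthogonal part. A function
  orthogonal to all generators thus has no nonzero Fourier coefficient. As the generators are
  bounded, this is also the density of the domain of truncated Toeplitz operators.\<close>

lemma L2_closure_model_power: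
  assumes \<Theta>: "inner_function \<Theta>"
  shows "L2_closure circle (lspan (range (model_power \<Theta>))) = model_space \<Theta>"
proof (rule circle.lspan_dense[OF closed_L2_subspace_model_space[OF \<Theta>]])
  fix f assume f: "f \<in> model_space \<Theta>"
    and orth: "\<And>g. g \<in> range (model_power \<Theta>) \<Longrightarrow> L2_inner circle f g = 0"
  show "AE z in circle. f z = 0"
    by (rule hardy2_AE_zero[OF model_space_hardy2[OF f]])
       (use orth model_space_inner_model_power[OF \<Theta> f] in auto)
qed (use model_power_in_model_space[OF \<Theta>] in auto)

text \<open>Since \<open>B\<close> has norm 1, the squared distance from \<open>B\<close> to its
  mean \<open>b\<close> is \<open>1 - |b|\<^sup>2\<close>; it is 0 only for constant
  \<open>B\<close>.\<close>

lemma inner_nonconstant_coeff_0: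
  assumes B: "inner_function B" and nc: "nonconstant B"
  shows "cmod (fourier_coeff B 0) < 1"
proof -
  let ?b = "fourier_coeff B 0"
  note BD = inner_functionD[OF B]
  have one: "(\<lambda>z. 1) \<in> L2 circle" "L2_norm circle (\<lambda>z. 1) = 1"
    using powi_L2[of 0] by (simp_all add: L2_norm_def circle.prob_space)
  note nB = L2_norm_inner_function[OF B]
  have "L2_inner circle B (\<lambda>z. 1) = ?b"
    using fourier_coeff_inner[OF BD(3), of 0] by simp
  then have eq: "(L2_norm circle (\<lambda>z. B z + (- ?b) * 1))\<^sup>2 = 1 - (cmod ?b)\<^sup>2"
    using L2_norm_add_scale_sq[OF BD(3) one(1), of "- ?b"] nB one(2)
    by (simp add: cmod_power2 power2_eq_square[of "Re _"] power2_eq_square[of "Im _"])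
  have L: "(\<lambda>z. B z + (- ?b) * 1) \<in> L2 circle"
    using L2_lincomb[OF BD(3) one(1), of 1 "- ?b"] by simp
  have "1 - (cmod ?b)\<^sup>2 \<noteq> 0"
  proof
    assume "1 - (cmod ?b)\<^sup>2 = 0"
    with eq have "L2_norm circle (\<lambda>z. B z + (- ?b) * 1) = 0" by simp
    then have "AE z in circle. B z + (- ?b) * 1 = 0"
      using L2_norm_eq_0_iff[OF L] by simp
    then have "AE z in circle. B z = ?b" by simp
    then show False using nc by (auto simp: nonconstant_def)
  qed
  with eq zero_le_power2[of "L2_norm circle (\<lambda>z. B z + (- ?b) * 1)"]
  have "(cmod ?b)\<^sup>2 < 1" by linarith
  then show ?thesis by (simp add: power_less_one_iff abs_square_less_1)
qed

lemma model_power_0_bound: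
  assumes "inner_function B"
  shows "AE z in circle. cmod (model_power B 0 z) \<ge> 1 - cmod (fourier_coeff B 0)"
  using inner_functionD(5)[OF assms]
proof eventually_elim
  case (elim z)
  have "cmod (model_power B 0 z) = cmod (1 - B z * cnj (fourier_coeff B 0))"
    by (simp add: model_power_def inner_power_quot_def)
  also have "\<dots> \<ge> cmod 1 - cmod (B z * cnj (fourier_coeff B 0))"
    by (rule norm_triangle_ineq2)
  finally show ?case using elim by (simp add: norm_mult)
qed

section \<open>Composition with an inner function\<close>

text \<open>For positive \<open>n\<close> the function \<open>B\<^sup>n h\<close> is a multiple of
  \<open>B\<close> in the Hardy space and hence orthogonal to \<open>h'\<close>. For negative
  \<open>n\<close> the factor is moved to \<open>h'\<close> by conjugation and the roles are
  exchanged.\<close>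

lemma model_space_moments:
  assumes B: "inner_function B" and h: "h \<in> model_space B" and h': "h' \<in> model_space B"
  shows "(LINT z|circle. h z * cnj (h' z) * B z powi n) = of_bool (n = 0) * L2_inner circle h h'"
proof -
  note BD = inner_functionD[OF B]
  note [measurable] = BD(4)
  have [measurable]: "h \<in> borel_measurable borel" "h' \<in> borel_measurable borel"
    using L2_D(1)[OF model_space_L2[OF h]] L2_D(1)[OF model_space_L2[OF h']] by auto
  \<comment> \<open>Nonzero exponents are written with \<open>Suc k\<close> to split off the one
    factor \<open>B\<close> that orthogonality uses.\<close>
  consider "n = 0" | k where "n = int (Suc k)" | k where "n = - int (Suc k)"
    by (metis int_cases3 Suc_pred of_nat_0_less_iff)
  then show ?thesis
  proof cases
    case 1
    then show ?thesis by (simp add: L2_inner_def)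
  next
    case (2 k)
    have "(LINT z|circle. h z * cnj (h' z) * B z powi n)
        = L2_inner circle (\<lambda>z. B z * (h z * B z ^ k)) h'"
      by (simp add: L2_inner_def 2 power_int_add_1 mult_ac flip: of_nat_Suc)
    also have "\<dots> = 0"
      by (rule model_space_inner_mult_zero(2)[OF h' hardy2_mult[OF model_space_hardy2[OF h] hardy_inf_power[OF BD(1)]]])
    finally show ?thesis by (simp add: 2)
  next
    case (3 k)
    have "(LINT z|circle. h z * cnj (h' z) * B z powi n)
        = L2_inner circle h (\<lambda>z. B z * (h' z * B z ^ k))"
      unfolding L2_inner_def
    proof (rule integral_cong_AE)
      show "AE z in circle. h z * cnj (h' z) * B z powi n = h z * cnj (B z * (h' z * B z ^ k))"
        using BD(5)
      proof eventually_elim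
        case (elim z)
        have "B z powi n = cnj (B z powi int (Suc k))"
          using powi_unimodular(4)[OF elim, of "int (Suc k)"] 3 by simp
        then show ?case by (simp add: mult_ac del: of_nat_Suc)
      qed
    qed measurable
    also have "\<dots> = 0"
      by (rule model_space_inner_mult_zero(1)[OF h hardy2_mult[OF model_space_hardy2[OF h'] hardy_inf_power[OF BD(1)]]])
    finally show ?thesis by (simp add: 3)
  qed
qed

text \<open>The pushforward identity is stated for nonnegative integrals, so it applies to
  indicators of null sets and to functions whose integrability after composition is still to be
  shown.\<close>

lemma nn_integral_model_space_compose:
  assumes B: "inner_function B" and h: "h \<in> model_space B" and f: "f \<in> borel_measurable borel"
  shows "(\<integral>\<^sup>+ z. ennreal ((cmod (h z))\<^sup>2) * f (B z) \<partial>circle)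
    = ennreal ((L2_norm circle h)\<^sup>2) * (\<integral>\<^sup>+ z. f z \<partial>circle)"
proof -
  note BD = inner_functionD[OF B]
  note [measurable] = BD(4) f
  note hL = model_space_L2[OF h]
  have [measurable]: "h \<in> borel_measurable borel"
    using L2_D(1)[OF hL] by auto
  have "distr (density circle (\<lambda>z. ennreal ((cmod (h z))\<^sup>2))) borel B
      = density circle (\<lambda>z. ennreal ((L2_norm circle h)\<^sup>2))" (is "?L = ?R")
  proof (rule measure_eqI)
    show "sets ?L = sets ?R" by simp
    fix A assume "A \<in> sets ?L"
    then have [measurable]: "A \<in> sets borel" by simp
    have int: "integrable circle (\<lambda>z. (cmod (h z))\<^sup>2 * indicator A (B z))"
      by (rule Bochner_Integration.integrable_bound[OF L2_D(2)[OF hL]]) (auto simp: indicator_def)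
    have "(LINT z|circle. (h z * cnj (h z)) * indicator A (B z))
        = (LINT z|circle. L2_inner circle h h * indicator A z)"
    proof (rule circle_moments_eq[where c = "\<lambda>z. z"])
      show "(LINT z|circle. h z * cnj (h z) * B z powi n) = (LINT z|circle. L2_inner circle h h * z powi n)" for n
        using model_space_moments[OF B h h, of n] by (simp add: circle_integral_powi)
    qed (use L2_mult_cnj_integrable[OF hL hL] BD AE_circle_norm in auto)
    moreover have "(h z * cnj (h z)) * indicator A (B z) = complex_of_real ((cmod (h z))\<^sup>2 * indicator A (B z))" for z
      by (simp add: indicator_def flip: complex_norm_square)
    moreover have "(LINT z|circle. L2_inner circle h h * indicator A z)
        = complex_of_real ((L2_norm circle h)\<^sup>2 * measure circle A)"
    proof -
      have "(\<lambda>z. indicator A z) = (\<lambda>z. complex_of_real (indicator A z))"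
        by (auto simp: indicator_def)
      then have "(LINT z|circle. indicator A z) = complex_of_real (LINT z|circle. indicator A z)"
        by (simp only: integral_complex_of_real)
      then show ?thesis by (simp add: L2_inner_self)
    qed
    ultimately have "complex_of_real (LINT z|circle. (cmod (h z))\<^sup>2 * indicator A (B z))
        = complex_of_real ((L2_norm circle h)\<^sup>2 * measure circle A)"
      by (simp only: integral_complex_of_real)
    then have eq: "(LINT z|circle. (cmod (h z))\<^sup>2 * indicator A (B z)) = (L2_norm circle h)\<^sup>2 * measure circle A"
      by (simp only: of_real_eq_iff)
    have [measurable]: "B -` A \<in> sets borel"
      using measurable_sets[OF BD(4), of A] by simp
    have "emeasure ?L A = (\<integral>\<^sup>+ z. ennreal ((cmod (h z))\<^sup>2) * indicator (B -` A) z \<partial>circle)"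
      by (subst emeasure_distr) (auto simp: emeasure_density space_circle)
    also have "\<dots> = (\<integral>\<^sup>+ z. ennreal ((cmod (h z))\<^sup>2 * indicator A (B z)) \<partial>circle)"
      by (intro nn_integral_cong) (auto simp: indicator_def)
    also have "\<dots> = ennreal ((L2_norm circle h)\<^sup>2 * measure circle A)"
      using int by (subst nn_integral_eq_integral) (auto simp: eq)
    also have "\<dots> = emeasure ?R A"
      by (simp add: emeasure_density nn_integral_cmult circle.emeasure_eq_measure ennreal_mult)
    finally show "emeasure ?L A = emeasure ?R A" .
  qed
  then have "(\<integral>\<^sup>+ z. f z \<partial>?L) = (\<integral>\<^sup>+ z. f z \<partial>?R)"
    by simp
  then show ?thesis
    by (simp add: nn_integral_distr nn_integral_density nn_integral_cmult)
qed

text \<open>The preimage of a null set carries no mass of \<open>|h|\<^sup>2 dm\<close> by the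
  pushforward identity, and for \<open>h = model_power B 0\<close> this density is bounded below.
  Hence composition with \<open>B\<close> is well defined on a.e. classes.\<close>

lemma AE_circle_compose:
  assumes B: "inner_function B" and nc: "nonconstant B" and P: "AE z in circle. P z"
  shows "AE z in circle. P (B z)"
proof -
  note BD = inner_functionD[OF B]
  note [measurable] = BD(4)
  let ?h = "model_power B 0"
  have h: "?h \<in> model_space B" by (rule model_power_in_model_space[OF B])
  have [measurable]: "?h \<in> borel_measurable borel"
    using L2_D(1)[OF model_space_L2[OF h]] by auto
  obtain N where N: "{z \<in> space circle. \<not> P z} \<subseteq> N" "N \<in> sets circle" "emeasure circle N = 0"
    using P by (rule AE_E)
  then have [measurable]: "N \<in> sets borel" by simp
  have "(\<integral>\<^sup>+ z. ennreal ((cmod (?h z))\<^sup>2) * indicator N (B z) \<partial>circle) = 0"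
    by (subst nn_integral_model_space_compose[OF B h]) (use N in auto)
  then have "AE z in circle. ennreal ((cmod (?h z))\<^sup>2) * indicator N (B z) = 0"
    by (subst (asm) nn_integral_0_iff_AE) auto
  with model_power_0_bound[OF B] show ?thesis
  proof eventually_elim
    case (elim z)
    have "cmod (?h z) > 0"
      using elim(1) inner_nonconstant_coeff_0[OF B nc] by linarith
    then have "B z \<notin> N"
      using elim(2) by (auto simp: indicator_def split: if_splits)
    then show ?case using N(1) by (auto simp: circle_def)
  qed
qed

lemma model_space_mult_compose:
  assumes B: "inner_function B" and h: "h \<in> model_space B" and f: "f \<in> L2 circle"
  shows "(\<lambda>z. h z * f (B z)) \<in> L2 circle"
    and "L2_norm circle (\<lambda>z. h z * f (B z)) = L2_norm circle h * L2_norm circle f"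
proof -
  note [measurable] = inner_functionD(4)[OF B]
  have [measurable]: "h \<in> borel_measurable borel" "f \<in> borel_measurable borel"
    using L2_D(1)[OF model_space_L2[OF h]] L2_D(1)[OF f] by auto
  have "(\<integral>\<^sup>+ z. ennreal ((cmod (h z * f (B z)))\<^sup>2) \<partial>circle)
      = (\<integral>\<^sup>+ z. ennreal ((cmod (h z))\<^sup>2) * ennreal ((cmod (f (B z)))\<^sup>2) \<partial>circle)"
    by (simp add: norm_mult power_mult_distrib ennreal_mult)
  also have "\<dots> = ennreal ((L2_norm circle h)\<^sup>2) * (\<integral>\<^sup>+ z. ennreal ((cmod (f z))\<^sup>2) \<partial>circle)"
    by (rule nn_integral_model_space_compose[OF B h, of "\<lambda>w. ennreal ((cmod (f w))\<^sup>2)"]) measurable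
  also have "(\<integral>\<^sup>+ z. ennreal ((cmod (f z))\<^sup>2) \<partial>circle) = ennreal ((L2_norm circle f)\<^sup>2)"
    using L2_D(2)[OF f] by (simp add: nn_integral_eq_integral L2_norm_sq)
  finally have eq: "(\<integral>\<^sup>+ z. ennreal ((cmod (h z * f (B z)))\<^sup>2) \<partial>circle)
      = ennreal ((L2_norm circle h * L2_norm circle f)\<^sup>2)"
    by (simp add: power_mult_distrib ennreal_mult)
  have int: "integrable circle (\<lambda>z. (cmod (h z * f (B z)))\<^sup>2)"
    by (rule integrableI_bounded) (use eq in auto)
  then show "(\<lambda>z. h z * f (B z)) \<in> L2 circle"
    by (simp add: L2_def)
  have "(LINT z|circle. (cmod (h z * f (B z)))\<^sup>2) = (L2_norm circle h * L2_norm circle f)\<^sup>2"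
    using eq nn_integral_eq_integral[OF int] by simp
  then show "L2_norm circle (\<lambda>z. h z * f (B z)) = L2_norm circle h * L2_norm circle f"
    by (simp add: L2_norm_def[of circle "\<lambda>z. h z * f (B z)"])
qed

text \<open>The product of \<open>f \<circ> B\<close> with \<open>model_power B 0\<close> has the
  product of the two norms; dividing by the lower bound \<open>1 - |B(0)|\<close> of this factor
  gives the constant.\<close>

lemma compose_L2:
  assumes B: "inner_function B" and nc: "nonconstant B" and f: "f \<in> L2 circle"
  shows "(\<lambda>z. f (B z)) \<in> L2 circle"
    and "L2_norm circle (\<lambda>z. f (B z))
      \<le> L2_norm circle (model_power B 0) / (1 - cmod (fourier_coeff B 0)) * L2_norm circle f"
proof -
  note [measurable] = inner_functionD(4)[OF B]
  let ?h = "model_power B 0" and ?d = "1 - cmod (fourier_coeff B 0)"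
  have d: "?d > 0" using inner_nonconstant_coeff_0[OF B nc] by simp
  have h: "?h \<in> model_space B" by (rule model_power_in_model_space[OF B])
  have [measurable]: "f \<in> borel_measurable borel" using L2_D(1)[OF f] by auto
  note hf = model_space_mult_compose[OF B h f]
  have bd: "AE z in circle. (cmod (f (B z)))\<^sup>2 \<le> (1 / ?d\<^sup>2) * (cmod (?h z * f (B z)))\<^sup>2"
    using model_power_0_bound[OF B]
  proof eventually_elim
    case (elim z)
    have "?d\<^sup>2 * (cmod (f (B z)))\<^sup>2 \<le> (cmod (?h z))\<^sup>2 * (cmod (f (B z)))\<^sup>2"
      using elim d by (intro mult_right_mono power_mono) auto
    then show ?case using d by (simp add: norm_mult power_mult_distrib field_simps)
  qed
  have int: "integrable circle (\<lambda>z. (1 / ?d\<^sup>2) * (cmod (?h z * f (B z)))\<^sup>2)"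
    by (rule integrable_mult_right[OF L2_D(2)[OF hf(1)]])
  show L: "(\<lambda>z. f (B z)) \<in> L2 circle"
    by (rule L2_bound[OF _ int bd]) measurable
  have "(L2_norm circle (\<lambda>z. f (B z)))\<^sup>2 \<le> (LINT z|circle. (1 / ?d\<^sup>2) * (cmod (?h z * f (B z)))\<^sup>2)"
    unfolding L2_norm_sq by (rule integral_mono_AE[OF L2_D(2)[OF L] int bd])
  also have "\<dots> = (L2_norm circle ?h / ?d * L2_norm circle f)\<^sup>2"
    by (simp add: hf(2) power_mult_distrib power_divide flip: L2_norm_sq)
  finally show "L2_norm circle (\<lambda>z. f (B z)) \<le> L2_norm circle ?h / ?d * L2_norm circle f"
    by (rule power2_le_imp_le) (use d in simp)
qed

text \<open>When \<open>f\<close> and \<open>f'\<close> are powers this is the vanishing of the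
  moments. Both sides are bounded and sesquilinear in \<open>f\<close> and \<open>f'\<close>, so the
  identity extends in one variable at a time.\<close>

lemma inner_model_space_mult_compose:
  assumes B: "inner_function B" and h: "h \<in> model_space B" and h': "h' \<in> model_space B"
    and f: "f \<in> L2 circle" and f': "f' \<in> L2 circle"
  shows "L2_inner circle (\<lambda>z. h z * f (B z)) (\<lambda>z. h' z * f' (B z)) = L2_inner circle h h' * L2_inner circle f f'"
proof -
  note BD = inner_functionD[OF B]
  note [measurable] = BD(4)
  define \<Lambda> where "\<Lambda> h h' f f' = L2_inner circle (\<lambda>z. h z * f (B z)) (\<lambda>z. h' z * f' (B z))
    - L2_inner circle h h' * L2_inner circle f f'" for h h' f f' :: "complex \<Rightarrow> complex"
  have ext: "\<Lambda> h h' f f' = 0"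
    if h: "h \<in> model_space B" and h': "h' \<in> model_space B" and f: "f \<in> L2 circle" and f': "f' \<in> L2 circle"
      and zero: "\<And>n. \<Lambda> h h' (\<lambda>z. z powi n) f' = 0" for h h' f f'
  proof (rule functional_eq_0[OF L2_subspace_UNIV, where G = "range (\<lambda>(n::int) z. z powi n)" and \<Lambda> = "\<lambda>f. \<Lambda> h h' f f'"
        and C = "2 * (L2_norm circle h * L2_norm circle h' * L2_norm circle f')"])
    note hL = model_space_L2[OF h] and h'L = model_space_L2[OF h']
    note c = model_space_mult_compose[OF B]
    show "\<Lambda> h h' (\<lambda>x. f x + c * g x) f' = \<Lambda> h h' f f' + c * \<Lambda> h h' g f'"
      if "f \<in> L2 circle" "g \<in> L2 circle" for f g c
      using L2_inner_lincomb_left[OF c(1)[OF h that(1)] c(1)[OF h that(2)] c(1)[OF h' f'], of 1 c]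
        L2_inner_lincomb_left[OF that f', of 1 c]
      by (simp add: \<Lambda>_def algebra_simps)
    show "cmod (\<Lambda> h h' f f') \<le> 2 * (L2_norm circle h * L2_norm circle h' * L2_norm circle f') * L2_norm circle f"
      if f: "f \<in> L2 circle" for f
    proof -
      have "cmod (\<Lambda> h h' f f') \<le> cmod (L2_inner circle (\<lambda>z. h z * f (B z)) (\<lambda>z. h' z * f' (B z)))
          + cmod (L2_inner circle h h') * cmod (L2_inner circle f f')"
        unfolding \<Lambda>_def by (rule order_trans[OF norm_triangle_ineq4]) (simp add: norm_mult)
      also have "\<dots> \<le> (L2_norm circle h * L2_norm circle f) * (L2_norm circle h' * L2_norm circle f')
          + (L2_norm circle h * L2_norm circle h') * (L2_norm circle f * L2_norm circle f')"
        using L2_Cauchy_Schwarz[OF c(1)[OF h f] c(1)[OF h' f']]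
        by (intro add_mono mult_mono L2_Cauchy_Schwarz hL h'L f f') (auto simp: c(2)[OF h f] c(2)[OF h' f'])
      finally show ?thesis by (simp add: algebra_simps)
    qed
  qed (use L2_closure_trig zero f in \<open>auto simp: powi_L2\<close>)
  have powi: "\<Lambda> h h' (\<lambda>z. z powi m) (\<lambda>z. z powi n) = 0"
    if h: "h \<in> model_space B" and h': "h' \<in> model_space B" for h h' m n
  proof -
    have [measurable]: "h \<in> borel_measurable borel" "h' \<in> borel_measurable borel"
      using L2_D(1)[OF model_space_L2[OF h]] L2_D(1)[OF model_space_L2[OF h']] by auto
    have "L2_inner circle (\<lambda>z. h z * B z powi m) (\<lambda>z. h' z * B z powi n)
        = (LINT z|circle. h z * cnj (h' z) * B z powi (m - n))"
      unfolding L2_inner_def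
    proof (rule integral_cong_AE)
      show "AE z in circle. h z * B z powi m * cnj (h' z * B z powi n) = h z * cnj (h' z) * B z powi (m - n)"
        using BD(5)
      proof eventually_elim
        case (elim z)
        have "B z powi (m - n) = B z powi m * cnj (B z powi n)"
          using power_int_add[of "B z" m "- n"] powi_unimodular[OF elim] by (simp only: diff_conv_add_uminus) simp
        then show ?case by (simp only: complex_cnj_mult mult_ac)
      qed
    qed measurable
    then show ?thesis
      by (simp add: \<Lambda>_def model_space_moments[OF B h h'] L2_inner_powi)
  qed
  \<comment> \<open>Conjugate symmetry turns the extension in the first function into an extension
    in the second, so \<open>ext\<close> serves for both.\<close>
  have flip: "\<Lambda> h' h f' f = cnj (\<Lambda> h h' f f')" for h h' f f'
    unfolding \<Lambda>_def by (simp flip: L2_inner_commute)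
  have 1: "\<Lambda> h h' f (\<lambda>z. z powi n) = 0"
    if "h \<in> model_space B" "h' \<in> model_space B" "f \<in> L2 circle" for h h' f n
    by (rule ext[OF that powi_L2 powi[OF that(1,2)]])
  have "\<Lambda> h h' f f' = 0"
  proof (rule ext[OF h h' f f'])
    show "\<Lambda> h h' (\<lambda>z. z powi n) f' = 0" for n
      using 1[OF h' h f', of n] flip[of h h' "\<lambda>z. z powi n" f'] by simp
  qed
  then show ?thesis by (simp add: \<Lambda>_def)
qed

text \<open>The functions \<open>B\<^sup>n h\<close> with \<open>h\<close> in the model space of \<open>B\<close> span the Hardy space. In the induction
  over \<open>m\<close>, orthogonality gives \<open>a n m = B(0) a (n + 1) m\<close> for the inner products \<open>a n m\<close> of \<open>g\<close> with
  \<open>z\<^sup>m B\<^sup>n\<close>, and \<open>|B(0)| < 1\<close>.\<close>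

lemma orthogonal_wandering_imp_orthogonal_power:
  assumes B: "inner_function B" and nc: "nonconstant B" and g: "g \<in> L2 circle"
    and orth: "\<And>n m. L2_inner circle g (\<lambda>z. model_power B m z * B z ^ n) = 0"
  shows "L2_inner circle g (\<lambda>z. z ^ m) = 0"
proof -
  note BD = inner_functionD[OF B]
  define a where "a n m = L2_inner circle g (\<lambda>z. z ^ m * B z ^ n)" for n m
  have zB: "(\<lambda>z. z ^ m * B z ^ n) \<in> hardy2" for n m
    by (rule hardy2_mult[OF power_hardy2 hardy_inf_power[OF BD(1)]])
  \<comment> \<open>As \<open>model_power B m\<close> is \<open>z\<^sup>m\<close> minus
    \<open>B\<close> times a polynomial of degree at most \<open>m\<close>, orthogonality trades
    \<open>z\<^sup>m B\<^sup>n\<close> for terms \<open>z\<^sup>k B\<^sup>n\<^sup>+\<^sup>1\<close>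
    with \<open>k \<le> m\<close>.\<close>
  have rec: "a n m = (\<Sum>k\<le>m. fourier_coeff B (int m - int k) * a (Suc n) k)" for n m
  proof -
    have qB: "(\<lambda>z. inner_power_quot B m z * B z ^ Suc n) \<in> L2 circle"
      by (intro hardy2_L2 hardy2_mult hardy_inf_power BD hardy_inf_hardy2 inner_power_quot_hardy_inf)
    have "L2_inner circle g (\<lambda>z. z ^ m * B z ^ n - inner_power_quot B m z * B z ^ Suc n) = 0"
      using orth[of m n] by (simp add: model_power_def algebra_simps)
    then have "a n m = L2_inner circle g (\<lambda>z. inner_power_quot B m z * B z ^ Suc n)"
      using L2_inner_diff_right[OF hardy2_L2[OF zB[of m n]] qB g] by (simp add: a_def)
    also have "\<dots> = (LINT z|circle. (\<Sum>k\<le>m. fourier_coeff B (int m - int k) * (g z * cnj (z ^ k * B z ^ Suc n))))"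
      by (simp add: L2_inner_def inner_power_quot_def sum_distrib_left sum_distrib_right mult_ac)
    also have "\<dots> = (\<Sum>k\<le>m. fourier_coeff B (int m - int k) * a (Suc n) k)"
      unfolding a_def L2_inner_def
      by (subst Bochner_Integration.integral_sum)
         (rule integrable_mult_right[OF L2_mult_cnj_integrable[OF g hardy2_L2[OF zB]]],
          simp only: integral_mult_right_zero)
    finally show ?thesis .
  qed
  have bd: "cmod (a n m) \<le> L2_norm circle g" for n m
  proof -
    have "L2_norm circle (\<lambda>z. z ^ m * B z ^ n) = 1"
    proof -
      have "(LINT z|circle. (cmod (z ^ m * B z ^ n))\<^sup>2) = (LINT z|circle. 1)"
      proof (rule integral_cong_AE)
        show "AE z in circle. (cmod (z ^ m * B z ^ n))\<^sup>2 = 1"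
          using BD(5) AE_circle_norm by eventually_elim (simp add: norm_mult norm_power)
      qed (use BD(4) in measurable)
      then show ?thesis by (simp add: L2_norm_def circle.prob_space)
    qed
    then show ?thesis
      using L2_Cauchy_Schwarz[OF g hardy2_L2[OF zB], of m n] by (simp add: a_def)
  qed
  have "\<forall>n. a n m = 0" for m
  proof (induction m rule: less_induct)
    case (less m)
    let ?b = "fourier_coeff B 0"
    have step: "a n m = ?b * a (Suc n) m" for n
    proof -
      \<comment> \<open>The induction hypothesis removes the terms with \<open>k < m\<close>, and
        the remaining coefficient is the mean of \<open>B\<close>.\<close>
      have "a n m = (\<Sum>k\<in>{m}. fourier_coeff B (int m - int k) * a (Suc n) k)"
        unfolding rec[of n m] by (rule sum.mono_neutral_right) (use less in auto)
      then show ?thesis by simp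
    qed
    \<comment> \<open>After \<open>N\<close> rounds the factor is \<open>?b ^ N\<close>, while
      \<open>bd\<close> bounds the inner products uniformly in the power of \<open>B\<close>;
      letting \<open>N\<close> grow leaves 0.\<close>
    have iter: "a n m = ?b ^ N * a (n + N) m" for n N
    proof (induction N)
      case (Suc N)
      have "a (n + N) m = ?b * a (n + Suc N) m"
        using step[of "n + N"] by (simp only: add_Suc_right)
      with Suc show ?case by (simp only: power_Suc mult_ac)
    qed simp
    have "a n m = 0" for n
    proof -
      have "(\<lambda>N. cmod ?b ^ N * L2_norm circle g) \<longlonglongrightarrow> 0 * L2_norm circle g"
        by (intro tendsto_intros LIMSEQ_realpow_zero inner_nonconstant_coeff_0[OF B nc]) simp
      moreover have "cmod (a n m) \<le> cmod ?b ^ N * L2_norm circle g" for N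
      proof -
        have "cmod (a n m) = cmod ?b ^ N * cmod (a (n + N) m)"
          by (subst iter[of n N]) (simp add: norm_mult norm_power)
        also have "\<dots> \<le> cmod ?b ^ N * L2_norm circle g"
          by (intro mult_left_mono bd) simp
        finally show ?thesis .
      qed
      ultimately have "cmod (a n m) \<le> 0 * L2_norm circle g"
        by (intro LIMSEQ_le_const) auto
      then show ?thesis by simp
    qed
    then show ?case by blast
  qed
  then have "a 0 m = 0" by blast
  then show ?thesis by (simp add: a_def)
qed

text \<open>For polynomials \<open>p\<close> the product of \<open>w\<close> and
  \<open>p \<circ> B\<close> is analytic because \<open>B\<close> is bounded and analytic; the bound
  carries this to limits. The abstract factor \<open>w\<close> covers both an element of the model
  space and the constant 1.\<close>

lemma mult_compose_hardy2:
  assumes B: "inner_function B" and w: "w \<in> hardy2"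
    and bd: "\<And>f. f \<in> L2 circle \<Longrightarrow> (\<lambda>z. w z * f (B z)) \<in> L2 circle \<and>
        L2_norm circle (\<lambda>z. w z * f (B z)) \<le> C * L2_norm circle f"
    and f: "f \<in> hardy2"
  shows "(\<lambda>z. w z * f (B z)) \<in> hardy2"
proof -
  note BD = inner_functionD[OF B]
  have p: "(\<lambda>z. w z * p (B z)) \<in> hardy2" if "p \<in> lspan (range (\<lambda>n::nat. \<lambda>z. z ^ n))" for p
    using that
  proof induction
    case lspan_zero
    show ?case using L2_subspace_zero[OF hardy2_subspace] by simp
  next
    case (lspan_step p e c)
    then obtain n where "e = (\<lambda>z. z ^ n)" by auto
    with L2_subspace_lincomb[OF hardy2_subspace lspan_step(3) hardy2_mult[OF w hardy_inf_power[OF BD(1), of n]], of 1 c]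
    show ?case by (simp add: algebra_simps)
  qed
  have fL: "f \<in> L2 circle" by (rule hardy2_L2[OF f])
  have "(\<lambda>z. w z * f (B z)) \<in> L2_closure circle hardy2"
    unfolding L2_closure_def
  proof (intro CollectI conjI allI impI)
    show "(\<lambda>z. w z * f (B z)) \<in> L2 circle" using bd[OF fL] by blast
    fix e :: real assume "e > 0"
    then have "e / (\<bar>C\<bar> + 1) > 0" by (simp add: add_nonneg_pos)
    moreover have "f \<in> L2_closure circle (lspan (range (\<lambda>n::nat. \<lambda>z. z ^ n)))"
      using f L2_closure_power by simp
    ultimately obtain p where pp: "p \<in> lspan (range (\<lambda>n::nat. \<lambda>z. z ^ n))"
      "L2_norm circle (\<lambda>z. f z - p z) < e / (\<bar>C\<bar> + 1)"
      using L2_closureE by blast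
    have "range (\<lambda>n::nat. \<lambda>z. z ^ n) \<subseteq> hardy2"
      using power_hardy2 by auto
    from subsetD[OF lspan_subset[OF hardy2_subspace this] pp(1)]
    have pL: "p \<in> L2 circle" by (rule hardy2_L2)
    have "L2_norm circle (\<lambda>z. w z * f (B z) - w z * p (B z)) \<le> C * L2_norm circle (\<lambda>z. f z - p z)"
      using bd[OF L2_diff[OF fL pL]] by (simp add: right_diff_distrib)
    also have "\<dots> \<le> (\<bar>C\<bar> + 1) * L2_norm circle (\<lambda>z. f z - p z)"
      by (intro mult_right_mono) auto
    also have "\<dots> < (\<bar>C\<bar> + 1) * (e / (\<bar>C\<bar> + 1))"
      by (intro mult_strict_left_mono pp(2)) (simp add: add_nonneg_pos)
    also have "\<dots> = e"
      by simp
    finally show "\<exists>v\<in>hardy2. L2_norm circle (\<lambda>z. w z * f (B z) - v z) < e"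
      by (rule bexI[OF _ p[OF pp(1)]])
  qed
  then show ?thesis
    by (rule closed_L2_subspace_closureD[OF closed_L2_subspace_hardy2])
qed

lemma model_space_mult_compose_hardy2:
  assumes B: "inner_function B" and h: "h \<in> model_space B" and f: "f \<in> hardy2"
  shows "(\<lambda>z. h z * f (B z)) \<in> hardy2"
proof (rule mult_compose_hardy2[OF B model_space_hardy2[OF h] _ f])
  show "(\<lambda>z. h z * f (B z)) \<in> L2 circle \<and>
      L2_norm circle (\<lambda>z. h z * f (B z)) \<le> L2_norm circle h * L2_norm circle f"
    if "f \<in> L2 circle" for f
    using model_space_mult_compose[OF B h that] by simp
qed

lemma compose_hardy_inf:
  assumes B: "inner_function B" and nc: "nonconstant B" and f: "f \<in> hardy_inf"
  shows "(\<lambda>z. f (B z)) \<in> hardy_inf"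
proof -
  have "(\<lambda>z. 1 * f (B z)) \<in> hardy2"
  proof (rule mult_compose_hardy2[OF B _ _ hardy_inf_hardy2[OF f]])
    show "(\<lambda>z. 1) \<in> hardy2" by (rule hardy_inf_hardy2[OF const_hardy_inf])
    show "(\<lambda>z. 1 * f (B z)) \<in> L2 circle \<and> L2_norm circle (\<lambda>z. 1 * f (B z))
        \<le> L2_norm circle (model_power B 0) / (1 - cmod (fourier_coeff B 0)) * L2_norm circle f"
      if "f \<in> L2 circle" for f
      using compose_L2[OF B nc that] by (simp only: mult_1)
  qed
  moreover obtain C where "AE z in circle. cmod (f z) \<le> C" using f by (rule hardy_infE)
  then have "AE z in circle. cmod (f (B z)) \<le> C" by (rule AE_circle_compose[OF B nc])
  ultimately show ?thesis by (auto simp: hardy_inf_def)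
qed

section \<open>Products spanning the model space of a composition\<close>

lemma inner_function_compose:
  assumes B: "inner_function B" and nc: "nonconstant B" and \<Theta>: "inner_function \<Theta>"
  shows "inner_function (\<Theta> \<circ> B)"
  using hardy_inf_hardy2[OF compose_hardy_inf[OF B nc inner_functionD(1)[OF \<Theta>]]]
    AE_circle_compose[OF B nc inner_functionD(5)[OF \<Theta>]]
  by (simp add: inner_function_def comp_def)

text \<open>Orthogonality to \<open>(\<Theta> \<circ> B) z\<^sup>n\<close> is hard to see for powers
  of \<open>z\<close> but evident for the functions \<open>model_power B m\<close> times
  \<open>B\<^sup>n\<close>: there the inner product factors, and one factor pairs \<open>f\<close>
  with a multiple of \<open>\<Theta>\<close>.\<close>

lemma mult_compose_in_model_space:
  assumes B: "inner_function B" and nc: "nonconstant B" and \<Theta>: "inner_function \<Theta>"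
    and h: "h \<in> model_space B" and f: "f \<in> model_space \<Theta>"
  shows "(\<lambda>z. h z * f (B z)) \<in> model_space (\<Theta> \<circ> B)"
proof (rule model_spaceI)
  note \<Theta>D = inner_functionD[OF \<Theta>]
  show \<Theta>B: "inner_function (\<Theta> \<circ> B)" by (rule inner_function_compose[OF B nc \<Theta>])
  show "(\<lambda>z. h z * f (B z)) \<in> hardy2"
    by (rule model_space_mult_compose_hardy2[OF B h model_space_hardy2[OF f]])
  have hf: "(\<lambda>z. h z * f (B z)) \<in> L2 circle"
    by (rule model_space_mult_compose(1)[OF B h model_space_L2[OF f]])
  \<comment> \<open>Moving \<open>\<Theta> \<circ> B\<close> to the left side leaves a fixed
    \<open>L2\<close> function to be tested against the Hardy space, which is what the
    wandering-subspace lemma does.\<close>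
  define G where "G z = h z * f (B z) * cnj (\<Theta> (B z))" for z
  have G: "G \<in> L2 circle"
    using L2_cnj[OF L2_mult_hardy_inf[OF L2_cnj[OF hf] inner_functionD(1)[OF \<Theta>B]]]
    by (simp add: G_def[abs_def])
  have zero: "L2_inner circle G (\<lambda>z. z ^ m) = 0" for m
  proof (rule orthogonal_wandering_imp_orthogonal_power[OF B nc G])
    fix n m
    have \<Theta>n: "(\<lambda>z. \<Theta> z * z ^ n) \<in> hardy2"
      by (rule hardy2_mult[OF \<Theta>D(2) power_hardy_inf])
    have "L2_inner circle G (\<lambda>z. model_power B m z * B z ^ n)
        = L2_inner circle (\<lambda>z. h z * f (B z)) (\<lambda>z. model_power B m z * (\<lambda>z. \<Theta> z * z ^ n) (B z))"
      by (simp add: L2_inner_def G_def mult_ac)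
    also have "\<dots> = L2_inner circle h (model_power B m) * L2_inner circle f (\<lambda>z. \<Theta> z * z ^ n)"
      by (rule inner_model_space_mult_compose[OF B h model_power_in_model_space[OF B] model_space_L2[OF f] hardy2_L2[OF \<Theta>n]])
    also have "\<dots> = 0"
      by (simp add: model_space_inner_mult_zero[OF f power_hardy2])
    finally show "L2_inner circle G (\<lambda>z. model_power B m z * B z ^ n) = 0" .
  qed
  show "L2_inner circle (\<lambda>z. h z * f (B z)) (\<lambda>z. (\<Theta> \<circ> B) z * z ^ n) = 0" for n
    using zero[of n] by (simp add: L2_inner_def G_def mult_ac)
qed

text \<open>Since \<open>z\<^sup>n\<close> is \<open>model_power \<Theta> n\<close> plus
  \<open>\<Theta>\<close> times a polynomial, \<open>model_power B m\<close> times
  \<open>B\<^sup>n\<close> is one of the products plus a multiple of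
  \<open>\<Theta> \<circ> B\<close> in the Hardy space. An element of the model space orthogonal to
  the products is therefore orthogonal to all of these functions, hence to every power of
  \<open>z\<close>.\<close>

lemma L2_closure_mult_compose:
  assumes B: "inner_function B" and nc: "nonconstant B" and \<Theta>: "inner_function \<Theta>"
  shows "L2_closure circle (lspan {\<lambda>z. model_power B m z * model_power \<Theta> n (B z) | m n. True}) = model_space (\<Theta> \<circ> B)"
proof (rule circle.lspan_dense[OF closed_L2_subspace_model_space[OF inner_function_compose[OF B nc \<Theta>]]])
  show "{\<lambda>z. model_power B m z * model_power \<Theta> n (B z) | m n. True} \<subseteq> model_space (\<Theta> \<circ> B)"
    using mult_compose_in_model_space[OF B nc \<Theta> model_power_in_model_space[OF B] model_power_in_model_space[OF \<Theta>]]
    by auto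
  fix g assume g: "g \<in> model_space (\<Theta> \<circ> B)"
    and orth: "\<And>k. k \<in> {\<lambda>z. model_power B m z * model_power \<Theta> n (B z) | m n. True} \<Longrightarrow> L2_inner circle g k = 0"
  note gL = model_space_L2[OF g]
  have "L2_inner circle g (\<lambda>z. model_power B m z * B z ^ n) = 0" for n m
  proof -
    have q: "(\<lambda>z. model_power B m z * inner_power_quot \<Theta> n (B z)) \<in> hardy2"
      by (rule model_space_mult_compose_hardy2[OF B model_power_in_model_space[OF B]
            hardy_inf_hardy2[OF inner_power_quot_hardy_inf]])
    have L1: "(\<lambda>z. model_power B m z * model_power \<Theta> n (B z)) \<in> L2 circle"
      by (rule model_space_mult_compose(1)[OF B model_power_in_model_space[OF B]
            model_space_L2[OF model_power_in_model_space[OF \<Theta>]]])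
    have L2: "(\<lambda>z. (\<Theta> \<circ> B) z * (model_power B m z * inner_power_quot \<Theta> n (B z))) \<in> L2 circle"
      using L2_mult_hardy_inf[OF hardy2_L2[OF q] inner_functionD(1)[OF inner_function_compose[OF B nc \<Theta>]]]
      by (simp add: mult.commute)
    have "(\<lambda>z. model_power B m z * B z ^ n) = (\<lambda>z. 1 * (model_power B m z * model_power \<Theta> n (B z))
        + 1 * ((\<Theta> \<circ> B) z * (model_power B m z * inner_power_quot \<Theta> n (B z))))"
      by (auto simp: model_power_def[of \<Theta>] algebra_simps)
    then have "L2_inner circle g (\<lambda>z. model_power B m z * B z ^ n)
        = cnj 1 * L2_inner circle g (\<lambda>z. model_power B m z * model_power \<Theta> n (B z))
        + cnj 1 * L2_inner circle g (\<lambda>z. (\<Theta> \<circ> B) z * (model_power B m z * inner_power_quot \<Theta> n (B z)))"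
      by (simp only: L2_inner_lincomb_right[OF L1 L2 gL])
    also have "\<dots> = 0"
      using orth[of "\<lambda>z. model_power B m z * model_power \<Theta> n (B z)"] model_space_inner_mult_zero(1)[OF g q] by auto
    finally show ?thesis .
  qed
  from orthogonal_wandering_imp_orthogonal_power[OF B nc gL this]
  show "AE z in circle. g z = 0"
    by (rule hardy2_AE_zero[OF model_space_hardy2[OF g]])
qed

section \<open>Tensor products of operators\<close>

text \<open>The span of pairs (generator, intended image) in the product space: the linear relation
  that prescribes an operator before it is known to be single-valued.\<close>

inductive_set pair_span ::
    "(('a \<Rightarrow> complex) \<times> ('b \<Rightarrow> complex)) set \<Rightarrow> (('a \<Rightarrow> complex) \<times> ('b \<Rightarrow> complex)) set"
  for G where
  pair_span_zero: "(\<lambda>x. 0, \<lambda>x. 0) \<in> pair_span G"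
| pair_span_step: "(x, y) \<in> pair_span G \<Longrightarrow> (g, k) \<in> G \<Longrightarrow>
    (\<lambda>t. x t + c * g t, \<lambda>t. y t + c * k t) \<in> pair_span G"

lemma pair_span_base:
  assumes "(g, k) \<in> G"
  shows "(g, k) \<in> pair_span G"
  using pair_span_step[OF pair_span_zero assms, of 1] by simp

lemma pair_span_add:
  assumes "(x', y') \<in> pair_span G" "(x, y) \<in> pair_span G"
  shows "(\<lambda>t. x t + x' t, \<lambda>t. y t + y' t) \<in> pair_span G"
  using assms(1)
proof (induction x' y' rule: pair_span.induct)
  case (pair_span_step x' y' g k c)
  then show ?case
    using pair_span.pair_span_step[OF pair_span_step(3,2), of c] by (simp add: add.assoc)
qed (use assms(2) in simp)

lemma pair_span_scale:
  assumes "(x, y) \<in> pair_span G"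
  shows "(\<lambda>t. a * x t, \<lambda>t. a * y t) \<in> pair_span G"
  using assms
proof (induction x y rule: pair_span.induct)
  case (pair_span_step x y g k c)
  then show ?case
    using pair_span.pair_span_step[OF pair_span_step(3,2), of "a * c"] by (simp add: algebra_simps)
qed (simp add: pair_span.pair_span_zero)

lemma pair_span_lspan:
  assumes "(x, y) \<in> pair_span G"
  shows "x \<in> lspan (fst ` G)" "y \<in> lspan (snd ` G)"
  using assms
proof (induction x y rule: pair_span.induct)
  case (pair_span_step x y g k c)
  { case 1
    show ?case using pair_span_step by (intro lspan_step) (auto intro: rev_image_eqI) }
  { case 2
    show ?case using pair_span_step by (intro lspan_step) (auto intro: rev_image_eqI) }
qed (rule lspan_zero)+

lemma fst_pair_span: "fst ` pair_span G = lspan (fst ` G)"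
proof
  show "fst ` pair_span G \<subseteq> lspan (fst ` G)"
    using pair_span_lspan(1) by fastforce
  have "\<exists>y. (x, y) \<in> pair_span G" if "x \<in> lspan (fst ` G)" for x
    using that
  proof induction
    case lspan_zero
    show ?case using pair_span.pair_span_zero by blast
  next
    case (lspan_step x g c)
    then obtain y k where "(x, y) \<in> pair_span G" "(g, k) \<in> G" by auto
    from pair_span.pair_span_step[OF this, of c] show ?case by (intro exI)
  qed
  then show "lspan (fst ` G) \<subseteq> fst ` pair_span G"
    by force
qed

text \<open>Equal Gram matrices of the generators and of their images make the spanned relation
  preserve inner products, hence norms; for \<open>Omega\<close> this yields well-definedness and
  isometry at once.\<close>

lemma pair_span_inner_eq:
  assumes G: "\<And>g k. (g, k) \<in> G \<Longrightarrow> g \<in> L2 M \<and> k \<in> L2 N"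
    and eq: "\<And>g k g' k'. (g, k) \<in> G \<Longrightarrow> (g', k') \<in> G \<Longrightarrow> L2_inner M g g' = L2_inner N k k'"
    and xy: "(x, y) \<in> pair_span G" and xy': "(x', y') \<in> pair_span G"
  shows "L2_inner M x x' = L2_inner N y y'"
proof -
  have sub: "fst ` G \<subseteq> L2 M" "snd ` G \<subseteq> L2 N"
    using G by auto
  have L: "x \<in> L2 M" "y \<in> L2 N" if "(x, y) \<in> pair_span G" for x y
    using pair_span_lspan[OF that] lspan_subset[OF L2_subspace_UNIV sub(1)]
      lspan_subset[OF L2_subspace_UNIV sub(2)] by auto
  have 1: "L2_inner M x g' = L2_inner N y k'" if "(x, y) \<in> pair_span G" and g': "(g', k') \<in> G" for x y g' k'
    using that(1)
  proof (induction x y rule: pair_span.induct)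
    case (pair_span_step x y g k c)
    show ?case
      using L2_inner_lincomb_left[of x M g g' 1 c] L2_inner_lincomb_left[of y N k k' 1 c]
        L[OF pair_span_step(1)] G[OF pair_span_step(2)] G[OF g'] eq[OF pair_span_step(2) g'] pair_span_step(3)
      by simp
  qed simp
  show ?thesis
    using xy'
  proof (induction x' y' rule: pair_span.induct)
    case (pair_span_step x' y' g k c)
    show ?case
      using L2_inner_lincomb_right[of x' M g x 1 c] L2_inner_lincomb_right[of y' N k y 1 c]
        L[OF pair_span_step(1)] G[OF pair_span_step(2)] L[OF xy] 1[OF xy pair_span_step(2)] pair_span_step(3)
      by simp
  qed simp
qed

lemma pair_span_operator:
  assumes T: "bounded_operator M K N L T" and K: "L2_subspace M K" and L: "L2_subspace N L"
    and G: "\<And>g k. (g, k) \<in> G \<Longrightarrow> g \<in> K \<and> (AE t in N. T g t = k t)"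
    and xy: "(x, y) \<in> pair_span G"
  shows "x \<in> K \<and> (AE t in N. T x t = y t)"
  using xy
proof (induction x y rule: pair_span.induct)
  case pair_span_zero
  show ?case using bounded_operator_zero[OF T K] L2_subspace_zero[OF K] by simp
next
  case (pair_span_step x y g k c)
  then have x: "x \<in> K" "AE t in N. T x t = y t" by auto
  have g: "g \<in> K" "AE t in N. T g t = k t" using G[OF pair_span_step(2)] by auto
  have "AE t in N. T (\<lambda>t. 1 * x t + c * g t) t = 1 * T x t + c * T g t"
    by (rule bounded_operatorD(2)[OF T x(1) g(1)])
  with x(2) g(2) have "AE t in N. T (\<lambda>t. x t + c * g t) t = y t + c * k t"
    by eventually_elim simp
  moreover have "(\<lambda>t. x t + c * g t) \<in> K"
    using L2_subspace_lincomb[OF K x(1) g(1), of 1 c] by simp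
  ultimately show ?case by blast
qed

text \<open>The bound has to be known on the whole span: bounds on single generators would not
  prevent a vanishing combination from having a nonzero image.\<close>

lemma pair_span_extension:
  assumes N: "finite_measure N" and L: "closed_L2_subspace N L"
    and G: "\<And>g k. (g, k) \<in> G \<Longrightarrow> g \<in> L2 M \<and> k \<in> L"
    and bd: "\<And>x y. (x, y) \<in> pair_span G \<Longrightarrow> L2_norm N y \<le> C * L2_norm M x"
  obtains T where "bounded_operator M (L2_closure M (lspan (fst ` G))) N L T"
    "\<And>g k. (g, k) \<in> G \<Longrightarrow> AE t in N. T g t = k t"
proof -
  note result = that
  have sub: "fst ` G \<subseteq> L2 M" "snd ` G \<subseteq> L"
    using G by auto
  let ?K = "L2_closure M (lspan (fst ` G))"
  have K: "L2_subspace M ?K"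
    by (intro closed_L2_subspaceD closed_L2_subspace_closure L2_subspace_lspan sub)
  have spanK: "lspan (fst ` G) \<subseteq> ?K"
    by (rule L2_closure_superset[OF lspan_subset[OF L2_subspace_UNIV sub(1)]])
  have spanL: "lspan (snd ` G) \<subseteq> L"
    by (rule lspan_subset[OF closed_L2_subspaceD[OF L] sub(2)])
  show ?thesis
  proof (rule bounded_operator_extension[OF N K L, of "pair_span G" C])
    show "pair_span G \<subseteq> ?K \<times> L"
    proof
      fix p assume "p \<in> pair_span G"
      then show "p \<in> ?K \<times> L"
        using pair_span_lspan[of "fst p" "snd p" G] spanK spanL by (cases p) auto
    qed
    show "pair_span G \<noteq> {}" using pair_span_zero by blast
    show "(\<lambda>t. a * x t + b * x' t, \<lambda>t. a * y t + b * y' t) \<in> pair_span G"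
      if "(x, y) \<in> pair_span G" "(x', y') \<in> pair_span G" for x y x' y' a b
      by (rule pair_span_add[OF pair_span_scale[OF that(2)] pair_span_scale[OF that(1)]])
    show "L2_norm N y \<le> C * L2_norm M x" if "(x, y) \<in> pair_span G" for x y
      by (rule bd[OF that])
    show "?K \<subseteq> L2_closure M (fst ` pair_span G)"
      by (simp add: fst_pair_span)
    show thesis if "bounded_operator M ?K N L T" "\<And>x y. (x, y) \<in> pair_span G \<Longrightarrow> AE t in N. T x t = y t" for T
      by (rule result[OF that(1) that(2)[OF pair_span_base]])
  qed
qed

section \<open>Tensor products inside \<open>L2\<close> of the torus\<close>

lemma finite_measure_torus: "finite_measure torus"
proof -
  interpret pair_prob_space circle circle ..
  show ?thesis by (rule finite_measure_axioms)
qed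

lemma torus_nn_integral:
  assumes "f \<in> borel_measurable torus"
  shows "(\<integral>\<^sup>+ p. f p \<partial>torus) = (\<integral>\<^sup>+ z. \<integral>\<^sup>+ w. f (z, w) \<partial>circle \<partial>circle)"
    and "(\<integral>\<^sup>+ p. f p \<partial>torus) = (\<integral>\<^sup>+ w. \<integral>\<^sup>+ z. f (z, w) \<partial>circle \<partial>circle)"
  using circle.nn_integral_fst[OF assms] torus.nn_integral_snd[OF assms] by simp_all

abbreviation elementary_tensors ::
  "(complex \<Rightarrow> complex) set \<Rightarrow> (complex \<Rightarrow> complex) set \<Rightarrow> (complex \<times> complex \<Rightarrow> complex) set" where
  "elementary_tensors K L \<equiv> {tensor h f | h f. h \<in> K \<and> f \<in> L}"

text \<open>Sums of elementary tensors carry no coefficients, while \<open>lspan\<close> does; a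
  coefficient is absorbed into the left factor, which is why \<open>K\<close> has to be a
  subspace.\<close>

lemma tensor_space_eq:
  assumes K: "L2_subspace circle K"
  shows "tensor_space K L = L2_closure torus (lspan (elementary_tensors K L))"
proof -
  have 1: "(\<lambda>p. \<Sum>i<n. tensor (h i) (f i) p) \<in> lspan (elementary_tensors K L)"
    if "\<forall>i<n. h i \<in> K \<and> f i \<in> L" for n :: nat and h f
    using that
  proof (induction n)
    case (Suc n)
    then have "tensor (h n) (f n) \<in> elementary_tensors K L" by auto
    with Suc lspan_step[of "\<lambda>p. \<Sum>i<n. tensor (h i) (f i) p" "elementary_tensors K L" "tensor (h n) (f n)" 1]
    show ?case by simp
  qed (simp add: lspan_zero)
  have 2: "\<exists>(n::nat) h f. (\<forall>i<n. h i \<in> K \<and> f i \<in> L) \<and> F = (\<lambda>p. \<Sum>i<n. tensor (h i) (f i) p)"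
    if "F \<in> lspan (elementary_tensors K L)" for F
    using that
  proof induction
    case lspan_zero
    show ?case by (intro exI[of _ 0]) simp
  next
    case (lspan_step F g c)
    then obtain n h f where F: "\<forall>i<(n::nat). h i \<in> K \<and> f i \<in> L" "F = (\<lambda>p. \<Sum>i<n. tensor (h i) (f i) p)"
      by blast
    obtain h' f' where g: "g = tensor h' f'" "h' \<in> K" "f' \<in> L"
      using lspan_step(2) by blast
    let ?h = "h(n := (\<lambda>z. c * h' z))" and ?f = "f(n := f')"
    have "\<forall>i<Suc n. ?h i \<in> K \<and> ?f i \<in> L"
      using F(1) g L2_subspace_scale[OF K g(2)] by (auto simp: less_Suc_eq)
    moreover have "(\<lambda>p. F p + c * g p) = (\<lambda>p. \<Sum>i<Suc n. tensor (?h i) (?f i) p)"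
      by (auto simp: F(2) g(1) tensor_def fun_eq_iff mult.assoc)
    ultimately show ?case by blast
  qed
  have "(\<exists>(n::nat) h f. (\<forall>i<n. h i \<in> K \<and> f i \<in> L) \<and>
        L2_norm torus (\<lambda>p. F p - (\<Sum>i<n. tensor (h i) (f i) p)) < e)
      \<longleftrightarrow> (\<exists>v\<in>lspan (elementary_tensors K L). L2_norm torus (\<lambda>p. F p - v p) < e)" for F e
  proof
    assume "\<exists>(n::nat) h f. (\<forall>i<n. h i \<in> K \<and> f i \<in> L) \<and>
        L2_norm torus (\<lambda>p. F p - (\<Sum>i<n. tensor (h i) (f i) p)) < e"
    then obtain n h f where *: "\<forall>i<(n::nat). h i \<in> K \<and> f i \<in> L"
        "L2_norm torus (\<lambda>p. F p - (\<Sum>i<n. tensor (h i) (f i) p)) < e"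
      by blast
    show "\<exists>v\<in>lspan (elementary_tensors K L). L2_norm torus (\<lambda>p. F p - v p) < e"
      using *(2) 1[OF *(1)] by (intro bexI[of _ "\<lambda>p. \<Sum>i<n. tensor (h i) (f i) p"])
  next
    assume "\<exists>v\<in>lspan (elementary_tensors K L). L2_norm torus (\<lambda>p. F p - v p) < e"
    then obtain v where v: "v \<in> lspan (elementary_tensors K L)" "L2_norm torus (\<lambda>p. F p - v p) < e"
      by blast
    from 2[OF v(1)] obtain n h f where "\<forall>i<(n::nat). h i \<in> K \<and> f i \<in> L" "v = (\<lambda>p. \<Sum>i<n. tensor (h i) (f i) p)"
      by blast
    with v(2) show "\<exists>(n::nat) h f. (\<forall>i<n. h i \<in> K \<and> f i \<in> L) \<and>
        L2_norm torus (\<lambda>p. F p - (\<Sum>i<n. tensor (h i) (f i) p)) < e"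
      by blast
  qed
  then show ?thesis
    by (simp only: tensor_space_def L2_closure_def)
qed

lemma elementary_tensors_L2:
  assumes "K \<subseteq> L2 circle" "L \<subseteq> L2 circle"
  shows "elementary_tensors K L \<subseteq> L2 torus"
  using assms tensor_L2 by blast

lemma closed_L2_subspace_tensor_space:
  assumes K: "L2_subspace circle K" and L: "L2_subspace circle L"
  shows "closed_L2_subspace torus (tensor_space K L)"
  unfolding tensor_space_eq[OF K]
  by (intro closed_L2_subspace_closure L2_subspace_lspan elementary_tensors_L2)
     (use K L in \<open>auto simp: L2_subspace_def\<close>)

lemma tensor_in_tensor_space:
  assumes K: "L2_subspace circle K" and L: "L2_subspace circle L" and "h \<in> K" "f \<in> L"
  shows "tensor h f \<in> tensor_space K L"
proof -
  have sub: "elementary_tensors K L \<subseteq> L2 torus"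
    by (rule elementary_tensors_L2) (use K L in \<open>auto simp: L2_subspace_def\<close>)
  have "tensor h f \<in> lspan (elementary_tensors K L)"
    using assms(3,4) by (intro lspan_base) blast
  then show ?thesis
    unfolding tensor_space_eq[OF K]
    by (rule subsetD[OF L2_closure_superset[OF lspan_subset[OF L2_subspace_UNIV sub]]])
qed

text \<open>Together with its converse below it translates norm bounds into inequalities of
  nonnegative integrals, where Tonelli's theorem can be applied slice by slice.\<close>

lemma L2_norm_le_nn_integral:
  assumes "f \<in> L2 M" "g \<in> L2 N"
    and "(\<integral>\<^sup>+ x. ennreal ((cmod (f x))\<^sup>2) \<partial>M) \<le> ennreal (C\<^sup>2) * (\<integral>\<^sup>+ x. ennreal ((cmod (g x))\<^sup>2) \<partial>N)"
    and C: "C \<ge> 0"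
  shows "L2_norm M f \<le> C * L2_norm N g"
proof -
  have "ennreal ((L2_norm M f)\<^sup>2) \<le> ennreal (C\<^sup>2) * ennreal ((L2_norm N g)\<^sup>2)"
    using assms(3) nn_integral_eq_integral[OF L2_D(2)[OF assms(1)]] nn_integral_eq_integral[OF L2_D(2)[OF assms(2)]]
    by (simp add: L2_norm_sq)
  then have "(L2_norm M f)\<^sup>2 \<le> (C * L2_norm N g)\<^sup>2"
    by (simp add: power_mult_distrib flip: ennreal_mult)
  then show ?thesis by (rule power2_le_imp_le) (use C in simp)
qed

lemma L2_norm_nn_integral_le:
  assumes "f \<in> L2 M" "g \<in> L2 N" "L2_norm M f \<le> C * L2_norm N g" and C: "C \<ge> 0"
  shows "(\<integral>\<^sup>+ x. ennreal ((cmod (f x))\<^sup>2) \<partial>M) \<le> ennreal (C\<^sup>2) * (\<integral>\<^sup>+ x. ennreal ((cmod (g x))\<^sup>2) \<partial>N)"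
proof -
  have "(L2_norm M f)\<^sup>2 \<le> (C * L2_norm N g)\<^sup>2"
    using assms(3) by (intro power_mono) auto
  then have "ennreal ((L2_norm M f)\<^sup>2) \<le> ennreal (C\<^sup>2) * ennreal ((L2_norm N g)\<^sup>2)"
    by (simp add: power_mult_distrib flip: ennreal_mult)
  then show ?thesis
    using nn_integral_eq_integral[OF L2_D(2)[OF assms(1)]] nn_integral_eq_integral[OF L2_D(2)[OF assms(2)]]
    by (simp add: L2_norm_sq)
qed

text \<open>Boundedness of \<open>1 \<otimes> T\<close>: for each fixed \<open>z\<close>, the slice at \<open>z\<close> of the image is \<open>T\<close> applied
  to the slice of the argument, so the norm bound follows by integrating over \<open>z\<close>.\<close>

lemma pair_span_tensor_slice_bound:
  fixes sl :: "complex \<Rightarrow> complex \<Rightarrow> complex \<times> complex"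
  assumes T: "bounded_operator circle L circle L T" and L: "L2_subspace circle L"
    and C: "C \<ge> 0" "\<And>f. f \<in> L \<Longrightarrow> L2_norm circle (T f) \<le> C * L2_norm circle f"
    and Gsl: "\<And>g k z. (g, k) \<in> G \<Longrightarrow> \<exists>c. \<exists>f\<in>L. (\<lambda>w. g (sl z w)) = (\<lambda>w. c * f w) \<and> (\<lambda>w. k (sl z w)) = (\<lambda>w. c * T f w)"
    and fub: "\<And>f. f \<in> borel_measurable torus \<Longrightarrow>
        (\<integral>\<^sup>+ p. f p \<partial>torus) = (\<integral>\<^sup>+ z. \<integral>\<^sup>+ w. f (sl z w) \<partial>circle \<partial>circle)"
    and G: "\<And>g k. (g, k) \<in> G \<Longrightarrow> g \<in> L2 torus \<and> k \<in> L2 torus"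
    and xy: "(x, y) \<in> pair_span G"
  shows "L2_norm torus y \<le> C * L2_norm torus x"
proof -
  note LL = L2_subspace_L2[OF L]
  \<comment> \<open>The claim holds for every \<open>z\<close>, not just almost every
    \<open>z\<close>: slices of generators are exact multiples \<open>d * T f w\<close>, and
    exceptional null sets arise only in the variable \<open>w\<close>.\<close>
  have slice: "(\<lambda>w. x (sl z w)) \<in> L \<and> (\<lambda>w. y (sl z w)) \<in> L2 circle \<and>
      (AE w in circle. T (\<lambda>w. x (sl z w)) w = y (sl z w))" for z
    using xy
  proof (induction x y rule: pair_span.induct)
    case pair_span_zero
    show ?case using bounded_operator_zero[OF T L] L2_subspace_zero[OF L] by (simp add: L2_zero)
  next
    case (pair_span_step x y g k c)
    obtain d f where f: "f \<in> L" "(\<lambda>w. g (sl z w)) = (\<lambda>w. d * f w)" "(\<lambda>w. k (sl z w)) = (\<lambda>w. d * T f w)"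
      using Gsl[OF pair_span_step(2)] by blast
    have g: "g (sl z w) = d * f w" and k: "k (sl z w) = d * T f w" for w
      using fun_cong[OF f(2)] fun_cong[OF f(3)] by auto
    from pair_span_step have x: "(\<lambda>w. x (sl z w)) \<in> L" and y: "(\<lambda>w. y (sl z w)) \<in> L2 circle"
      and Tx: "AE w in circle. T (\<lambda>w. x (sl z w)) w = y (sl z w)" by auto
    have "AE w in circle. T (\<lambda>w. 1 * x (sl z w) + (c * d) * f w) w = 1 * T (\<lambda>w. x (sl z w)) w + (c * d) * T f w"
      by (rule bounded_operatorD(2)[OF T x f(1)])
    with Tx have "AE w in circle. T (\<lambda>w. x (sl z w) + c * g (sl z w)) w = y (sl z w) + c * k (sl z w)"
      by eventually_elim (simp add: g k mult.assoc)
    moreover have "(\<lambda>w. x (sl z w) + c * g (sl z w)) \<in> L"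
      using L2_subspace_lincomb[OF L x f(1), of 1 "c * d"] by (simp add: g mult.assoc)
    moreover have "(\<lambda>w. y (sl z w) + c * k (sl z w)) \<in> L2 circle"
      using L2_lincomb[OF y LL[OF bounded_operatorD(1)[OF T f(1)]], of 1 "c * d"] by (simp add: k mult.assoc)
    ultimately show ?case by blast
  qed
  have sub: "fst ` G \<subseteq> L2 torus" "snd ` G \<subseteq> L2 torus"
    using G by auto
  have x: "x \<in> L2 torus" and y: "y \<in> L2 torus"
    using pair_span_lspan[OF xy] lspan_subset[OF L2_subspace_UNIV sub(1)]
      lspan_subset[OF L2_subspace_UNIV sub(2)] by auto
  note [measurable] = L2_D(1)[OF x] L2_D(1)[OF y]
  have in_slice: "(\<integral>\<^sup>+ w. ennreal ((cmod (y (sl z w)))\<^sup>2) \<partial>circle)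
      \<le> ennreal (C\<^sup>2) * (\<integral>\<^sup>+ w. ennreal ((cmod (x (sl z w)))\<^sup>2) \<partial>circle)" for z
  proof (rule L2_norm_nn_integral_le[OF _ _ _ C(1)])
    have s: "(\<lambda>w. x (sl z w)) \<in> L" "AE w in circle. T (\<lambda>w. x (sl z w)) w = y (sl z w)"
      using slice[of z] by blast+
    show sy: "(\<lambda>w. y (sl z w)) \<in> L2 circle"
      using slice[of z] by blast
    show "(\<lambda>w. x (sl z w)) \<in> L2 circle"
      by (rule LL[OF s(1)])
    have "L2_norm circle (\<lambda>w. y (sl z w)) = L2_norm circle (T (\<lambda>w. x (sl z w)))"
      by (rule L2_norm_cong_AE[OF LL[OF bounded_operatorD(1)[OF T s(1)]] sy s(2), symmetric])
    also have "\<dots> \<le> C * L2_norm circle (\<lambda>w. x (sl z w))"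
      by (rule C(2)[OF s(1)])
    finally show "L2_norm circle (\<lambda>w. y (sl z w)) \<le> C * L2_norm circle (\<lambda>w. x (sl z w))" .
  qed
  show ?thesis
  proof (rule L2_norm_le_nn_integral[OF y x _ C(1)])
    have "(\<integral>\<^sup>+ p. ennreal ((cmod (y p))\<^sup>2) \<partial>torus) = (\<integral>\<^sup>+ z. \<integral>\<^sup>+ w. ennreal ((cmod (y (sl z w)))\<^sup>2) \<partial>circle \<partial>circle)"
      by (rule fub) measurable
    also have "\<dots> \<le> (\<integral>\<^sup>+ z. ennreal (C\<^sup>2) * (\<integral>\<^sup>+ w. ennreal ((cmod (x (sl z w)))\<^sup>2) \<partial>circle) \<partial>circle)"
      by (intro nn_integral_mono in_slice)
    also have "\<dots> = (\<integral>\<^sup>+ z. \<integral>\<^sup>+ w. ennreal (C\<^sup>2) * ennreal ((cmod (x (sl z w)))\<^sup>2) \<partial>circle \<partial>circle)"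
    proof (intro nn_integral_cong nn_integral_cmult[symmetric])
      fix z
      have "(\<lambda>w. x (sl z w)) \<in> L" using slice[of z] by blast
      note [measurable] = L2_D(1)[OF LL[OF this]]
      show "(\<lambda>w. ennreal ((cmod (x (sl z w)))\<^sup>2)) \<in> borel_measurable circle"
        by measurable
    qed
    also have "\<dots> = (\<integral>\<^sup>+ p. ennreal (C\<^sup>2) * ennreal ((cmod (x p))\<^sup>2) \<partial>torus)"
      by (rule fub[symmetric]) measurable
    also have "\<dots> = ennreal (C\<^sup>2) * (\<integral>\<^sup>+ p. ennreal ((cmod (x p))\<^sup>2) \<partial>torus)"
      by (rule nn_integral_cmult) measurable
    finally show "(\<integral>\<^sup>+ p. ennreal ((cmod (y p))\<^sup>2) \<partial>torus) \<le> ennreal (C\<^sup>2) * (\<integral>\<^sup>+ p. ennreal ((cmod (x p))\<^sup>2) \<partial>torus)" .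
  qed
qed

text \<open>The operator is the product of \<open>S \<otimes> 1\<close> and
  \<open>1 \<otimes> T\<close>. Each factor is bounded by slicing in one variable, so the norm
  bounds multiply, and the extension lemma supplies the operator that the choice in
  \<open>tensor_operator\<close> asks for.\<close>

lemma tensor_operator:
  assumes S: "bounded_operator circle K circle K S" and K: "L2_subspace circle K"
    and T: "bounded_operator circle L circle L T" and L: "L2_subspace circle L"
  shows "bounded_operator torus (tensor_space K L) torus (tensor_space K L) (tensor_operator K L S T)" (is ?bd)
    and "h \<in> K \<Longrightarrow> f \<in> L \<Longrightarrow> AE p in torus. tensor_operator K L S T (tensor h f) p = tensor (S h) (T f) p"
proof -
  note KL = L2_subspace_L2[OF K] and LL = L2_subspace_L2[OF L]
  note SK = bounded_operatorD(1)[OF S] and TL = bounded_operatorD(1)[OF T]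
  obtain C where C: "C \<ge> 0" "\<And>f. f \<in> K \<Longrightarrow> L2_norm circle (S f) \<le> C * L2_norm circle f"
    using bounded_operator_bound[OF S] by blast
  obtain D where D: "D \<ge> 0" "\<And>f. f \<in> L \<Longrightarrow> L2_norm circle (T f) \<le> D * L2_norm circle f"
    using bounded_operator_bound[OF T] by blast
  define G where "G = {(tensor h f, tensor (S h) (T f)) | h f. h \<in> K \<and> f \<in> L}"
  define G1 where "G1 = {(tensor h f, tensor h (T f)) | h f. h \<in> K \<and> f \<in> L}"
  define G2 where "G2 = {(tensor h f, tensor (S h) f) | h f. h \<in> K \<and> f \<in> L}"
  have b1: "L2_norm torus y \<le> D * L2_norm torus x" if "(x, y) \<in> pair_span G1" for x y
  proof (rule pair_span_tensor_slice_bound[OF T L D _ _ _ that, where sl = Pair])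
    show "\<exists>c. \<exists>f\<in>L. (\<lambda>w. g (z, w)) = (\<lambda>w. c * f w) \<and> (\<lambda>w. k (z, w)) = (\<lambda>w. c * T f w)"
      if gk: "(g, k) \<in> G1" for g k z
    proof -
      obtain h f where "g = tensor h f" "k = tensor h (T f)" "f \<in> L"
        using gk unfolding G1_def by blast
      then show ?thesis by (intro exI[of _ "h z"] bexI[of _ f]) (auto simp: tensor_def)
    qed
    show "(\<integral>\<^sup>+ p. f p \<partial>torus) = (\<integral>\<^sup>+ z. \<integral>\<^sup>+ w. f (z, w) \<partial>circle \<partial>circle)"
      if "f \<in> borel_measurable torus" for f
      by (rule torus_nn_integral(1)[OF that])
    show "g \<in> L2 torus \<and> k \<in> L2 torus" if gk: "(g, k) \<in> G1" for g k
    proof -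
      obtain h f where "g = tensor h f" "k = tensor h (T f)" "h \<in> K" "f \<in> L"
        using gk unfolding G1_def by blast
      then show ?thesis by (simp add: tensor_L2 KL LL TL)
    qed
  qed
  \<comment> \<open>Now the second coordinate is frozen and \<open>S\<close> acts in the first, so
    the torus integral is taken in the other order.\<close>
  have b2: "L2_norm torus y \<le> C * L2_norm torus x" if "(x, y) \<in> pair_span G2" for x y
  proof (rule pair_span_tensor_slice_bound[OF S K C _ _ _ that, where sl = "\<lambda>w z. (z, w)"])
    show "\<exists>c. \<exists>f\<in>K. (\<lambda>w. g (w, z)) = (\<lambda>w. c * f w) \<and> (\<lambda>w. k (w, z)) = (\<lambda>w. c * S f w)"
      if gk: "(g, k) \<in> G2" for g k z
    proof -
      obtain h f where "g = tensor h f" "k = tensor (S h) f" "h \<in> K"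
        using gk unfolding G2_def by blast
      then show ?thesis by (intro exI[of _ "f z"] bexI[of _ h]) (auto simp: tensor_def mult.commute)
    qed
    show "(\<integral>\<^sup>+ p. f p \<partial>torus) = (\<integral>\<^sup>+ z. \<integral>\<^sup>+ w. f (w, z) \<partial>circle \<partial>circle)"
      if "f \<in> borel_measurable torus" for f
      by (rule torus_nn_integral(2)[OF that])
    show "g \<in> L2 torus \<and> k \<in> L2 torus" if gk: "(g, k) \<in> G2" for g k
    proof -
      obtain h f where "g = tensor h f" "k = tensor (S h) f" "h \<in> K" "f \<in> L"
        using gk unfolding G2_def by blast
      then show ?thesis by (simp add: tensor_L2 KL LL SK)
    qed
  qed
  \<comment> \<open>The intermediate function \<open>m\<close> is the image under
    \<open>1 \<otimes> T\<close>; it is built along the same combination, so the two bounds can be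
    chained.\<close>
  have factor: "\<exists>m. (x, m) \<in> pair_span G1 \<and> (m, y) \<in> pair_span G2" if "(x, y) \<in> pair_span G" for x y
    using that
  proof (induction x y rule: pair_span.induct)
    case pair_span_zero
    show ?case using pair_span.pair_span_zero by blast
  next
    case (pair_span_step x y g k c)
    then obtain m where m: "(x, m) \<in> pair_span G1" "(m, y) \<in> pair_span G2" by blast
    obtain h f where hf: "g = tensor h f" "k = tensor (S h) (T f)" "h \<in> K" "f \<in> L"
      using pair_span_step(2) unfolding G_def by blast
    have g1: "(g, tensor h (T f)) \<in> G1"
      unfolding G1_def using hf by blast
    have g2: "(tensor h (T f), k) \<in> G2"
      unfolding G2_def using hf TL[OF hf(4)] by blast
    show ?case
      using pair_span.pair_span_step[OF m(1) g1, of c] pair_span.pair_span_step[OF m(2) g2, of c] by blast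
  qed
  have bd: "L2_norm torus y \<le> (C * D) * L2_norm torus x" if xy: "(x, y) \<in> pair_span G" for x y
  proof -
    obtain m where m: "(x, m) \<in> pair_span G1" "(m, y) \<in> pair_span G2"
      using factor[OF xy] by blast
    have "L2_norm torus y \<le> C * L2_norm torus m" by (rule b2[OF m(2)])
    also have "\<dots> \<le> C * (D * L2_norm torus x)" by (intro mult_left_mono b1[OF m(1)] C(1))
    finally show ?thesis by (simp add: mult.assoc)
  qed
  have fstG: "fst ` G = elementary_tensors K L"
    unfolding G_def by (auto simp: image_def)
  have "\<exists>R. bounded_operator torus (tensor_space K L) torus (tensor_space K L) R \<and>
        (\<forall>h\<in>K. \<forall>f\<in>L. AE p in torus. R (tensor h f) p = tensor (S h) (T f) p)"
  proof (rule pair_span_extension[OF finite_measure_torus closed_L2_subspace_tensor_space[OF K L] _ bd])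
    show "g \<in> L2 torus \<and> k \<in> tensor_space K L" if gk: "(g, k) \<in> G" for g k
    proof -
      obtain h f where "g = tensor h f" "k = tensor (S h) (T f)" "h \<in> K" "f \<in> L"
        using gk unfolding G_def by blast
      then show ?thesis by (simp add: tensor_L2 KL LL tensor_in_tensor_space[OF K L] SK TL)
    qed
    fix R assume R: "bounded_operator torus (L2_closure torus (lspan (fst ` G))) torus (tensor_space K L) R"
      "\<And>g k. (g, k) \<in> G \<Longrightarrow> AE t in torus. R g t = k t"
    show ?thesis
    proof (intro exI conjI ballI)
      show "bounded_operator torus (tensor_space K L) torus (tensor_space K L) R"
        using R(1) unfolding fstG tensor_space_eq[OF K, symmetric] .
      show "AE p in torus. R (tensor h f) p = tensor (S h) (T f) p" if "h \<in> K" "f \<in> L" for h f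
        by (rule R(2)) (use that in \<open>auto simp: G_def\<close>)
    qed
  qed
  then have *: "bounded_operator torus (tensor_space K L) torus (tensor_space K L) (tensor_operator K L S T) \<and>
        (\<forall>h\<in>K. \<forall>f\<in>L. AE p in torus. tensor_operator K L S T (tensor h f) p = tensor (S h) (T f) p)"
    unfolding tensor_operator_def by (rule someI_ex)
  show ?bd using * by (rule conjunct1)
  show "AE p in torus. tensor_operator K L S T (tensor h f) p = tensor (S h) (T f) p" if "h \<in> K" "f \<in> L"
    using * that by blast
qed

text \<open>Inner products of elementary tensors and of their images factor in the same way, so the
  prescribed relation is isometric and extends. This also shows that the choice defining
  \<open>Omega\<close> is not vacuous.\<close>

lemma
  assumes B: "inner_function B"
  shows bounded_operator_Omega: "bounded_operator torus (tensor_space (model_space B) (L2 circle)) circle (L2 circle) (Omega B)"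
    and Omega_tensor: "h \<in> model_space B \<Longrightarrow> f \<in> L2 circle \<Longrightarrow> AE z in circle. Omega B (tensor h f) z = h z * f (B z)"
    and L2_norm_Omega: "F \<in> tensor_space (model_space B) (L2 circle) \<Longrightarrow> L2_norm circle (Omega B F) = L2_norm torus F"
proof -
  let ?K = "model_space B"
  have K: "L2_subspace circle ?K"
    by (rule closed_L2_subspaceD[OF closed_L2_subspace_model_space[OF B]])
  define G where "G = {(tensor h f, \<lambda>z. h z * f (B z)) | h f. h \<in> ?K \<and> f \<in> L2 circle}"
  have GD: "\<exists>h f. g = tensor h f \<and> k = (\<lambda>z. h z * f (B z)) \<and> h \<in> ?K \<and> f \<in> L2 circle" if "(g, k) \<in> G" for g k
    using that unfolding G_def by blast
  have GL: "g \<in> L2 torus \<and> k \<in> L2 circle" if gk: "(g, k) \<in> G" for g k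
  proof -
    obtain h f where "g = tensor h f" "k = (\<lambda>z. h z * f (B z))" "h \<in> ?K" "f \<in> L2 circle"
      using GD[OF gk] by blast
    then show ?thesis
      by (simp add: tensor_L2 model_space_L2[of _ B] model_space_mult_compose(1)[OF B])
  qed
  have inner: "L2_inner torus g g' = L2_inner circle k k'" if gk: "(g, k) \<in> G" and gk': "(g', k') \<in> G" for g k g' k'
  proof -
    obtain h f h' f' where "g = tensor h f" "k = (\<lambda>z. h z * f (B z))" "h \<in> ?K" "f \<in> L2 circle"
      "g' = tensor h' f'" "k' = (\<lambda>z. h' z * f' (B z))" "h' \<in> ?K" "f' \<in> L2 circle"
      using GD[OF gk] GD[OF gk'] by blast
    then show ?thesis
      by (simp only: L2_inner_tensor inner_model_space_mult_compose[OF B] model_space_L2)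
  qed
  have iso: "L2_norm circle y = L2_norm torus x" if "(x, y) \<in> pair_span G" for x y
  proof -
    have "L2_inner torus x x = L2_inner circle y y"
      by (rule pair_span_inner_eq[OF GL inner that that])
    then have "(L2_norm torus x)\<^sup>2 = (L2_norm circle y)\<^sup>2"
      unfolding L2_inner_self of_real_eq_iff .
    then show ?thesis by (simp add: power2_eq_iff_nonneg)
  qed
  have bd: "L2_norm circle y \<le> 1 * L2_norm torus x" if "(x, y) \<in> pair_span G" for x y
    using iso[OF that] by simp
  have fstG: "fst ` G = elementary_tensors ?K (L2 circle)"
    unfolding G_def by (auto simp: image_def)
  have "\<exists>U. bounded_operator torus (tensor_space ?K (L2 circle)) circle (L2 circle) U \<and>
        (\<forall>h\<in>?K. \<forall>f\<in>L2 circle. AE z in circle. U (tensor h f) z = h z * (f \<circ> B) z)"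
  proof (rule pair_span_extension[OF circle.finite_measure_axioms closed_L2_subspace_UNIV GL bd])
    fix U assume U: "bounded_operator torus (L2_closure torus (lspan (fst ` G))) circle (L2 circle) U"
      "\<And>g k. (g, k) \<in> G \<Longrightarrow> AE t in circle. U g t = k t"
    show ?thesis
    proof (intro exI conjI ballI)
      show "bounded_operator torus (tensor_space ?K (L2 circle)) circle (L2 circle) U"
        using U(1) unfolding fstG tensor_space_eq[OF K, symmetric] .
      show "AE z in circle. U (tensor h f) z = h z * (f \<circ> B) z" if "h \<in> ?K" "f \<in> L2 circle" for h f
        unfolding comp_def by (rule U(2)) (use that in \<open>auto simp: G_def\<close>)
    qed
  qed
  then have *: "bounded_operator torus (tensor_space ?K (L2 circle)) circle (L2 circle) (Omega B) \<and>
        (\<forall>h\<in>?K. \<forall>f\<in>L2 circle. AE z in circle. Omega B (tensor h f) z = h z * (f \<circ> B) z)"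
    unfolding Omega_def by (rule someI_ex)
  show bo: "bounded_operator torus (tensor_space ?K (L2 circle)) circle (L2 circle) (Omega B)"
    using * by (rule conjunct1)
  show val: "AE z in circle. Omega B (tensor h f) z = h z * f (B z)" if "h \<in> ?K" "f \<in> L2 circle" for h f
    using * that unfolding comp_def by blast
  show "L2_norm circle (Omega B F) = L2_norm torus F" if F: "F \<in> tensor_space ?K (L2 circle)"
  proof -
    let ?TS = "tensor_space ?K (L2 circle)"
    have TS: "L2_subspace torus ?TS"
      by (rule closed_L2_subspaceD[OF closed_L2_subspace_tensor_space[OF K L2_subspace_UNIV]])
    obtain C where C: "C \<ge> 0" "\<And>F. F \<in> ?TS \<Longrightarrow> L2_norm circle (Omega B F) \<le> C * L2_norm torus F"
      using bounded_operator_bound[OF bo] by blast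
    have FL: "F \<in> L2 torus" and OF: "Omega B F \<in> L2 circle"
      using L2_subspace_L2[OF TS F] bounded_operatorD(1)[OF bo F] by auto
    \<comment> \<open>\<open>F\<close> is approximated by \<open>x\<close> in the span, where the
      norms agree. The image moves by at most \<open>C\<close> times the distance and
      \<open>F\<close> itself by the distance, hence the factor \<open>C + 1\<close>.\<close>
    have "\<bar>L2_norm circle (Omega B F) - L2_norm torus F\<bar> \<le> 0 + e" if "e > 0" for e
    proof -
      have "F \<in> L2_closure torus (lspan (fst ` G))"
        using F unfolding tensor_space_eq[OF K] fstG .
      moreover have "e / (C + 1) > 0" using that C by simp
      ultimately obtain x where x: "x \<in> fst ` pair_span G" "L2_norm torus (\<lambda>p. F p - x p) < e / (C + 1)"
        unfolding fst_pair_span by (rule L2_closureE)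
      then obtain y where xy: "(x, y) \<in> pair_span G" by auto
      have "x \<in> ?TS \<and> (AE t in circle. Omega B x t = y t)"
      proof (rule pair_span_operator[OF bo TS L2_subspace_UNIV _ xy])
        fix g k assume "(g, k) \<in> G"
        then obtain h f where "g = tensor h f" "k = (\<lambda>z. h z * f (B z))" "h \<in> ?K" "f \<in> L2 circle"
          using GD by blast
        then show "g \<in> ?TS \<and> (AE t in circle. Omega B g t = k t)"
          using val tensor_in_tensor_space[OF K L2_subspace_UNIV] by simp
      qed
      then have xTS: "x \<in> ?TS" and Ox: "AE t in circle. Omega B x t = y t" by auto
      have xL: "x \<in> L2 torus" by (rule L2_subspace_L2[OF TS xTS])
      have OxL: "Omega B x \<in> L2 circle" by (rule bounded_operatorD(1)[OF bo xTS])
      have "snd ` G \<subseteq> L2 circle" using GL by auto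
      then have yL: "y \<in> L2 circle"
        using subsetD[OF lspan_subset[OF L2_subspace_UNIV] pair_span_lspan(2)[OF xy]] by blast
      have d: "(\<lambda>p. F p - x p) \<in> ?TS" by (rule L2_subspace_diff[OF TS F xTS])
      have "AE t in circle. Omega B (\<lambda>p. 1 * F p + (-1) * x p) t = 1 * Omega B F t + (-1) * Omega B x t"
        by (rule bounded_operatorD(2)[OF bo F xTS])
      then have "AE t in circle. Omega B (\<lambda>p. F p - x p) t = Omega B F t - Omega B x t" by simp
      then have "L2_norm circle (\<lambda>t. Omega B F t - Omega B x t) = L2_norm circle (Omega B (\<lambda>p. F p - x p))"
        by (intro L2_norm_cong_AE L2_diff OF OxL bounded_operatorD(1)[OF bo d]) auto
      also have "\<dots> \<le> C * L2_norm torus (\<lambda>p. F p - x p)" by (rule C(2)[OF d])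
      finally have 1: "L2_norm circle (\<lambda>t. Omega B F t - Omega B x t) \<le> C * L2_norm torus (\<lambda>p. F p - x p)" .
      have 2: "L2_norm circle (Omega B x) = L2_norm torus x"
        using L2_norm_cong_AE[OF OxL yL Ox] iso[OF xy] by simp
      have tri: "\<bar>L2_norm M u - L2_norm M v\<bar> \<le> L2_norm M (\<lambda>t. u t - v t)"
        if "u \<in> L2 M" "v \<in> L2 M" for u v :: "'c \<Rightarrow> complex" and M
        using L2_norm_add_le[OF L2_diff[OF that] that(2)] L2_norm_add_le[OF L2_diff[OF that(2,1)] that(1)]
          L2_norm_minus[of M u v] by simp
      have "\<bar>L2_norm circle (Omega B F) - L2_norm torus F\<bar>
          \<le> L2_norm circle (\<lambda>t. Omega B F t - Omega B x t) + L2_norm torus (\<lambda>p. F p - x p)"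
        using tri[OF OF OxL] tri[OF FL xL] 2 by linarith
      also have "\<dots> \<le> (C + 1) * L2_norm torus (\<lambda>p. F p - x p)"
        using 1 by (simp add: algebra_simps)
      also have "\<dots> \<le> (C + 1) * (e / (C + 1))"
        using x(2) C(1) by (intro mult_left_mono) auto
      also have "\<dots> = e" using C(1) by simp
      finally show ?thesis by simp
    qed
    then have "\<bar>L2_norm circle (Omega B F) - L2_norm torus F\<bar> \<le> 0" by (rule field_le_epsilon)
    then show ?thesis by simp
  qed
qed

section \<open>Truncated Toeplitz operators\<close>

lemma tto_extension_tto: "tto_bounded \<Theta> \<phi> \<Longrightarrow> tto_extension \<Theta> \<phi> (tto \<Theta> \<phi>)"
  using someI_ex[of "tto_extension \<Theta> \<phi>"] by (simp add: tto_bounded_def tto_def)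

text \<open>Against elements of the model space the projection drops out. With the converse
  \<open>tto_extensionI\<close>, extensions are recognised by inner products alone.\<close>

lemma tto_extension_inner:
  assumes \<Theta>: "inner_function \<Theta>" and \<phi>: "\<phi> \<in> L2 circle" and T: "tto_extension \<Theta> \<phi> T"
    and f: "f \<in> model_space \<Theta>" "f \<in> hardy_inf" and k: "k \<in> model_space \<Theta>"
  shows "L2_inner circle (T f) k = L2_inner circle (\<lambda>z. \<phi> z * f z) k"
proof -
  note K = closed_L2_subspace_model_space[OF \<Theta>]
  have \<phi>f: "(\<lambda>z. \<phi> z * f z) \<in> L2 circle" by (rule L2_mult_hardy_inf[OF \<phi> f(2)])
  have Tf: "T f \<in> model_space \<Theta>"
    using T f(1) unfolding tto_extension_def by (blast dest: bounded_operatorD(1))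
  have "AE z in circle. T f z = L2_proj circle (model_space \<Theta>) (\<lambda>w. \<phi> w * f w) z"
    using T f unfolding tto_extension_def by blast
  then have "L2_inner circle (T f) k = L2_inner circle (L2_proj circle (model_space \<Theta>) (\<lambda>w. \<phi> w * f w)) k"
    by (rule L2_inner_cong_AE[OF model_space_L2[OF Tf] model_space_L2[OF circle.L2_proj_in[OF K \<phi>f]]
          model_space_L2[OF k] model_space_L2[OF k]]) simp
  also have "\<dots> = L2_inner circle (\<lambda>z. \<phi> z * f z) k"
    by (rule circle.L2_inner_proj[OF K \<phi>f k])
  finally show ?thesis .
qed

lemma tto_extensionI:
  assumes \<Theta>: "inner_function \<Theta>" and \<phi>: "\<phi> \<in> L2 circle"
    and T: "bounded_operator circle (model_space \<Theta>) circle (model_space \<Theta>) T"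
    and inner: "\<And>f k. f \<in> model_space \<Theta> \<Longrightarrow> f \<in> hardy_inf \<Longrightarrow> k \<in> model_space \<Theta> \<Longrightarrow>
        L2_inner circle (T f) k = L2_inner circle (\<lambda>z. \<phi> z * f z) k"
  shows "tto_extension \<Theta> \<phi> T"
  unfolding tto_extension_def
proof (intro conjI ballI T)
  fix f assume "f \<in> model_space \<Theta> \<inter> hardy_inf"
  then have f: "f \<in> model_space \<Theta>" "f \<in> hardy_inf" by auto
  show "AE z in circle. T f z = L2_proj circle (model_space \<Theta>) (\<lambda>w. \<phi> w * f w) z"
    by (rule circle.L2_proj_unique[OF closed_L2_subspace_model_space[OF \<Theta>] L2_mult_hardy_inf[OF \<phi> f(2)]
          bounded_operatorD(1)[OF T f(1)] inner[OF f]])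
qed

text \<open>Both unit shifts of the symbol are instances of this: \<open>\<phi>' f = \<phi> (S f) + c(f) p\<close> with
  \<open>S\<close> the compressed shift of the model space or its adjoint.\<close>

lemma tto_bounded_perturb:
  assumes \<Theta>: "inner_function \<Theta>" and \<phi>: "\<phi> \<in> L2 circle" and \<phi>': "\<phi>' \<in> L2 circle" and p: "p \<in> L2 circle"
    and bdd: "tto_bounded \<Theta> \<phi>"
    and S: "\<And>f. f \<in> model_space \<Theta> \<Longrightarrow> S f \<in> model_space \<Theta>"
    and S_inf: "\<And>f. f \<in> model_space \<Theta> \<Longrightarrow> f \<in> hardy_inf \<Longrightarrow> S f \<in> hardy_inf"
    and S_lin: "\<And>f g a b. f \<in> model_space \<Theta> \<Longrightarrow> g \<in> model_space \<Theta> \<Longrightarrow>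
        S (\<lambda>z. a * f z + b * g z) = (\<lambda>z. a * S f z + b * S g z)"
    and S_bd: "\<And>f. f \<in> model_space \<Theta> \<Longrightarrow> L2_norm circle (S f) \<le> C * L2_norm circle f"
    and c_lin: "\<And>f g a b. f \<in> model_space \<Theta> \<Longrightarrow> g \<in> model_space \<Theta> \<Longrightarrow>
        c (\<lambda>z. a * f z + b * g z) = a * c f + b * c g"
    and c_bd: "\<And>f. f \<in> model_space \<Theta> \<Longrightarrow> cmod (c f) \<le> D * L2_norm circle f"
    and eq: "\<And>f. f \<in> model_space \<Theta> \<Longrightarrow> AE z in circle. \<phi>' z * f z = \<phi> z * S f z + c f * p z"
  shows "tto_bounded \<Theta> \<phi>'"
proof -
  let ?K = "model_space \<Theta>"
  note K = closed_L2_subspace_model_space[OF \<Theta>]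
  note KS = closed_L2_subspaceD[OF K]
  define T where "T = tto \<Theta> \<phi>"
  have T: "tto_extension \<Theta> \<phi> T"
    unfolding T_def by (rule tto_extension_tto[OF bdd])
  then have Tb: "bounded_operator circle ?K circle ?K T"
    by (simp add: tto_extension_def)
  note TK = bounded_operatorD(1)[OF Tb S]
  define q where "q = L2_proj circle ?K p"
  have q: "q \<in> ?K" unfolding q_def by (rule circle.L2_proj_in[OF K p])
  obtain E where E: "E \<ge> 0" "\<And>f. f \<in> ?K \<Longrightarrow> L2_norm circle (T f) \<le> E * L2_norm circle f"
    using bounded_operator_bound[OF Tb] by blast
  define T' where "T' f = (\<lambda>z. 1 * T (S f) z + c f * q z)" for f
  have T'b: "bounded_operator circle ?K circle ?K T'"
    unfolding bounded_operator_def T'_def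
  proof (intro conjI ballI allI exI)
    show "(\<lambda>z. 1 * T (S f) z + c f * q z) \<in> ?K" if "f \<in> ?K" for f
      by (rule L2_subspace_lincomb[OF KS TK[OF that] q])
    show "AE x in circle. 1 * T (S (\<lambda>y. a * f y + b * g y)) x + c (\<lambda>y. a * f y + b * g y) * q x
        = a * (1 * T (S f) x + c f * q x) + b * (1 * T (S g) x + c g * q x)" if fg: "f \<in> ?K" "g \<in> ?K" for f g a b
      unfolding S_lin[OF fg] c_lin[OF fg]
      using bounded_operatorD(2)[OF Tb S[OF fg(1)] S[OF fg(2)], of a b]
      by eventually_elim (simp add: algebra_simps)
    show "L2_norm circle (\<lambda>z. 1 * T (S f) z + c f * q z) \<le> (E * C + D * L2_norm circle q) * L2_norm circle f"
      if f: "f \<in> ?K" for f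
    proof -
      have "L2_norm circle (\<lambda>z. 1 * T (S f) z + c f * q z)
          \<le> cmod 1 * L2_norm circle (T (S f)) + cmod (c f) * L2_norm circle q"
        by (rule L2_norm_lincomb_le[OF model_space_L2[OF TK[OF f]] model_space_L2[OF q]])
      also have "\<dots> \<le> E * (C * L2_norm circle f) + (D * L2_norm circle f) * L2_norm circle q"
        using order_trans[OF E(2)[OF S[OF f]] mult_left_mono[OF S_bd[OF f] E(1)]]
        by (intro add_mono mult_right_mono c_bd f) auto
      finally show ?thesis by (simp add: algebra_simps)
    qed
  qed
  have "tto_extension \<Theta> \<phi>' T'"
  proof (rule tto_extensionI[OF \<Theta> \<phi>' T'b])
    fix f k assume f: "f \<in> ?K" "f \<in> hardy_inf" and k: "k \<in> ?K"
    have \<phi>S: "(\<lambda>z. \<phi> z * S f z) \<in> L2 circle"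
      by (rule L2_mult_hardy_inf[OF \<phi> S_inf[OF f]])
    have "L2_inner circle (T' f) k = 1 * L2_inner circle (T (S f)) k + c f * L2_inner circle q k"
      unfolding T'_def
      by (rule L2_inner_lincomb_left[OF model_space_L2[OF TK[OF f(1)]] model_space_L2[OF q] model_space_L2[OF k]])
    also have "L2_inner circle (T (S f)) k = L2_inner circle (\<lambda>z. \<phi> z * S f z) k"
      by (rule tto_extension_inner[OF \<Theta> \<phi> T S[OF f(1)] S_inf[OF f] k])
    also have "L2_inner circle q k = L2_inner circle p k"
      unfolding q_def by (rule circle.L2_inner_proj[OF K p k])
    also have "1 * L2_inner circle (\<lambda>z. \<phi> z * S f z) k + c f * L2_inner circle p k
        = L2_inner circle (\<lambda>z. 1 * (\<phi> z * S f z) + c f * p z) k"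
      by (rule L2_inner_lincomb_left[OF \<phi>S p model_space_L2[OF k], symmetric])
    also have "\<dots> = L2_inner circle (\<lambda>z. \<phi>' z * f z) k"
    proof (rule L2_inner_cong_AE[OF L2_lincomb[OF \<phi>S p] L2_mult_hardy_inf[OF \<phi>' f(2)] model_space_L2[OF k] model_space_L2[OF k]])
      show "AE z in circle. 1 * (\<phi> z * S f z) + c f * p z = \<phi>' z * f z"
        using eq[OF f(1)] by eventually_elim simp
    qed simp
    finally show "L2_inner circle (T' f) k = L2_inner circle (\<lambda>z. \<phi>' z * f z) k" .
  qed
  then show ?thesis unfolding tto_bounded_def by (intro exI)
qed

section \<open>Multiplying the symbol by integer powers of \<open>z\<close>\<close>

lemma AE_circle_powi: "AE z in circle. cmod (z powi n) = 1"
  using AE_circle_norm by eventually_elim (rule powi_unimodular(1))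

lemma L2_norm_mult_powi: "f \<in> L2 circle \<Longrightarrow> L2_norm circle (\<lambda>z. f z * z powi n) = L2_norm circle f"
  by (rule L2_norm_mult_unimodular[OF _ _ AE_circle_powi]) measurable

text \<open>The function \<open>z f\<close> is orthogonal to \<open>\<Theta> z\<^sup>n\<close> for
  \<open>n \<ge> 1\<close>, so removing its component along \<open>\<Theta>\<close> gives the
  compressed shift \<open>S f\<close>. Then \<open>\<phi> z f\<close> differs from
  \<open>\<phi> S f\<close> by the rank-one term \<open>c f\<close> times
  \<open>\<phi> \<Theta>\<close>.\<close>

lemma tto_bounded_shift:
  assumes \<Theta>: "inner_function \<Theta>" and \<phi>: "\<phi> \<in> L2 circle" and bdd: "tto_bounded \<Theta> \<phi>"
  shows "tto_bounded \<Theta> (\<lambda>z. \<phi> z * z powi 1)"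
proof -
  let ?K = "model_space \<Theta>"
  note \<Theta>D = inner_functionD[OF \<Theta>]
  define c where "c f = L2_inner circle (\<lambda>z. f z * z powi 1) \<Theta>" for f
  define S where "S f = (\<lambda>z. 1 * (f z * z powi 1) + (- c f) * \<Theta> z)" for f
  have zf: "(\<lambda>z. f z * z powi 1) \<in> hardy2" if "f \<in> ?K" for f
    using hardy2_mult_power[OF model_space_hardy2[OF that], of 1] by simp
  have S2: "S f \<in> hardy2" if "f \<in> ?K" for f
    unfolding S_def by (rule L2_subspace_lincomb[OF hardy2_subspace zf[OF that] \<Theta>D(2)])
  have SK: "S f \<in> ?K" if f: "f \<in> ?K" for f
  proof (rule model_spaceI[OF \<Theta> S2[OF f]])
    fix n
    have \<Theta>n: "(\<lambda>z. \<Theta> z * z ^ n) \<in> L2 circle"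
      by (rule hardy2_L2[OF hardy2_mult_power[OF \<Theta>D(2)]])
    have "L2_inner circle (\<lambda>z. f z * z powi 1) (\<lambda>z. \<Theta> z * z ^ n) = c f * of_bool (n = 0)"
    proof (cases n)
      case 0
      then show ?thesis by (simp add: c_def)
    next
      case (Suc m)
      have [measurable]: "f \<in> borel_measurable borel"
        using L2_D(1)[OF model_space_L2[OF f]] by simp
      note [measurable] = \<Theta>D(4)
      have "L2_inner circle (\<lambda>z. f z * z powi 1) (\<lambda>z. \<Theta> z * z ^ n) = L2_inner circle f (\<lambda>z. \<Theta> z * z ^ m)"
        unfolding L2_inner_def
      proof (rule integral_cong_AE)
        show "AE z in circle. f z * z powi 1 * cnj (\<Theta> z * z ^ n) = f z * cnj (\<Theta> z * z ^ m)"
          using AE_circle_norm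
        proof eventually_elim
          case (elim z)
          have "f z * z powi 1 * cnj (\<Theta> z * z ^ n) = (z * cnj z) * (f z * cnj (\<Theta> z * z ^ m))"
            by (simp add: Suc mult_ac)
          then show ?case by (simp only: unimodular_mult_cnj[OF elim] mult_1)
        qed
      qed measurable
      also have "\<dots> = 0" by (rule model_space_inner_mult_zero(1)[OF f power_hardy2])
      finally show ?thesis by (simp add: Suc)
    qed
    moreover have "L2_inner circle \<Theta> (\<lambda>z. \<Theta> z * z ^ n) = of_bool (n = 0)"
      using L2_inner_inner_function_mult[OF \<Theta> powi_L2[of 0] powi_L2[of "int n"]]
        L2_inner_powi[of 0 "int n"] by simp
    ultimately show "L2_inner circle (S f) (\<lambda>z. \<Theta> z * z ^ n) = 0"
      unfolding S_def L2_inner_lincomb_left[OF hardy2_L2[OF zf[OF f]] \<Theta>D(3) \<Theta>n] by simp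
  qed
  have c_bd: "cmod (c f) \<le> 1 * L2_norm circle f" if f: "f \<in> ?K" for f
    using L2_Cauchy_Schwarz[OF hardy2_L2[OF zf[OF f]] \<Theta>D(3)] L2_norm_mult_powi[OF model_space_L2[OF f], of 1]
    by (simp add: c_def L2_norm_inner_function[OF \<Theta>])
  have c_lin: "c (\<lambda>z. a * f z + b * g z) = a * c f + b * c g" if f: "f \<in> ?K" and g: "g \<in> ?K" for f g a b
    using L2_inner_lincomb_left[OF hardy2_L2[OF zf[OF f]] hardy2_L2[OF zf[OF g]] \<Theta>D(3), of a b]
    by (simp add: c_def distrib_right mult.assoc)
  show ?thesis
  proof (rule tto_bounded_perturb[OF \<Theta> \<phi> _ _ bdd SK _ _ _ c_lin c_bd])
    show "(\<lambda>z. \<phi> z * z powi 1) \<in> L2 circle" by (rule L2_mult_powi[OF \<phi>])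
    show "(\<lambda>z. \<phi> z * \<Theta> z) \<in> L2 circle" by (rule L2_mult_hardy_inf[OF \<phi> \<Theta>D(1)])
    show "S f \<in> hardy_inf" if "f \<in> ?K" "f \<in> hardy_inf" for f
      unfolding S_def
      using hardy_inf_lincomb[OF hardy_inf_mult[OF that(2) power_hardy_inf[of 1]] \<Theta>D(1), of 1 "- c f"] by simp
    show "S (\<lambda>z. a * f z + b * g z) = (\<lambda>z. a * S f z + b * S g z)" if "f \<in> ?K" "g \<in> ?K" for f g a b
      unfolding S_def c_lin[OF that] by (auto simp: algebra_simps)
    show "L2_norm circle (S f) \<le> 2 * L2_norm circle f" if f: "f \<in> ?K" for f
      using L2_norm_lincomb_le[OF hardy2_L2[OF zf[OF f]] \<Theta>D(3), of 1 "- c f"] c_bd[OF f]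
        L2_norm_mult_powi[OF model_space_L2[OF f], of 1]
      by (simp add: S_def L2_norm_inner_function[OF \<Theta>])
    show "AE z in circle. \<phi> z * z powi 1 * f z = \<phi> z * S f z + c f * (\<phi> z * \<Theta> z)" for f
      by (intro always_eventually allI) (simp add: S_def algebra_simps)
  qed
qed

text \<open>Removing the mean of \<open>f\<close> before dividing by \<open>z\<close> keeps the
  result analytic; this is the backward shift, which preserves the model space. The mean contributes
  a multiple of the new symbol itself.\<close>

lemma tto_bounded_backward_shift:
  assumes \<Theta>: "inner_function \<Theta>" and \<phi>: "\<phi> \<in> L2 circle" and bdd: "tto_bounded \<Theta> \<phi>"
  shows "tto_bounded \<Theta> (\<lambda>z. \<phi> z * z powi (-1))"
proof -
  let ?K = "model_space \<Theta>"
  note \<Theta>D = inner_functionD[OF \<Theta>]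
  have one: "(\<lambda>z. 1) \<in> hardy2" "(\<lambda>z. 1) \<in> L2 circle" "L2_norm circle (\<lambda>z. 1) = 1"
    using power_hardy2[of 0] hardy2_L2[OF power_hardy2[of 0]] by (simp_all add: L2_norm_def circle.prob_space)
  define c where "c f = L2_inner circle f (\<lambda>z. 1)" for f
  have c_coeff: "c f = fourier_coeff f 0" if "f \<in> ?K" for f
    using fourier_coeff_inner[OF model_space_L2[OF that], of 0] by (simp add: c_def)
  define S where "S f = (\<lambda>z. (1 * f z + (- c f) * 1) * z powi (-1))" for f
  have f0: "(\<lambda>z. 1 * f z + (- c f) * 1) \<in> hardy2" if "f \<in> ?K" for f
    by (rule L2_subspace_lincomb[OF hardy2_subspace model_space_hardy2[OF that] one(1)])
  have SL: "S f \<in> L2 circle" if "f \<in> ?K" for f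
    unfolding S_def by (rule L2_mult_powi[OF hardy2_L2[OF f0[OF that]]])
  have S2: "S f \<in> hardy2" if f: "f \<in> ?K" for f
  proof -
    have [measurable]: "f \<in> borel_measurable borel"
      using L2_D(1)[OF model_space_L2[OF f]] by simp
    have "fourier_coeff (S f) n = fourier_coeff (\<lambda>z. 1 * f z + (- c f) * 1) (n - (-1))" for n
      unfolding S_def by (rule fourier_coeff_mult_powi) measurable
    moreover have "fourier_coeff (\<lambda>z. 1 * f z + (- c f) * 1) (n - (-1)) = 0" if "n < 0" for n
    proof (cases "n = -1")
      case True
      have "fourier_coeff (\<lambda>z. 1 * f z + (- c f) * 1) 0 = L2_inner circle (\<lambda>z. 1 * f z + (- c f) * 1) (\<lambda>z. 1)"
        using fourier_coeff_inner[OF hardy2_L2[OF f0[OF f]], of 0] by simp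
      also have "\<dots> = 1 * L2_inner circle f (\<lambda>z. 1) + (- c f) * L2_inner circle (\<lambda>z. 1) (\<lambda>z. 1)"
        by (rule L2_inner_lincomb_left[OF model_space_L2[OF f] one(2) one(2)])
      also have "\<dots> = 0" by (simp add: c_def L2_inner_self one(3))
      finally show ?thesis using True by simp
    next
      case False
      then show ?thesis using that f0[OF f] by (simp add: hardy2_def)
    qed
    ultimately show ?thesis using SL[OF f] by (simp add: hardy2_def)
  qed
  have SK: "S f \<in> ?K" if f: "f \<in> ?K" for f
  proof (rule model_spaceI[OF \<Theta> S2[OF f]])
    fix n :: nat
    have \<Theta>n: "(\<lambda>z. \<Theta> z * z ^ Suc n) \<in> hardy2"
      by (rule hardy2_mult_power[OF \<Theta>D(2)])
    have [measurable]: "f \<in> borel_measurable borel"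
      using L2_D(1)[OF model_space_L2[OF f]] by simp
    note [measurable] = \<Theta>D(4)
    have "L2_inner circle (S f) (\<lambda>z. \<Theta> z * z ^ n)
        = L2_inner circle (\<lambda>z. 1 * f z + (- c f) * 1) (\<lambda>z. \<Theta> z * z ^ Suc n)"
      unfolding L2_inner_def S_def
    proof (rule integral_cong_AE)
      show "AE z in circle. (1 * f z + (- c f) * 1) * z powi (-1) * cnj (\<Theta> z * z ^ n)
          = (1 * f z + (- c f) * 1) * cnj (\<Theta> z * z ^ Suc n)"
        using AE_circle_norm
      proof eventually_elim
        case (elim z)
        have "z powi (-1) = cnj z"
          using powi_unimodular(2)[OF elim] by (simp add: power_int_minus)
        then show ?case by (simp only: power_Suc complex_cnj_mult mult_ac)
      qed
    qed measurable
    also have "\<dots> = 1 * L2_inner circle f (\<lambda>z. \<Theta> z * z ^ Suc n)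
        + (- c f) * L2_inner circle (\<lambda>z. 1) (\<lambda>z. \<Theta> z * z ^ Suc n)"
      by (rule L2_inner_lincomb_left[OF model_space_L2[OF f] one(2) hardy2_L2[OF \<Theta>n]])
    also have "L2_inner circle f (\<lambda>z. \<Theta> z * z ^ Suc n) = 0"
      by (rule model_space_inner_mult_zero(1)[OF f power_hardy2])
    also have "L2_inner circle (\<lambda>z. 1) (\<lambda>z. \<Theta> z * z ^ Suc n) = cnj (fourier_coeff (\<lambda>z. \<Theta> z * z ^ Suc n) 0)"
      using fourier_coeff_inner[OF hardy2_L2[OF \<Theta>n], of 0]
      unfolding L2_inner_commute[of circle "\<lambda>z. 1" "\<lambda>z. \<Theta> z * z ^ Suc n"] by simp
    also have "fourier_coeff (\<lambda>z. \<Theta> z * z ^ Suc n) 0 = 0"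
      using fourier_coeff_mult_powi[OF \<Theta>D(4), of "int (Suc n)" 0] \<Theta>D(2)
      unfolding power_int_of_nat by (simp add: hardy2_def)
    finally show "L2_inner circle (S f) (\<lambda>z. \<Theta> z * z ^ n) = 0" by simp
  qed
  have c_bd: "cmod (c f) \<le> 1 * L2_norm circle f" if f: "f \<in> ?K" for f
    using L2_Cauchy_Schwarz[OF model_space_L2[OF f] one(2)] by (simp add: c_def one(3))
  have c_lin: "c (\<lambda>z. a * f z + b * g z) = a * c f + b * c g" if f: "f \<in> ?K" and g: "g \<in> ?K" for f g a b
    unfolding c_def by (rule L2_inner_lincomb_left[OF model_space_L2[OF f] model_space_L2[OF g] one(2)])
  show ?thesis
  proof (rule tto_bounded_perturb[OF \<Theta> \<phi> _ _ bdd SK _ _ _ c_lin c_bd])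
    show "(\<lambda>z. \<phi> z * z powi (-1)) \<in> L2 circle" "(\<lambda>z. \<phi> z * z powi (-1)) \<in> L2 circle"
      by (rule L2_mult_powi[OF \<phi>])+
    show "S f \<in> hardy_inf" if f: "f \<in> ?K" "f \<in> hardy_inf" for f
    proof -
      obtain C where C: "AE z in circle. cmod (1 * f z + (- c f) * 1) \<le> C"
        using hardy_infE[OF hardy_inf_lincomb[OF f(2) const_hardy_inf[of 1], of 1 "- c f"]] by blast
      have "AE z in circle. cmod (S f z) \<le> C"
        using C AE_circle_powi[of "-1"]
        by eventually_elim (simp only: S_def norm_mult mult_1_right)
      with S2[OF f(1)] show ?thesis by (auto simp: hardy_inf_def)
    qed
    show "S (\<lambda>z. a * f z + b * g z) = (\<lambda>z. a * S f z + b * S g z)" if "f \<in> ?K" "g \<in> ?K" for f g a b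
      unfolding S_def c_lin[OF that] by (auto simp: algebra_simps)
    show "L2_norm circle (S f) \<le> 2 * L2_norm circle f" if f: "f \<in> ?K" for f
      using L2_norm_lincomb_le[OF model_space_L2[OF f] one(2), of 1 "- c f"] c_bd[OF f]
        L2_norm_mult_powi[OF hardy2_L2[OF f0[OF f]], of "-1"]
      by (simp add: S_def one(3))
    show "AE z in circle. \<phi> z * z powi (-1) * f z = \<phi> z * S f z + c f * (\<phi> z * z powi (-1))" for f
      by (intro always_eventually allI) (simp add: S_def algebra_simps)
  qed
qed

lemma tto_bounded_cong_AE:
  assumes \<Theta>: "inner_function \<Theta>" and \<phi>: "\<phi> \<in> L2 circle" and \<phi>': "\<phi>' \<in> L2 circle"
    and eq: "AE z in circle. \<phi> z = \<phi>' z" and bdd: "tto_bounded \<Theta> \<phi>"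
  shows "tto_bounded \<Theta> \<phi>'"
proof -
  have T: "tto_extension \<Theta> \<phi> (tto \<Theta> \<phi>)" by (rule tto_extension_tto[OF bdd])
  then have "bounded_operator circle (model_space \<Theta>) circle (model_space \<Theta>) (tto \<Theta> \<phi>)"
    by (simp add: tto_extension_def)
  then have "tto_extension \<Theta> \<phi>' (tto \<Theta> \<phi>)"
  proof (rule tto_extensionI[OF \<Theta> \<phi>'])
    fix f k assume f: "f \<in> model_space \<Theta>" "f \<in> hardy_inf" and k: "k \<in> model_space \<Theta>"
    have "L2_inner circle (\<lambda>z. \<phi> z * f z) k = L2_inner circle (\<lambda>z. \<phi>' z * f z) k"
    proof (rule L2_inner_cong_AE[OF L2_mult_hardy_inf[OF \<phi> f(2)] L2_mult_hardy_inf[OF \<phi>' f(2)]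
          model_space_L2[OF k] model_space_L2[OF k]])
      show "AE z in circle. \<phi> z * f z = \<phi>' z * f z"
        using eq by eventually_elim simp
    qed simp
    then show "L2_inner circle (tto \<Theta> \<phi> f) k = L2_inner circle (\<lambda>z. \<phi>' z * f z) k"
      using tto_extension_inner[OF \<Theta> \<phi> T f k] by simp
  qed
  then show ?thesis unfolding tto_bounded_def by (intro exI)
qed

lemma tto_bounded_mult_powi:
  assumes \<Theta>: "inner_function \<Theta>" and \<phi>: "\<phi> \<in> L2 circle" and bdd: "tto_bounded \<Theta> \<phi>"
  shows "tto_bounded \<Theta> (\<lambda>z. \<phi> z * z powi j)"
proof -
  \<comment> \<open>Exponents of \<open>powi\<close> add only away from 0, so the two symbols agree
    almost everywhere rather than as functions.\<close>
  have step: "tto_bounded \<Theta> (\<lambda>z. \<phi> z * z powi (i + s))"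
    if "tto_bounded \<Theta> (\<lambda>z. \<phi> z * z powi i)" "tto_bounded \<Theta> (\<lambda>z. \<phi> z * z powi i * z powi s)" for i s
  proof (rule tto_bounded_cong_AE[OF \<Theta> L2_mult_powi[OF L2_mult_powi[OF \<phi>]] L2_mult_powi[OF \<phi>] _ that(2)])
    show "AE z in circle. \<phi> z * z powi i * z powi s = \<phi> z * z powi (i + s)"
      using AE_circle_nonzero by eventually_elim (simp add: power_int_add)
  qed
  show ?thesis
  proof (induction j rule: int_induct[where k = 0])
    case base
    show ?case using bdd by simp
  next
    case (step1 i)
    show ?case
      by (rule step[OF step1(2) tto_bounded_shift[OF \<Theta> L2_mult_powi[OF \<phi>] step1(2)]])
  next
    case (step2 i)
    show ?case
      using step[OF step2(2) tto_bounded_backward_shift[OF \<Theta> L2_mult_powi[OF \<phi>] step2(2)]] by simp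
  qed
qed

text \<open>Both sides are bounded functionals of \<open>v\<close>, the left one because composition
  with \<open>B\<close> is bounded, so it suffices to take \<open>v = z\<^sup>n\<close>. Then only
  \<open>j = - n\<close> can contribute on the right, and its coefficient is the left side.\<close>

lemma integral_mult_compose_expand:
  assumes B: "inner_function B" and nc: "nonconstant B" and u: "u \<in> L2 circle" and v: "v \<in> L2 circle"
    and J: "finite J" and zero: "\<And>j::int. j \<notin> J \<Longrightarrow> (LINT z|circle. cnj (B z) powi j * u z) = 0"
  shows "(LINT z|circle. u z * v (B z))
    = (\<Sum>j\<in>J. (LINT z|circle. cnj (B z) powi j * u z) * (LINT z|circle. z powi j * v z))"
proof -
  note BD = inner_functionD[OF B]
  note [measurable] = BD(4)
  have [measurable]: "u \<in> borel_measurable borel"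
    using L2_D(1)[OF u] by simp
  define s where "s j = (LINT z|circle. cnj (B z) powi j * u z)" for j
  \<comment> \<open>Conjugated powers, so that integrals of \<open>z powi j * f z\<close> become
    inner products of \<open>f\<close> with \<open>w j\<close>.\<close>
  define w where "w j = (\<lambda>z. cnj (z powi j))" for j :: int
  have w: "w j \<in> L2 circle" for j
    unfolding w_def by (rule L2_cnj[OF powi_L2])
  have cu: "(\<lambda>z. cnj (u z)) \<in> L2 circle" by (rule L2_cnj[OF u])
  obtain C where comp: "\<And>f. f \<in> L2 circle \<Longrightarrow> (\<lambda>z. f (B z)) \<in> L2 circle"
    "\<And>f. f \<in> L2 circle \<Longrightarrow> L2_norm circle (\<lambda>z. f (B z)) \<le> C * L2_norm circle f"
    using compose_L2[OF B nc] by blast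
  define \<Lambda> where "\<Lambda> f = L2_inner circle (\<lambda>z. f (B z)) (\<lambda>z. cnj (u z)) - (\<Sum>j\<in>J. s j * L2_inner circle f (w j))" for f
  have "\<Lambda> v = 0"
  proof (rule functional_eq_0[OF L2_subspace_UNIV, where G = "range (\<lambda>(n::int) z. z powi n)" and \<Lambda> = \<Lambda>
        and C = "C * L2_norm circle (\<lambda>z. cnj (u z)) + (\<Sum>j\<in>J. cmod (s j) * L2_norm circle (w j))"])
    show "range (\<lambda>(n::int) z. z powi n) \<subseteq> L2 circle" by (auto simp: powi_L2)
    show "L2 circle \<subseteq> L2_closure circle trig_polynomials" by (simp add: L2_closure_trig)
    show "\<Lambda> (\<lambda>x. f x + c * g x) = \<Lambda> f + c * \<Lambda> g" if f: "f \<in> L2 circle" and g: "g \<in> L2 circle" for f g c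
    proof -
      have "L2_inner circle (\<lambda>x. f x + c * g x) (w j) = L2_inner circle f (w j) + c * L2_inner circle g (w j)" for j
        using L2_inner_lincomb_left[OF f g w, of 1 c] by simp
      then show ?thesis
        using L2_inner_lincomb_left[OF comp(1)[OF f] comp(1)[OF g] cu, of 1 c]
        by (simp add: \<Lambda>_def algebra_simps sum.distrib sum_distrib_left)
    qed
    show "cmod (\<Lambda> f) \<le> (C * L2_norm circle (\<lambda>z. cnj (u z)) + (\<Sum>j\<in>J. cmod (s j) * L2_norm circle (w j))) * L2_norm circle f"
      if f: "f \<in> L2 circle" for f
    proof -
      have "cmod (L2_inner circle (\<lambda>z. f (B z)) (\<lambda>z. cnj (u z))) \<le> (C * L2_norm circle f) * L2_norm circle (\<lambda>z. cnj (u z))"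
        by (rule order_trans[OF L2_Cauchy_Schwarz[OF comp(1)[OF f] cu] mult_right_mono[OF comp(2)[OF f]]]) simp
      moreover have "cmod (\<Sum>j\<in>J. s j * L2_inner circle f (w j)) \<le> (\<Sum>j\<in>J. cmod (s j) * (L2_norm circle f * L2_norm circle (w j)))"
        by (rule order_trans[OF norm_sum sum_mono])
           (simp add: norm_mult mult_left_mono L2_Cauchy_Schwarz[OF f w])
      ultimately have "cmod (\<Lambda> f) \<le> (C * L2_norm circle f) * L2_norm circle (\<lambda>z. cnj (u z))
          + (\<Sum>j\<in>J. cmod (s j) * (L2_norm circle f * L2_norm circle (w j)))"
        unfolding \<Lambda>_def by (rule norm_triangle_le_diff[OF add_mono])
      then show ?thesis
        by (simp add: distrib_left sum_distrib_left mult_ac)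
    qed
    show "\<Lambda> g = 0" if gr: "g \<in> range (\<lambda>(n::int) z. z powi n)" for g
    proof -
      obtain n :: int where g: "g = (\<lambda>z. z powi n)" using gr by auto
      have "L2_inner circle (\<lambda>z. g (B z)) (\<lambda>z. cnj (u z)) = s (- n)"
        unfolding s_def L2_inner_def g
      proof (rule integral_cong_AE)
        show "AE z in circle. B z powi n * cnj (cnj (u z)) = cnj (B z) powi (- n) * u z"
          using BD(5)
        proof eventually_elim
          case (elim z)
          have "cnj (B z) powi (- n) = B z powi n"
            using powi_unimodular(4)[OF elim, of "- n"] by simp
          then show ?case by simp
        qed
      qed measurable
      moreover have "L2_inner circle g (w j) = of_bool (j = - n)" for j
      proof -
        have "L2_inner circle g (w j) = L2_inner circle (\<lambda>z. z powi n) (\<lambda>z. z powi (- j))"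
        proof (rule L2_inner_cong_AE)
          show "AE z in circle. w j z = z powi (- j)"
            using AE_circle_norm by eventually_elim (simp only: w_def powi_unimodular(4))
        qed (auto simp: g w powi_L2)
        then show ?thesis by (simp add: L2_inner_powi eq_commute minus_equation_iff)
      qed
      \<comment> \<open>When \<open>- n\<close> is outside \<open>J\<close> the sum is empty of it
        and \<open>s (- n)\<close> is 0 by \<open>zero\<close>; this accounts for the indices left
        out of \<open>J\<close>.\<close>
      moreover have "(\<Sum>j\<in>J. s j * of_bool (j = - n)) = s (- n)"
        using zero[of "- n"] J by (cases "- n \<in> J") (auto simp: s_def of_bool_def if_distrib cong: if_cong)
      ultimately show ?thesis by (simp add: \<Lambda>_def)
    qed
  qed (rule v)
  moreover have "L2_inner circle v (w j) = (LINT z|circle. z powi j * v z)" for j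
    by (simp add: L2_inner_def w_def mult.commute)
  ultimately show ?thesis
    by (simp add: \<Lambda>_def s_def L2_inner_def mult.commute)
qed

section \<open>The operator identity\<close>

lemma L2_inner_mult_left_cnj:
  "L2_inner M (\<lambda>z. p z * f z) g = L2_inner M f (\<lambda>z. cnj (p z) * g z)"
  by (simp add: L2_inner_def mult_ac)

theorem theorem3p2:
  fixes B \<Theta> \<psi> \<phi> :: "complex \<Rightarrow> complex"
  defines "J \<equiv> {j::int. tto_nonzero B (\<lambda>z. cnj (B z) powi j * \<psi> z)}"
  assumes "inner_function B" and "nonconstant B" and "inner_function \<Theta>"
    and "\<psi> \<in> L2 circle" and "\<phi> \<in> L2 circle"
    and a_bounded: "\<And>j::int. tto_bounded B (\<lambda>z. cnj (B z) powi j * \<psi> z)"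
    and a_finite: "finite J"
    and b: "tto_bounded \<Theta> \<phi>"
    and c: "(\<lambda>z. \<psi> z * (\<phi> \<circ> B) z) \<in> L2 circle"
  shows "tto_bounded (\<Theta> \<circ> B) (\<lambda>z. \<psi> z * (\<phi> \<circ> B) z) \<and>
    (\<forall>F \<in> tensor_space (model_space B) (model_space \<Theta>).
       AE z in circle.
         tto (\<Theta> \<circ> B) (\<lambda>z. \<psi> z * (\<phi> \<circ> B) z) (omega B \<Theta> F) z =
         omega B \<Theta> (\<lambda>p. \<Sum>j\<in>J. tensor_operator (model_space B) (model_space \<Theta>)
             (tto B (\<lambda>z. cnj (B z) powi j * \<psi> z))
             (tto \<Theta> (\<lambda>z. z powi j * \<phi> z)) F p) z)"
proof -
  note B = assms(2) and nc = assms(3) and \<Theta> = assms(4) and \<psi> = assms(5) and \<phi> = assms(6)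
  note BD = inner_functionD[OF B]
  note \<Theta>B = inner_function_compose[OF B nc \<Theta>]
  let ?K = "model_space B" and ?L = "model_space \<Theta>" and ?M = "model_space (\<Theta> \<circ> B)"
  let ?\<Phi> = "\<lambda>z. \<psi> z * (\<phi> \<circ> B) z" and ?W = "Omega B"
  let ?TS = "tensor_space ?K ?L" and ?TS' = "tensor_space ?K (L2 circle)"
  define S where "S j = tto B (\<lambda>z. cnj (B z) powi j * \<psi> z)" for j :: int
  define T where "T j = tto \<Theta> (\<lambda>z. z powi j * \<phi> z)" for j :: int
  define R where "R = (\<lambda>F p. \<Sum>j\<in>J. tensor_operator ?K ?L (S j) (T j) F p)"
  \<comment> \<open>\<open>P\<close> is the graph of \<open>\<omega> R \<omega>\<^sup>-\<^sup>1\<close>; \<open>A\<close> below is its closure.\<close>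
  define P where "P = {(x, y). x \<in> ?M \<and> y \<in> ?M \<and> (\<exists>F\<in>?TS. (AE z in circle. x z = ?W F z) \<and> (AE z in circle. y z = ?W (R F) z))}"
  define G where "G = {\<lambda>z. model_power B m z * model_power \<Theta> n (B z) | m n. True}"
  note K = closed_L2_subspaceD[OF closed_L2_subspace_model_space[OF B]]
  note L = closed_L2_subspaceD[OF closed_L2_subspace_model_space[OF \<Theta>]]
  note Mc = closed_L2_subspace_model_space[OF \<Theta>B]
  note M = closed_L2_subspaceD[OF Mc]
  note TS = closed_L2_subspaceD[OF closed_L2_subspace_tensor_space[OF K L]]
  note TS' = closed_L2_subspaceD[OF closed_L2_subspace_tensor_space[OF K L2_subspace_UNIV]]
  note W = bounded_operator_Omega[OF B]
  note kB = model_power_in_model_space[OF B] and k\<Theta> = model_power_in_model_space[OF \<Theta>]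

  have \<psi>j: "(\<lambda>z. cnj (B z) powi j * \<psi> z) \<in> L2 circle" for j :: int
  proof -
    have "(\<lambda>z. \<psi> z * cnj (B z) powi j) \<in> L2 circle"
    proof (rule L2_mult_bounded[OF \<psi>])
      show "(\<lambda>z. cnj (B z) powi j) \<in> borel_measurable circle"
        using BD(4) by measurable
      show "AE z in circle. cmod (cnj (B z) powi j) \<le> 1"
        using BD(5) by eventually_elim (simp add: powi_unimodular(1))
    qed
    then show ?thesis by (simp add: mult.commute)
  qed
  have \<phi>j: "(\<lambda>z. z powi j * \<phi> z) \<in> L2 circle" for j
    using L2_mult_powi[OF \<phi>, of j] by (simp add: mult.commute)
  have S: "tto_extension B (\<lambda>z. cnj (B z) powi j * \<psi> z) (S j)" for j
    unfolding S_def by (rule tto_extension_tto[OF a_bounded])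
  have T: "tto_extension \<Theta> (\<lambda>z. z powi j * \<phi> z) (T j)" for j
    unfolding T_def using tto_extension_tto[OF tto_bounded_mult_powi[OF \<Theta> \<phi> b, of j]]
    by (simp add: mult.commute)
  have Sb: "bounded_operator circle ?K circle ?K (S j)" and Tb: "bounded_operator circle ?L circle ?L (T j)" for j
    using S[of j] T[of j] by (simp_all add: tto_extension_def)
  note SK = bounded_operatorD(1)[OF Sb] and TL = bounded_operatorD(1)[OF Tb]
  have Rb: "bounded_operator torus ?TS torus ?TS R"
    unfolding R_def by (rule bounded_operator_sum[OF TS TS a_finite tensor_operator(1)[OF Sb K Tb L]])
  note RTS = bounded_operatorD(1)[OF Rb]

  \<comment> \<open>\<open>Omega B\<close> is given on the tensor product with all of
    \<open>L2\<close>; this inclusion makes its properties available on \<open>?TS\<close>.\<close>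
  have TS_sub: "F \<in> ?TS'" if F: "F \<in> ?TS" for F
  proof -
    have "elementary_tensors ?K ?L \<subseteq> elementary_tensors ?K (L2 circle)"
      using model_space_L2 by blast
    from subsetD[OF L2_closure_mono[OF lspan_mono[OF this]]] F
    show ?thesis unfolding tensor_space_eq[OF K] .
  qed
  \<comment> \<open>Elementary tensors go to products \<open>h (f \<circ> B)\<close>, which lie in
    the model space; since that space is closed, the whole tensor product is mapped into it.\<close>
  have WM: "?W F \<in> ?M" if F: "F \<in> ?TS" for F
  proof (rule bounded_operator_closure_range[OF W TS' L2_subspace_UNIV Mc])
    show "F \<in> ?TS'" by (rule TS_sub[OF F])
    show "F \<in> L2_closure torus (lspan (elementary_tensors ?K ?L))"
      using F unfolding tensor_space_eq[OF K] .
    fix g assume "g \<in> elementary_tensors ?K ?L"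
    then obtain h f where g: "g = tensor h f" and h: "h \<in> ?K" and f: "f \<in> ?L" by blast
    have gTS: "tensor h f \<in> ?TS'" by (rule tensor_in_tensor_space[OF K L2_subspace_UNIV h model_space_L2[OF f]])
    have "AE z in circle. h z * f (B z) = ?W (tensor h f) z"
      using Omega_tensor[OF B h model_space_L2[OF f]] by eventually_elim simp
    from closed_L2_subspace_cong_AE[OF Mc mult_compose_in_model_space[OF B nc \<Theta> h f]
        L2_D(1)[OF bounded_operatorD(1)[OF W gTS]] this]
    show "g \<in> ?TS' \<and> ?W g \<in> ?M" using gTS by (simp add: g)
  qed

  have PD: "\<exists>F\<in>?TS. (AE z in circle. x z = ?W F z) \<and> (AE z in circle. y z = ?W (R F) z)" "x \<in> ?M" "y \<in> ?M"
    if "(x, y) \<in> P" for x y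
    using that unfolding P_def by blast+
  have P_lin: "(\<lambda>t. a * x t + b * x' t, \<lambda>t. a * y t + b * y' t) \<in> P"
    if xy: "(x, y) \<in> P" and xy': "(x', y') \<in> P" for x y x' y' a b
  proof -
    obtain F where F: "F \<in> ?TS" "AE z in circle. x z = ?W F z" "AE z in circle. y z = ?W (R F) z"
      using PD(1)[OF xy] by blast
    obtain F' where F': "F' \<in> ?TS" "AE z in circle. x' z = ?W F' z" "AE z in circle. y' z = ?W (R F') z"
      using PD(1)[OF xy'] by blast
    let ?F = "\<lambda>p. a * F p + b * F' p"
    have FTS: "?F \<in> ?TS" by (rule L2_subspace_lincomb[OF TS F(1) F'(1)])
    have 1: "AE z in circle. a * x z + b * x' z = ?W ?F z"
      using bounded_operatorD(2)[OF W TS_sub[OF F(1)] TS_sub[OF F'(1)], of a b] F(2) F'(2)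
      by eventually_elim simp
    have RF: "(\<lambda>p. a * R F p + b * R F' p) \<in> ?TS"
      by (rule L2_subspace_lincomb[OF TS RTS[OF F(1)] RTS[OF F'(1)]])
    have "AE z in circle. ?W (R ?F) z = ?W (\<lambda>p. a * R F p + b * R F' p) z"
      by (rule bounded_operator_cong_AE[OF W TS' L2_subspace_UNIV TS_sub[OF RTS[OF FTS]] TS_sub[OF RF]
            bounded_operatorD(2)[OF Rb F(1) F'(1)]])
    then have 2: "AE z in circle. a * y z + b * y' z = ?W (R ?F) z"
      using bounded_operatorD(2)[OF W TS_sub[OF RTS[OF F(1)]] TS_sub[OF RTS[OF F'(1)]], of a b] F(3) F'(3)
      by eventually_elim simp
    show ?thesis
      unfolding P_def
      using L2_subspace_lincomb[OF M PD(2)[OF xy] PD(2)[OF xy'], of a b]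
        L2_subspace_lincomb[OF M PD(3)[OF xy] PD(3)[OF xy'], of a b] FTS 1 2 by blast
  qed
  have P_W: "(?W F, ?W (R F)) \<in> P" if "F \<in> ?TS" for F
    unfolding P_def using that WM[OF that] WM[OF RTS[OF that]] by blast
  obtain C where C: "C \<ge> 0" "\<And>F. F \<in> ?TS \<Longrightarrow> L2_norm torus (R F) \<le> C * L2_norm torus F"
    using bounded_operator_bound[OF Rb] by blast
  \<comment> \<open>\<open>Omega B\<close> is isometric at both ends, so the bound of
    \<open>R\<close> carries over with the same constant.\<close>
  have P_bd: "L2_norm circle y \<le> C * L2_norm circle x" if xy: "(x, y) \<in> P" for x y
  proof -
    obtain F where F: "F \<in> ?TS" "AE z in circle. x z = ?W F z" "AE z in circle. y z = ?W (R F) z"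
      using PD(1)[OF xy] by blast
    have "L2_norm circle y = L2_norm circle (?W (R F))"
      by (rule L2_norm_cong_AE[OF model_space_L2[OF PD(3)[OF xy]] model_space_L2[OF WM[OF RTS[OF F(1)]]] F(3)])
    moreover have "L2_norm circle x = L2_norm circle (?W F)"
      by (rule L2_norm_cong_AE[OF model_space_L2[OF PD(2)[OF xy]] model_space_L2[OF WM[OF F(1)]] F(2)])
    ultimately show ?thesis
      using C(2)[OF F(1)] L2_norm_Omega[OF B TS_sub[OF F(1)]] L2_norm_Omega[OF B TS_sub[OF RTS[OF F(1)]]]
      by simp
  qed
  \<comment> \<open>\<open>P\<close> is defined up to a.e. equality so that the literal product
    belongs to its domain; the value of \<open>Omega B\<close> at the tensor agrees with it only
    almost everywhere.\<close>
  have gen: "(\<lambda>z. model_power B m z * model_power \<Theta> n (B z),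
      ?W (R (tensor (model_power B m) (model_power \<Theta> n)))) \<in> P" for m n
  proof -
    have F: "tensor (model_power B m) (model_power \<Theta> n) \<in> ?TS"
      by (rule tensor_in_tensor_space[OF K L kB k\<Theta>])
    have "AE z in circle. model_power B m z * model_power \<Theta> n (B z) = ?W (tensor (model_power B m) (model_power \<Theta> n)) z"
      using Omega_tensor[OF B kB model_space_L2[OF k\<Theta>], of m n] by eventually_elim simp
    then show ?thesis
      unfolding P_def using F WM[OF RTS[OF F]] mult_compose_in_model_space[OF B nc \<Theta> kB k\<Theta>] by blast
  qed
  have GM: "G \<subseteq> ?M"
    unfolding G_def using mult_compose_in_model_space[OF B nc \<Theta> kB k\<Theta>] by blast
  have G_dense: "?M \<subseteq> L2_closure circle (lspan G)"
    unfolding G_def L2_closure_mult_compose[OF B nc \<Theta>] by (rule order_refl)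
  have fst_lin: "(\<lambda>x. a * f x + b * g x) \<in> fst ` P" if fg: "f \<in> fst ` P" "g \<in> fst ` P" for f g a b
  proof -
    obtain f' g' where "(f, f') \<in> P" "(g, g') \<in> P" using fg by auto
    from imageI[OF P_lin[OF this, of a b], of fst] show ?thesis by simp
  qed
  have fst_gen: "(\<lambda>z. model_power B m z * model_power \<Theta> n (B z)) \<in> fst ` P" for m n
    using imageI[OF gen, of fst] by simp
  have "(\<lambda>x. 0) \<in> fst ` P"
    using fst_lin[OF fst_gen fst_gen, of 0 0 0 0 0 0] by (simp only: mult_zero_left add_0)
  moreover have "fst ` P \<subseteq> L2 circle" using PD(2) model_space_L2 by force
  ultimately have "L2_subspace circle (fst ` P)"
    unfolding L2_subspace_def using fst_lin by blast
  moreover have "G \<subseteq> fst ` P"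
    unfolding G_def using fst_gen by blast
  ultimately have "lspan G \<subseteq> fst ` P" by (rule lspan_subset)
  then have P_dense: "?M \<subseteq> L2_closure circle (fst ` P)"
    using G_dense L2_closure_mono by blast
  have "P \<subseteq> ?M \<times> ?M" using PD(2,3) by auto
  moreover have "P \<noteq> {}" using gen by blast
  \<comment> \<open>The domain of \<open>P\<close> contains the span of the products, which is
    dense, so \<open>A\<close> is defined on all of the model space.\<close>
  ultimately obtain A where A: "bounded_operator circle ?M circle ?M A"
    and AP: "\<And>x y. (x, y) \<in> P \<Longrightarrow> AE t in circle. A x t = y t"
    using bounded_operator_extension[OF circle.finite_measure_axioms M Mc _ _ P_lin P_bd P_dense] by blast
  note AM = bounded_operatorD(1)[OF A]

  \<comment> \<open>This is the vanishing outside \<open>J\<close> that the finite expansion formula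
    requires.\<close>
  have S_zero: "L2_inner circle (S j h) h' = 0" if "j \<notin> J" and h: "h \<in> ?K" and h': "h' \<in> ?K" for j h h'
  proof -
    have "AE z in circle. S j h z = 0"
      using that unfolding J_def tto_nonzero_def S_def by blast
    then have "L2_inner circle (S j h) h' = L2_inner circle (\<lambda>z. 0) h'"
      by (rule L2_inner_cong_AE[OF model_space_L2[OF SK[OF h]] L2_zero model_space_L2[OF h'] model_space_L2[OF h']]) simp
    then show ?thesis by simp
  qed
  \<comment> \<open>The matrix entries of \<open>A\<close> on products are those of multiplication
    by \<open>?\<Phi>\<close>. All four functions are bounded here, so every product formed below is
    in \<open>L2\<close>.\<close>
  have A_gen: "L2_inner circle (A (\<lambda>z. h z * f (B z))) (\<lambda>z. h' z * f' (B z))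
      = L2_inner circle (\<lambda>z. ?\<Phi> z * (h z * f (B z))) (\<lambda>z. h' z * f' (B z))"
    if hm: "h = model_power B m" "h' = model_power B m'" and fn: "f = model_power \<Theta> n" "f' = model_power \<Theta> n'"
    for h h' f f' m m' n n'
  proof -
    have h: "h \<in> ?K" "h \<in> hardy_inf" and h': "h' \<in> ?K" "h' \<in> hardy_inf"
      and f: "f \<in> ?L" "f \<in> hardy_inf" and f': "f' \<in> ?L" "f' \<in> hardy_inf"
      unfolding hm fn using kB k\<Theta> model_power_hardy_inf[OF B] model_power_hardy_inf[OF \<Theta>] by auto
    have hfTS: "tensor h f \<in> ?TS" by (rule tensor_in_tensor_space[OF K L h(1) f(1)])
    have tTS: "tensor (S j h) (T j f) \<in> ?TS" for j
      by (rule tensor_in_tensor_space[OF K L SK[OF h(1)] TL[OF f(1)]])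
    have sTS: "(\<lambda>p. \<Sum>j\<in>J. tensor (S j h) (T j f) p) \<in> ?TS"
      by (rule L2_subspace_sum[OF TS tTS])
    have "AE p in torus. R (tensor h f) p = (\<Sum>j\<in>J. tensor (S j h) (T j f) p)"
    proof -
      have "AE p in torus. \<forall>j\<in>J. tensor_operator ?K ?L (S j) (T j) (tensor h f) p = tensor (S j h) (T j f) p"
        by (rule AE_finite_allI[OF a_finite tensor_operator(2)[OF Sb K Tb L h(1) f(1)]])
      then show ?thesis by eventually_elim (simp add: R_def)
    qed
    then have "AE z in circle. ?W (R (tensor h f)) z = ?W (\<lambda>p. \<Sum>j\<in>J. tensor (S j h) (T j f) p) z"
      by (rule bounded_operator_cong_AE[OF W TS' L2_subspace_UNIV TS_sub[OF RTS[OF hfTS]] TS_sub[OF sTS]])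
    moreover have "AE z in circle. ?W (\<lambda>p. \<Sum>j\<in>J. tensor (S j h) (T j f) p) z = (\<Sum>j\<in>J. ?W (tensor (S j h) (T j f)) z)"
      by (rule bounded_operator_sum_arg[OF W TS' a_finite TS_sub[OF tTS]])
    moreover have "AE z in circle. \<forall>j\<in>J. ?W (tensor (S j h) (T j f)) z = S j h z * T j f (B z)"
      by (rule AE_finite_allI[OF a_finite Omega_tensor[OF B SK[OF h(1)] model_space_L2[OF TL[OF f(1)]]]])
    moreover have "AE z in circle. A (\<lambda>z. h z * f (B z)) z = ?W (R (tensor h f)) z"
      using AP[OF gen[of m n]] unfolding hm fn .
    ultimately have A_eq: "AE z in circle. A (\<lambda>z. h z * f (B z)) z = (\<Sum>j\<in>J. S j h z * T j f (B z))"
      by eventually_elim simp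
    have hf: "(\<lambda>z. h z * f (B z)) \<in> ?M" and hf': "(\<lambda>z. h' z * f' (B z)) \<in> ?M"
      by (rule mult_compose_in_model_space[OF B nc \<Theta> h(1) f(1)])
         (rule mult_compose_in_model_space[OF B nc \<Theta> h'(1) f'(1)])
    have STL: "(\<lambda>z. S j h z * T j f (B z)) \<in> L2 circle" for j
      by (rule model_space_mult_compose(1)[OF B SK[OF h(1)] model_space_L2[OF TL[OF f(1)]]])
    \<comment> \<open>The double conjugation turns multiplication by a bounded analytic function
      into multiplication by its conjugate.\<close>
    have u: "(\<lambda>z. \<psi> z * h z * cnj (h' z)) \<in> L2 circle"
      using L2_cnj[OF L2_mult_hardy_inf[OF L2_cnj[OF L2_mult_hardy_inf[OF \<psi> h(2)]] h'(2)]] by simp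
    have v: "(\<lambda>z. \<phi> z * f z * cnj (f' z)) \<in> L2 circle"
      using L2_cnj[OF L2_mult_hardy_inf[OF L2_cnj[OF L2_mult_hardy_inf[OF \<phi> f(2)]] f'(2)]] by simp
    have s: "L2_inner circle (S j h) h' = (LINT z|circle. cnj (B z) powi j * (\<psi> z * h z * cnj (h' z)))" for j
      using tto_extension_inner[OF B \<psi>j S h h'(1), of j] by (simp add: L2_inner_def mult.assoc)
    have t: "L2_inner circle (T j f) f' = (LINT z|circle. z powi j * (\<phi> z * f z * cnj (f' z)))" for j
      using tto_extension_inner[OF \<Theta> \<phi>j T f f'(1), of j] by (simp add: L2_inner_def mult.assoc)
    have "L2_inner circle (A (\<lambda>z. h z * f (B z))) (\<lambda>z. h' z * f' (B z))
        = L2_inner circle (\<lambda>z. \<Sum>j\<in>J. S j h z * T j f (B z)) (\<lambda>z. h' z * f' (B z))"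
      by (rule L2_inner_cong_AE[OF model_space_L2[OF AM[OF hf]] L2_subspace_sum[OF L2_subspace_UNIV STL]
            model_space_L2[OF hf'] model_space_L2[OF hf'] A_eq]) simp
    also have "\<dots> = (\<Sum>j\<in>J. L2_inner circle (\<lambda>z. S j h z * T j f (B z)) (\<lambda>z. h' z * f' (B z)))"
      by (rule L2_inner_sum_left[OF a_finite STL model_space_L2[OF hf']])
    also have "\<dots> = (\<Sum>j\<in>J. L2_inner circle (S j h) h' * L2_inner circle (T j f) f')"
      by (intro sum.cong refl
          inner_model_space_mult_compose[OF B SK[OF h(1)] h'(1) model_space_L2[OF TL[OF f(1)]] model_space_L2[OF f'(1)]])
    \<comment> \<open>The factored inner products are the coefficients of the expansion formula,
      which is read here from right to left.\<close>
    also have "\<dots> = (LINT z|circle. (\<psi> z * h z * cnj (h' z)) * (\<lambda>z. \<phi> z * f z * cnj (f' z)) (B z))"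
      unfolding s t
      by (rule integral_mult_compose_expand[OF B nc u v a_finite, symmetric])
         (use S_zero[OF _ h(1) h'(1)] s in simp)
    also have "\<dots> = L2_inner circle (\<lambda>z. ?\<Phi> z * (h z * f (B z))) (\<lambda>z. h' z * f' (B z))"
      by (simp add: L2_inner_def mult_ac)
    finally show ?thesis .
  qed
  have G_inf: "g \<in> hardy_inf" if "g \<in> G" for g
    using that hardy_inf_mult[OF model_power_hardy_inf[OF B] compose_hardy_inf[OF B nc model_power_hardy_inf[OF \<Theta>]]]
    unfolding G_def by blast
  \<comment> \<open>First extension: with the symbol moved to the bounded function \<open>g\<close>,
    the right side is an inner product of \<open>f\<close> with a fixed \<open>L2\<close> function
    and so is continuous in \<open>f\<close>.\<close>
  have A_G: "L2_inner circle (A f) g = L2_inner circle f (\<lambda>z. cnj (?\<Phi> z) * g z)" if f: "f \<in> ?M" and g: "g \<in> G" for f g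
  proof -
    have gL: "g \<in> L2 circle" using g GM model_space_L2 by blast
    have \<Phi>g: "(\<lambda>z. cnj (?\<Phi> z) * g z) \<in> L2 circle"
      by (rule L2_mult_hardy_inf[OF L2_cnj[OF c] G_inf[OF g]])
    obtain D where D: "D \<ge> 0" "\<And>f. f \<in> ?M \<Longrightarrow> L2_norm circle (A f) \<le> D * L2_norm circle f"
      using bounded_operator_bound[OF A] by blast
    have "L2_inner circle (A f) g - L2_inner circle f (\<lambda>z. cnj (?\<Phi> z) * g z) = 0"
    proof (rule functional_eq_0[OF M GM G_dense _ _ _ f])
      show "L2_inner circle (A (\<lambda>x. f x + c * k x)) g - L2_inner circle (\<lambda>x. f x + c * k x) (\<lambda>z. cnj (?\<Phi> z) * g z)
          = L2_inner circle (A f) g - L2_inner circle f (\<lambda>z. cnj (?\<Phi> z) * g z)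
          + c * (L2_inner circle (A k) g - L2_inner circle k (\<lambda>z. cnj (?\<Phi> z) * g z))"
        if "f \<in> ?M" "k \<in> ?M" for f k c
        using bounded_operator_inner[OF A M M that gL, of c]
          L2_inner_lincomb_left[OF model_space_L2[OF that(1)] model_space_L2[OF that(2)] \<Phi>g, of 1 c]
        by (simp add: algebra_simps)
      show "cmod (L2_inner circle (A f) g - L2_inner circle f (\<lambda>z. cnj (?\<Phi> z) * g z))
          \<le> (D * L2_norm circle g + L2_norm circle (\<lambda>z. cnj (?\<Phi> z) * g z)) * L2_norm circle f" if f: "f \<in> ?M" for f
      proof -
        have "cmod (L2_inner circle (A f) g) \<le> (D * L2_norm circle f) * L2_norm circle g"
          by (rule order_trans[OF L2_Cauchy_Schwarz[OF model_space_L2[OF AM[OF f]] gL] mult_right_mono[OF D(2)[OF f]]]) simp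
        from norm_triangle_le_diff[OF add_mono[OF this L2_Cauchy_Schwarz[OF model_space_L2[OF f] \<Phi>g]]]
        show ?thesis by (simp add: algebra_simps)
      qed
      show "L2_inner circle (A k) g - L2_inner circle k (\<lambda>z. cnj (?\<Phi> z) * g z) = 0" if k: "k \<in> G" for k
      proof -
        obtain m n where k: "k = (\<lambda>z. model_power B m z * model_power \<Theta> n (B z))"
          using k unfolding G_def by blast
        obtain m' n' where g: "g = (\<lambda>z. model_power B m' z * model_power \<Theta> n' (B z))"
          using g unfolding G_def by blast
        show ?thesis
          unfolding k g using A_gen[OF refl refl refl refl, of m n m' n']
          by (simp only: L2_inner_mult_left_cnj) simp
      qed
    qed
    then show ?thesis by simp
  qed
  \<comment> \<open>Second extension: for bounded \<open>f\<close> the product with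
    \<open>?\<Phi>\<close> is in \<open>L2\<close>, so the identity is continuous in
    \<open>k\<close> and can be extended from the products to the whole model space.\<close>
  have A_ext: "tto_extension (\<Theta> \<circ> B) ?\<Phi> A"
  proof (rule tto_extensionI[OF \<Theta>B c A])
    fix f k assume f: "f \<in> ?M" "f \<in> hardy_inf" and k: "k \<in> ?M"
    have \<Phi>f: "(\<lambda>z. ?\<Phi> z * f z) \<in> L2 circle" by (rule L2_mult_hardy_inf[OF c f(2)])
    have d: "(\<lambda>z. A f z - ?\<Phi> z * f z) \<in> L2 circle"
      by (rule L2_diff[OF model_space_L2[OF AM[OF f(1)]] \<Phi>f])
    \<comment> \<open>\<open>k\<close> is put in the first slot, where the inner product is linear
      as \<open>functional_eq_0\<close> demands.\<close>
    have "L2_inner circle k (\<lambda>z. A f z - ?\<Phi> z * f z) = 0"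
    proof (rule functional_eq_0[OF M GM G_dense _ _ _ k])
      show "L2_inner circle (\<lambda>x. g x + c * h x) (\<lambda>z. A f z - ?\<Phi> z * f z)
          = L2_inner circle g (\<lambda>z. A f z - ?\<Phi> z * f z) + c * L2_inner circle h (\<lambda>z. A f z - ?\<Phi> z * f z)"
        if "g \<in> ?M" "h \<in> ?M" for g h c
        using L2_inner_lincomb_left[OF model_space_L2[OF that(1)] model_space_L2[OF that(2)] d, of 1 c] by simp
      show "cmod (L2_inner circle g (\<lambda>z. A f z - ?\<Phi> z * f z)) \<le> L2_norm circle (\<lambda>z. A f z - ?\<Phi> z * f z) * L2_norm circle g"
        if "g \<in> ?M" for g
        using L2_Cauchy_Schwarz[OF model_space_L2[OF that] d] by (simp add: mult.commute)
      show "L2_inner circle g (\<lambda>z. A f z - ?\<Phi> z * f z) = 0" if g: "g \<in> G" for g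
      proof -
        have gL: "g \<in> L2 circle" using g GM model_space_L2 by blast
        have "L2_inner circle (\<lambda>z. A f z - ?\<Phi> z * f z) g
            = L2_inner circle (A f) g - L2_inner circle (\<lambda>z. ?\<Phi> z * f z) g"
          by (rule L2_inner_diff_left[OF model_space_L2[OF AM[OF f(1)]] \<Phi>f gL])
        also have "\<dots> = 0"
          unfolding A_G[OF f(1) g] L2_inner_mult_left_cnj by simp
        finally show ?thesis
          unfolding L2_inner_commute[of circle g "\<lambda>z. A f z - ?\<Phi> z * f z"] by simp
      qed
    qed
    then have "L2_inner circle (\<lambda>z. A f z - ?\<Phi> z * f z) k = 0"
      unfolding L2_inner_commute[of circle "\<lambda>z. A f z - ?\<Phi> z * f z" k] by simp
    then show "L2_inner circle (A f) k = L2_inner circle (\<lambda>z. ?\<Phi> z * f z) k"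
      unfolding L2_inner_diff_left[OF model_space_L2[OF AM[OF f(1)]] \<Phi>f model_space_L2[OF k]] by simp
  qed
  then have bounded: "tto_bounded (\<Theta> \<circ> B) ?\<Phi>"
    unfolding tto_bounded_def by (intro exI)
  note ext = tto_extension_tto[OF bounded]
  \<comment> \<open>\<open>tto\<close> is an arbitrary choice of extension, so it is compared with
    \<open>A\<close> on bounded functions whose span is dense in the model space.\<close>
  have tto_A: "AE z in circle. tto (\<Theta> \<circ> B) ?\<Phi> f z = A f z" if f: "f \<in> ?M" for f
  proof (rule bounded_operator_agree[OF _ A M M _ _ _ f])
    show "bounded_operator circle ?M circle ?M (tto (\<Theta> \<circ> B) ?\<Phi>)"
      using ext by (simp add: tto_extension_def)
    show "range (model_power (\<Theta> \<circ> B)) \<subseteq> ?M"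
      using model_power_in_model_space[OF \<Theta>B] by blast
    show "?M \<subseteq> L2_closure circle (lspan (range (model_power (\<Theta> \<circ> B))))"
      unfolding L2_closure_model_power[OF \<Theta>B] by (rule order_refl)
    fix g assume "g \<in> range (model_power (\<Theta> \<circ> B))"
    then have g: "g \<in> ?M \<inter> hardy_inf"
      using model_power_in_model_space[OF \<Theta>B] model_power_hardy_inf[OF \<Theta>B] by blast
    have "AE z in circle. tto (\<Theta> \<circ> B) ?\<Phi> g z = L2_proj circle ?M (\<lambda>w. ?\<Phi> w * g w) z"
      using ext g unfolding tto_extension_def by blast
    moreover have "AE z in circle. A g z = L2_proj circle ?M (\<lambda>w. ?\<Phi> w * g w) z"
      using A_ext g unfolding tto_extension_def by blast
    ultimately show "AE z in circle. tto (\<Theta> \<circ> B) ?\<Phi> g z = A g z"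
      by eventually_elim simp
  qed
  \<comment> \<open>Both \<open>F\<close> and \<open>R F\<close> lie in the tensor product of the
    model spaces, where the restriction \<open>omega\<close> has the values of
    \<open>Omega B\<close>; the pair of their images is in the relation that defines
    \<open>A\<close>.\<close>
  have "AE z in circle. tto (\<Theta> \<circ> B) ?\<Phi> (omega B \<Theta> F) z = omega B \<Theta> (R F) z" if F: "F \<in> ?TS" for F
  proof -
    have "omega B \<Theta> F = ?W F" "omega B \<Theta> (R F) = ?W (R F)"
      using F RTS[OF F] by (simp_all add: omega_def)
    with tto_A[OF WM[OF F]] AP[OF P_W[OF F]] show ?thesis
      by (auto elim!: eventually_elim2)
  qed
  with bounded show ?thesis
    unfolding R_def S_def T_def by blast
qed

end
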